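(* Let $d\geq 1$ be an integer and let $\mathbb{S}^{2d+1}\subseteq\mathbb{R}^{2d+2}$ be the unit sphere. For $s\in(0,2d+1)$ and a positive integer $n$ let \[ C_{s,2d+1,n}=\frac{V_{s}(\mathbb{S}^{2d+1})\,n^{2}-\min_{\omega_n}\mathcal{E}_{s}(\omega_{n})}{n^{1+\frac{s}{2d+1}}}, \] where the minimum is over all $n$-point configurations $\omega_n=\{x_1,\ldots,x_n\}\subseteq\mathbb{S}^{2d+1}$. Then \[ \limsup_{n\to\infty} C_{2,2d+1,n}\geq \frac{3^{1 - \frac{2}{2d+1}} (2d-1)^{1 - \frac{2}{2d+1}} (2d+1)\, \Gamma\left( d- \frac{1}{2} \right)^{2 - \frac{2}{2d+1}}}{2^{4 - \frac{2}{2d+1}} (d!)^{2 - \frac{4}{2d+1}}}, \] and the right-hand side tends to $\frac{3}{4e}$ as $d\to\infty$.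
   Context: For a finite set $\omega_n=\{x_1,\ldots,x_n\}\subseteq\mathbb{R}^m$ and $s>0$, the Riesz $s$-energy is $\mathcal{E}_s(\omega_n)=\sum_{i\neq j}\|x_i-x_j\|^{-s}$ (sum over ordered pairs of distinct indices). For $0<s<d'$, $V_s(\mathbb{S}^{d'})=\frac{1}{\mathrm{Vol}(\mathbb{S}^{d'})^2}\int_{\mathbb{S}^{d'}}\int_{\mathbb{S}^{d'}}\|p-q\|^{-s}\,dp\,dq=2^{d'-s-1}\frac{\Gamma\left(\frac{d'+1}{2}\right)\Gamma\left(\frac{d'-s}{2}\right)}{\sqrt{\pi}\,\Gamma\left(d'-\frac{s}{2}\right)}$ is the continuous $s$-energy of the normalized uniform measure on $\mathbb{S}^{d'}$. *)

theory Defs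
  imports "HOL-Analysis.Analysis"
begin

text \<open>Points of R^m are represented as functions nat => real vanishing outside {..<m},
  since the ambient dimension 2d+2 varies with d inside the statement.\<close>

definition unit_sphere_pts :: "nat \<Rightarrow> (nat \<Rightarrow> real) set" where
  "unit_sphere_pts m = {p. (\<forall>k\<ge>m. p k = 0) \<and> (\<Sum>k<m. (p k)\<^sup>2) = 1}"

definition edist :: "nat \<Rightarrow> (nat \<Rightarrow> real) \<Rightarrow> (nat \<Rightarrow> real) \<Rightarrow> real" where
  "edist m p q = sqrt (\<Sum>k<m. (p k - q k)\<^sup>2)"

definition riesz_energy :: "nat \<Rightarrow> real \<Rightarrow> nat \<Rightarrow> (nat \<Rightarrow> nat \<Rightarrow> real) \<Rightarrow> real" where
  "riesz_energy m s n x = (\<Sum>i<n. \<Sum>j\<in>{..<n} - {i}. (edist m (x i) (x j)) powr (- s))"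

definition min_energy :: "nat \<Rightarrow> real \<Rightarrow> nat \<Rightarrow> real" where
  "min_energy m s n = Inf {riesz_energy m s n x | x.
      inj_on x {..<n} \<and> (\<forall>i<n. x i \<in> unit_sphere_pts m)}"

text \<open>Continuous s-energy V_s(S^{d'}) of the normalized uniform measure, via the closed form.\<close>
definition V_sphere :: "nat \<Rightarrow> real \<Rightarrow> real" where
  "V_sphere d' s = 2 powr (real d' - s - 1) * Gamma ((real d' + 1) / 2) * Gamma ((real d' - s) / 2)
      / (sqrt pi * Gamma (real d' - s / 2))"

definition C_const :: "real \<Rightarrow> nat \<Rightarrow> nat \<Rightarrow> real" where
  "C_const s d' n = (V_sphere d' s * (real n)\<^sup>2 - min_energy (d' + 1) s n)
      / (real n) powr (1 + s / real d')"

definition bound_1p2 :: "nat \<Rightarrow> real" where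
  "bound_1p2 d = (let e = 2 / (2 * real d + 1) in
     3 powr (1 - e) * (2 * real d - 1) powr (1 - e) * (2 * real d + 1)
       * Gamma (real d - 1/2) powr (2 - e)
     / (2 powr (4 - e) * (fact d) powr (2 - 2 * e)))"

end

(* Pull back a determinantal point process from CP^d to S^(2d+1): choose N = (L + d choose d) points
   of CP^d with joint weight |det (p_j^alpha)|^2, alpha running over the monomials of degree L, and put k
   equally spaced points, randomly rotated, on each fibre circle.  Two distinct fibres through p and q
   then interact with average energy k^2 / (2 sqrt (1 - t)), t = |<p,q>|^2, and the process has pair
   correlation N^2 (1 - t^L), so the expected energy is at most
     N k^3 / 12 + k^2 N^2 (V - (d/2) Beta (L + 1) (d - 1/2)).
   The bound follows with k ~ kappa sqrt L for the optimal kappa.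

   No measure theory on spheres is used.  The invariant measure of CP^d is replaced by finite grids
   (lattice points of the simplex for the |p_i|^2, roots of unity for the phases) for which distinct
   monomials of equal degree are exactly orthogonal; only their norms converge.  Since
   (1 - t^L) / sqrt (1 - t) is singular, it is bounded by the positive-coefficient partial sums of
   sum_m c_m (t^m - t^(m+L)), up to an error L c_(M+1) that is uniform in t. *)
theory Submission
  imports Defs "HOL-Real_Asymp.Real_Asymp"
begin

section \<open>Determinantal averages over a finite set\<close>

text \<open>Why k is of order sqrt L: N is about L^d / d! and the Beta value decays like L^(1/2 -
  d), so with this k the loss N k^3 / 12 and the gain k^2 N^2 Beta are both of order L^(d + 3/2).
  For n = N k, of order L^(d + 1/2), this is n^(1 + 2/(2d+1)), the normalisation in
  \<open>C_const\<close>. A bound along the values n = N k is enough for a limsup. The price of a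
  finite grid is the loss of unitary invariance: monomial norms are only approximately right, so the
  kernel is not exactly <p,q>^L, and the interaction, singular at t = 1, could amplify the error.
  Lagrange's identity removes this danger: K(u,u) K(v,v) - |K(u,v)|^2 is a sum of squares whose
  coefficients increase with the monomial weights. Raising the weights to a multiple of the
  multinomial ones costs one factor close to 1, uniformly in both points. The limits are taken in a
  fixed order: for given L and M the grid is refined, then M grows, and L grows last. The rotations
  of the fibres come from K-th roots of unity, with K tending to infinity for each configuration
  separately.\<close>

definition slater :: "(nat \<Rightarrow> 'x \<Rightarrow> complex) \<Rightarrow> nat \<Rightarrow> (nat \<Rightarrow> 'x) \<Rightarrow> complex" where
  "slater \<phi> N x = (\<Sum>\<pi> | \<pi> permutes {..<N}. of_int (sign \<pi>) * (\<Prod>l<N. \<phi> (\<pi> l) (x l)))"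

lemma sum_permutes_comp_transpose:
  assumes "i < (N::nat)" "j < N"
  shows "(\<Sum>\<pi> | \<pi> permutes {..<N}. g (\<pi> \<circ> Transposition.transpose i j)) = (\<Sum>\<pi> | \<pi> permutes {..<N}. g \<pi>)"
  by (metis sum_permutations_compose_right permutes_swap_id assms lessThan_iff)

lemma sign_comp_transpose:
  assumes "\<pi> permutes {..<N::nat}" "i \<noteq> j"
  shows "sign (\<pi> \<circ> Transposition.transpose i j) = - sign \<pi>"
proof -
  have "permutation \<pi>" using assms(1) permutation_permutes by blast
  then show ?thesis using assms(2) by (simp add: sign_compose permutation_swap_id sign_swap_id)
qed

lemma prod_two_factors:
  fixes g :: "nat \<Rightarrow> 'a::comm_monoid_mult"
  assumes "i < N" "j < N" "i \<noteq> j"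
  shows "(\<Prod>l<N. g l) = g i * g j * (\<Prod>l\<in>{..<N}-{i,j}. g l)"
proof -
  have "{..<N} = insert i (insert j ({..<N}-{i,j}))" using assms by auto
  then have "(\<Prod>l<N. g l) = (\<Prod>l\<in>insert i (insert j ({..<N}-{i,j})). g l)" by simp
  also have "\<dots> = g i * (g j * (\<Prod>l\<in>{..<N}-{i,j}. g l))"
    using assms by (subst prod.insert; simp)+
  finally show ?thesis by (simp add: mult.assoc)
qed

text \<open>Swapping \<open>i\<close> and \<open>j\<close> flips every sign and keeps every product,
  since the factor \<open>c\<close> comes out either way; the sum is its own negative. Consequently
  a configuration of nonzero weight cannot have two points on one fibre.\<close>

lemma slater_eq_0:
  assumes ij: "i < N" "j < N" "i \<noteq> j"
    and pr: "\<And>a. a < N \<Longrightarrow> \<phi> a (x i) = c * \<phi> a (x j)"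
  shows "slater \<phi> N x = 0"
proof -
  define t where "t = Transposition.transpose i j"
  have *: "of_int (sign (\<pi> \<circ> t)) * (\<Prod>l<N. \<phi> ((\<pi> \<circ> t) l) (x l))
      = - (of_int (sign \<pi>) * (\<Prod>l<N. \<phi> (\<pi> l) (x l)))" if \<pi>: "\<pi> permutes {..<N}" for \<pi>
  proof -
    have "sign (\<pi> \<circ> t) = - sign \<pi>"
      using \<pi> ij unfolding t_def by (simp add: sign_comp_transpose)
    moreover have "(\<Prod>l<N. \<phi> ((\<pi> \<circ> t) l) (x l)) = (\<Prod>l<N. \<phi> (\<pi> l) (x l))"
    proof -
      have "(\<Prod>l\<in>{..<N}-{i,j}. \<phi> ((\<pi> \<circ> t) l) (x l)) = (\<Prod>l\<in>{..<N}-{i,j}. \<phi> (\<pi> l) (x l))"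
        by (rule prod.cong) (auto simp: t_def)
      moreover have "\<pi> i < N" "\<pi> j < N" using permutes_in_image[OF \<pi>] ij by auto
      ultimately show ?thesis
        using ij pr by (subst (1 2) prod_two_factors[OF ij]) (simp add: t_def)
    qed
    ultimately show ?thesis by simp
  qed
  have "slater \<phi> N x = (\<Sum>\<pi> | \<pi> permutes {..<N}. of_int (sign (\<pi> \<circ> t)) * (\<Prod>l<N. \<phi> ((\<pi> \<circ> t) l) (x l)))"
    unfolding slater_def t_def
    by (rule sum_permutes_comp_transpose[symmetric, OF ij(1,2),
          where g = "\<lambda>\<pi>. of_int (sign \<pi>) * (\<Prod>l<N. \<phi> (\<pi> l) (x l))"])
  also have "\<dots> = - slater \<phi> N x"
    unfolding slater_def sum_negf[symmetric] by (rule sum.cong) (use * in auto)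
  finally show ?thesis by simp
qed

text \<open>All coordinates except the two coupled by \<open>F\<close> can be summed
  independently.\<close>

lemma sum_PiE_two_point:
  fixes f :: "nat \<Rightarrow> 'x \<Rightarrow> complex"
  assumes X: "finite X" and ij: "i < N" "j < N" "i \<noteq> j"
  shows "(\<Sum>x\<in>PiE {..<N} (\<lambda>_. X). F (x i) (x j) * (\<Prod>l<N. f l (x l)))
    = (\<Sum>u\<in>X. \<Sum>v\<in>X. F u v * f i u * f j v) * (\<Prod>l\<in>{..<N}-{i,j}. \<Sum>u\<in>X. f l u)"
proof -
  \<comment> \<open>Pinning coordinates \<open>i\<close> and \<open>j\<close> to \<open>u\<close>
    and \<open>v\<close> turns the summand into a pure product, to which \<open>prod_sum_PiE\<close>
    applies.\<close>
  define \<delta> where "\<delta> u v l y = (if l = i then if y = u then f l y else 0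
     else if l = j then if y = v then f l y else 0 else f l y)" for u v l y
  have split: "F (x i) (x j) * (\<Prod>l<N. f l (x l)) = (\<Sum>u\<in>X. \<Sum>v\<in>X. F u v * (\<Prod>l<N. \<delta> u v l (x l)))"
    if x: "x \<in> PiE {..<N} (\<lambda>_. X)" for x
  proof -
    have xi: "x i \<in> X" "x j \<in> X" using x ij by auto
    have "F u v * (\<Prod>l<N. \<delta> u v l (x l)) = (if v = x j then if u = x i then F (x i) (x j) * (\<Prod>l<N. f l (x l)) else 0 else 0)" for u v
    proof -
      have "(\<Prod>l\<in>{..<N}-{i,j}. \<delta> u v l (x l)) = (\<Prod>l\<in>{..<N}-{i,j}. f l (x l))"
        by (rule prod.cong) (auto simp: \<delta>_def)
      then show ?thesis using ij by (subst (1 2) prod_two_factors[OF ij]) (auto simp: \<delta>_def)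
    qed
    then show ?thesis using X xi by simp
  qed
  have "(\<Sum>x\<in>PiE {..<N} (\<lambda>_. X). F (x i) (x j) * (\<Prod>l<N. f l (x l)))
    = (\<Sum>x\<in>PiE {..<N} (\<lambda>_. X). \<Sum>u\<in>X. \<Sum>v\<in>X. F u v * (\<Prod>l<N. \<delta> u v l (x l)))"
    by (rule sum.cong) (use split in auto)
  also have "\<dots> = (\<Sum>u\<in>X. \<Sum>v\<in>X. F u v * (\<Sum>x\<in>PiE {..<N} (\<lambda>_. X). (\<Prod>l<N. \<delta> u v l (x l))))"
    unfolding sum_distrib_left by (subst sum.swap, rule sum.cong[OF refl], rule sum.swap)
  also have "\<dots> = (\<Sum>u\<in>X. \<Sum>v\<in>X. F u v * (\<Prod>l<N. \<Sum>y\<in>X. \<delta> u v l y))"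
    by (subst prod_sum_PiE) (use X in auto)
  also have "\<dots> = (\<Sum>u\<in>X. \<Sum>v\<in>X. F u v * f i u * f j v * (\<Prod>l\<in>{..<N}-{i,j}. \<Sum>u\<in>X. f l u))"
  proof (intro sum.cong refl)
    fix u v assume uv: "u \<in> X" "v \<in> X"
    have "(\<Prod>l\<in>{..<N}-{i,j}. \<Sum>y\<in>X. \<delta> u v l y) = (\<Prod>l\<in>{..<N}-{i,j}. \<Sum>y\<in>X. f l y)"
      by (intro prod.cong sum.cong) (auto simp: \<delta>_def)
    moreover have "(\<Sum>y\<in>X. \<delta> u v i y) = f i u" "(\<Sum>y\<in>X. \<delta> u v j y) = f j v"
      using uv X ij by (simp_all add: \<delta>_def)
    ultimately show "F u v * (\<Prod>l<N. \<Sum>y\<in>X. \<delta> u v l y) = F u v * f i u * f j v * (\<Prod>l\<in>{..<N}-{i,j}. \<Sum>u\<in>X. f l u)"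
      by (subst prod_two_factors[OF ij]) simp
  qed
  finally show ?thesis by (simp add: sum_distrib_right)
qed

text \<open>This identifies the pairs of permutations that survive when a product of two Leibniz
  expansions is summed over all coordinates but two.\<close>

lemma permutes_eq_off_two:
  assumes p: "\<pi> permutes {..<N::nat}" "\<sigma> permutes {..<N}" and ij: "i < N" "j < N" "i \<noteq> j"
    and eq: "\<And>l. l \<in> {..<N}-{i,j} \<Longrightarrow> \<pi> l = \<sigma> l"
  shows "\<sigma> = \<pi> \<or> \<sigma> = \<pi> \<circ> Transposition.transpose i j"
proof -
  have inj: "inj \<pi>" "inj \<sigma>" using p by (auto simp: permutes_inj)
  have out: "\<sigma> l = l" "\<pi> l = l" if "\<not> l < N" for l using p that by (auto simp: permutes_def)
  have A: "\<sigma> l = \<pi> l" if "l \<noteq> i" "l \<noteq> j" for l using eq[of l] out[of l] that by (cases "l < N") auto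
  have im: "\<sigma> l \<in> {\<pi> i, \<pi> j}" if "l = i \<or> l = j" for l
  proof -
    have "surj \<pi>" using p permutes_surj by auto
    then obtain m where m: "\<sigma> l = \<pi> m" by (metis surjD)
    have "m = i \<or> m = j"
    proof (rule ccontr)
      assume n: "\<not> ?thesis"
      then have "\<sigma> m = \<sigma> l" using A[of m] m by simp
      then have "m = l" using inj by (simp add: inj_eq)
      then show False using n that by auto
    qed
    then show ?thesis using m by auto
  qed
  have ne: "\<sigma> i \<noteq> \<sigma> j" using inj ij by (simp add: inj_eq)
  show ?thesis
  proof (cases "\<sigma> i = \<pi> i")
    case True
    then have "\<sigma> j = \<pi> j" using im[of j] ne by auto
    then have "\<sigma> = \<pi>" using A True by (metis ext)
    then show ?thesis by simp
  next
    case False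
    then have s: "\<sigma> i = \<pi> j" "\<sigma> j = \<pi> i" using im[of i] im[of j] ne by auto
    have "\<sigma> = \<pi> \<circ> Transposition.transpose i j"
    proof
      fix l show "\<sigma> l = (\<pi> \<circ> Transposition.transpose i j) l"
        using A[of l] s by (cases "l = i"; cases "l = j") auto
    qed
    then show ?thesis by simp
  qed
qed

text \<open>The reference measure is counting measure on \<open>X\<close>; any normalisation is
  absorbed into the functions \<open>\<phi>\<close>.\<close>

locale finite_orthonormal =
  fixes X :: "'x set" and \<phi> :: "nat \<Rightarrow> 'x \<Rightarrow> complex" and N :: nat
  assumes finX: "finite X"
    and ortho: "\<And>a b. a < N \<Longrightarrow> b < N \<Longrightarrow> (\<Sum>x\<in>X. \<phi> a x * cnj (\<phi> b x)) = (if a = b then 1 else 0)"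
begin

lemma cmod_slater_sq:
  "complex_of_real ((cmod (slater \<phi> N x))\<^sup>2) = (\<Sum>\<pi> | \<pi> permutes {..<N}. \<Sum>\<sigma> | \<sigma> permutes {..<N}.
     of_int (sign \<pi> * sign \<sigma>) * (\<Prod>l<N. \<phi> (\<pi> l) (x l) * cnj (\<phi> (\<sigma> l) (x l))))"
  unfolding complex_norm_square slater_def cnj_sum sum_product
  by (intro sum.cong refl) (simp add: prod.distrib mult_ac)

text \<open>Normalising constant of the process: orthonormality kills every pair of distinct
  permutations, and each of the \<open>fact N\<close> diagonal pairs contributes 1.\<close>

lemma sum_slater_sq: "(\<Sum>x\<in>PiE {..<N} (\<lambda>_. X). (cmod (slater \<phi> N x))\<^sup>2) = fact N"
proof -
  let ?P = "{\<pi>. \<pi> permutes {..<N}}"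
  have finP: "finite ?P" by (simp add: finite_permutations)
  have one: "of_int (sign \<pi> * sign \<sigma>) * (\<Prod>l<N. \<Sum>x\<in>X. \<phi> (\<pi> l) x * cnj (\<phi> (\<sigma> l) x)) = (if \<sigma> = \<pi> then 1 else 0 :: complex)"
    if p: "\<pi> \<in> ?P" "\<sigma> \<in> ?P" for \<pi> \<sigma>
  proof -
    have lt: "\<pi> l < N" "\<sigma> l < N" if "l < N" for l
      using p that permutes_in_image[of \<pi> "{..<N}" l] permutes_in_image[of \<sigma> "{..<N}" l] by auto
    have "(\<Prod>l<N. \<Sum>x\<in>X. \<phi> (\<pi> l) x * cnj (\<phi> (\<sigma> l) x)) = (\<Prod>l<N. if \<pi> l = \<sigma> l then 1 else 0)"
      by (rule prod.cong) (auto simp: ortho lt)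
    also have "\<dots> = (if \<sigma> = \<pi> then 1 else 0)"
    proof (cases "\<sigma> = \<pi>")
      case False
      then obtain l where "\<sigma> l \<noteq> \<pi> l" by auto
      then have "l < N" using p by (force simp: permutes_def)
      then show ?thesis using False \<open>\<sigma> l \<noteq> \<pi> l\<close> by (auto intro!: prod_zero)
    qed simp
    finally show ?thesis by (simp flip: of_int_mult add: sign_idempotent)
  qed
  have "complex_of_real (\<Sum>x\<in>PiE {..<N} (\<lambda>_. X). (cmod (slater \<phi> N x))\<^sup>2)
     = (\<Sum>x\<in>PiE {..<N} (\<lambda>_. X). \<Sum>\<pi>\<in>?P. \<Sum>\<sigma>\<in>?P. of_int (sign \<pi> * sign \<sigma>) * (\<Prod>l<N. \<phi> (\<pi> l) (x l) * cnj (\<phi> (\<sigma> l) (x l))))"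
    by (simp only: of_real_sum cmod_slater_sq)
  also have "\<dots> = (\<Sum>\<pi>\<in>?P. \<Sum>\<sigma>\<in>?P. of_int (sign \<pi> * sign \<sigma>) * (\<Sum>x\<in>PiE {..<N} (\<lambda>_. X). \<Prod>l<N. \<phi> (\<pi> l) (x l) * cnj (\<phi> (\<sigma> l) (x l))))"
    unfolding sum_distrib_left by (subst sum.swap, rule sum.cong[OF refl], rule sum.swap)
  also have "\<dots> = (\<Sum>\<pi>\<in>?P. \<Sum>\<sigma>\<in>?P. of_int (sign \<pi> * sign \<sigma>) * (\<Prod>l<N. \<Sum>x\<in>X. \<phi> (\<pi> l) x * cnj (\<phi> (\<sigma> l) x)))"
    by (subst prod_sum_PiE) (use finX in auto)
  also have "\<dots> = (\<Sum>\<pi>\<in>?P. \<Sum>\<sigma>\<in>?P. if \<sigma> = \<pi> then 1 else 0)"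
    by (intro sum.cong refl one)
  also have "\<dots> = of_nat (card ?P)" using finP by simp
  also have "card ?P = fact N" by (simp add: card_permutations)
  finally have "complex_of_real (\<Sum>x\<in>PiE {..<N} (\<lambda>_. X). (cmod (slater \<phi> N x))\<^sup>2) = complex_of_real (fact N)" by simp
  then show ?thesis by (simp only: of_real_eq_iff)
qed

text \<open>For each \<open>\<pi>\<close> only \<open>\<sigma> = \<pi>\<close> and
  \<open>\<sigma> = \<pi> \<circ> t\<close> survive, the latter with opposite sign; together they
  form a 2 by 2 determinant in the two remaining coordinates.\<close>

lemma sum_slater_sq_pair:
  fixes F :: "'x \<Rightarrow> 'x \<Rightarrow> real"
  assumes ij: "i < N" "j < N" "i \<noteq> j"
  shows "complex_of_real (\<Sum>x\<in>PiE {..<N} (\<lambda>_. X). F (x i) (x j) * (cmod (slater \<phi> N x))\<^sup>2)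
    = (\<Sum>\<pi> | \<pi> permutes {..<N}. \<Sum>u\<in>X. \<Sum>v\<in>X. of_real (F u v) *
        (\<phi> (\<pi> i) u * \<phi> (\<pi> j) v * (cnj (\<phi> (\<pi> i) u) * cnj (\<phi> (\<pi> j) v) - cnj (\<phi> (\<pi> j) u) * cnj (\<phi> (\<pi> i) v))))"
proof -
  let ?P = "{\<pi>. \<pi> permutes {..<N}}"
  define t where "t = Transposition.transpose i j"
  have finP: "finite ?P" by (simp add: finite_permutations)
  have tp: "\<pi> \<circ> t \<in> ?P" if "\<pi> \<in> ?P" for \<pi>
    using that permutes_swap_id[of i "{..<N}" j] ij by (auto simp: t_def intro: permutes_compose)
  have tne: "\<pi> \<circ> t \<noteq> \<pi>" if "\<pi> \<in> ?P" for \<pi>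
  proof
    assume "\<pi> \<circ> t = \<pi>"
    then have "\<pi> j = \<pi> i" by (metis comp_apply t_def transpose_apply_first)
    then show False using that ij by (metis inj_eq mem_Collect_eq permutes_inj)
  qed
  have sgn: "sign (\<pi> \<circ> t) = - sign \<pi>" if "\<pi> \<in> ?P" for \<pi>
    using that ij unfolding t_def by (simp add: sign_comp_transpose)
  define T where "T \<pi> \<sigma> = (\<Sum>u\<in>X. \<Sum>v\<in>X. of_real (F u v) * (\<phi> (\<pi> i) u * cnj (\<phi> (\<sigma> i) u)) * (\<phi> (\<pi> j) v * cnj (\<phi> (\<sigma> j) v)))" for \<pi> \<sigma>
  define R where "R \<pi> \<sigma> = of_int (sign \<pi> * sign \<sigma>) * (T \<pi> \<sigma> * (\<Prod>l\<in>{..<N}-{i,j}. \<Sum>x\<in>X. \<phi> (\<pi> l) x * cnj (\<phi> (\<sigma> l) x)))" for \<pi> \<sigma>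
  have lt: "\<pi> l < N" if "l < N" "\<pi> \<in> ?P" for l \<pi>
    using that permutes_in_image[of \<pi> "{..<N}" l] by auto
  have inner: "(\<Sum>\<sigma>\<in>?P. R \<pi> \<sigma>) = T \<pi> \<pi> - T \<pi> (\<pi> \<circ> t)" if p: "\<pi> \<in> ?P" for \<pi>
  proof -
    have "(\<Sum>\<sigma>\<in>?P. R \<pi> \<sigma>) = (\<Sum>\<sigma>\<in>{\<pi>, \<pi> \<circ> t}. R \<pi> \<sigma>)"
    proof (rule sum.mono_neutral_right)
      show "\<forall>\<sigma>\<in>?P - {\<pi>, \<pi> \<circ> t}. R \<pi> \<sigma> = 0"
      proof
        fix \<sigma> assume s: "\<sigma> \<in> ?P - {\<pi>, \<pi> \<circ> t}"
        then obtain l where l: "l \<in> {..<N}-{i,j}" "\<pi> l \<noteq> \<sigma> l"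
          using permutes_eq_off_two[of \<pi> N \<sigma> i j] p ij unfolding t_def by auto
        have "(\<Sum>x\<in>X. \<phi> (\<pi> l) x * cnj (\<phi> (\<sigma> l) x)) = 0"
          using l s p lt[of l \<sigma>] lt[of l \<pi>] ortho[of "\<pi> l" "\<sigma> l"] by auto
        then have "(\<Prod>l\<in>{..<N}-{i,j}. \<Sum>x\<in>X. \<phi> (\<pi> l) x * cnj (\<phi> (\<sigma> l) x)) = 0"
          using l by (intro prod_zero) auto
        then show "R \<pi> \<sigma> = 0" by (simp add: R_def)
      qed
    qed (use finP p tp in auto)
    also have "\<dots> = R \<pi> \<pi> + R \<pi> (\<pi> \<circ> t)" using tne[OF p] by (simp add: eq_commute)
    also have "R \<pi> \<pi> = T \<pi> \<pi>"
    proof -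
      have "(\<Prod>l\<in>{..<N}-{i,j}. \<Sum>x\<in>X. \<phi> (\<pi> l) x * cnj (\<phi> (\<pi> l) x)) = 1"
        by (rule prod.neutral) (use lt p ortho in auto)
      then show ?thesis by (simp add: R_def flip: of_int_mult add: sign_idempotent)
    qed
    also have "R \<pi> (\<pi> \<circ> t) = - T \<pi> (\<pi> \<circ> t)"
    proof -
      have "(\<Prod>l\<in>{..<N}-{i,j}. \<Sum>x\<in>X. \<phi> (\<pi> l) x * cnj (\<phi> ((\<pi> \<circ> t) l) x)) = 1"
        by (rule prod.neutral) (use lt p ortho in \<open>auto simp: t_def\<close>)
      then show ?thesis by (simp add: R_def sgn[OF p] flip: of_int_mult add: sign_idempotent)
    qed
    finally show ?thesis by simp
  qed
  have "complex_of_real (\<Sum>x\<in>PiE {..<N} (\<lambda>_. X). F (x i) (x j) * (cmod (slater \<phi> N x))\<^sup>2)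
     = (\<Sum>x\<in>PiE {..<N} (\<lambda>_. X). \<Sum>\<pi>\<in>?P. \<Sum>\<sigma>\<in>?P. of_int (sign \<pi> * sign \<sigma>) * (of_real (F (x i) (x j)) * (\<Prod>l<N. \<phi> (\<pi> l) (x l) * cnj (\<phi> (\<sigma> l) (x l)))))"
    by (simp only: of_real_sum of_real_mult cmod_slater_sq sum_distrib_left mult.left_commute)
  also have "\<dots> = (\<Sum>\<pi>\<in>?P. \<Sum>\<sigma>\<in>?P. of_int (sign \<pi> * sign \<sigma>) * (\<Sum>x\<in>PiE {..<N} (\<lambda>_. X). of_real (F (x i) (x j)) * (\<Prod>l<N. \<phi> (\<pi> l) (x l) * cnj (\<phi> (\<sigma> l) (x l)))))"
    unfolding sum_distrib_left by (subst sum.swap, rule sum.cong[OF refl], rule sum.swap)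
  also have "\<dots> = (\<Sum>\<pi>\<in>?P. \<Sum>\<sigma>\<in>?P. R \<pi> \<sigma>)"
    by (subst sum_PiE_two_point[OF finX ij, where F = "\<lambda>u v. of_real (F u v)"]) (simp add: R_def T_def)
  also have "\<dots> = (\<Sum>\<pi>\<in>?P. T \<pi> \<pi> - T \<pi> (\<pi> \<circ> t))" by (intro sum.cong refl inner)
  also have "\<dots> = (\<Sum>\<pi>\<in>?P. \<Sum>u\<in>X. \<Sum>v\<in>X. of_real (F u v) *
        (\<phi> (\<pi> i) u * \<phi> (\<pi> j) v * (cnj (\<phi> (\<pi> i) u) * cnj (\<phi> (\<pi> j) v) - cnj (\<phi> (\<pi> j) u) * cnj (\<phi> (\<pi> i) v))))"
    unfolding T_def t_def sum_subtractf[symmetric]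
    by (intro sum.cong refl) (simp add: algebra_simps)
  finally show ?thesis .
qed

text \<open>The right-hand side is the determinantal two-point function K(u,u) K(v,v) - |K(u,v)|^2
  for the projection kernel K of the functions \<open>\<phi>\<close>.\<close>

lemma sum_slater_sq_pairs:
  fixes F :: "'x \<Rightarrow> 'x \<Rightarrow> real"
  shows "(\<Sum>x\<in>PiE {..<N} (\<lambda>_. X). (\<Sum>i<N. \<Sum>j\<in>{..<N}-{i}. F (x i) (x j)) * (cmod (slater \<phi> N x))\<^sup>2)
    = fact N * (\<Sum>u\<in>X. \<Sum>v\<in>X. F u v * ((\<Sum>a<N. (cmod (\<phi> a u))\<^sup>2) * (\<Sum>a<N. (cmod (\<phi> a v))\<^sup>2)
         - (cmod (\<Sum>a<N. \<phi> a u * cnj (\<phi> a v)))\<^sup>2))"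
proof -
  let ?P = "{\<pi>. \<pi> permutes {..<N}}"
  define G where "G a b = (\<Sum>u\<in>X. \<Sum>v\<in>X. of_real (F u v) *
        (\<phi> a u * \<phi> b v * (cnj (\<phi> a u) * cnj (\<phi> b v) - cnj (\<phi> b u) * cnj (\<phi> a v))))" for a b
  have G0: "G a a = 0" for a by (simp add: G_def)
  have reindex: "(\<Sum>i<N. \<Sum>j<N. G (\<pi> i) (\<pi> j)) = (\<Sum>a<N. \<Sum>b<N. G a b)" if "\<pi> \<in> ?P" for \<pi>
  proof -
    have bij: "bij_betw \<pi> {..<N} {..<N}" using that by (simp add: permutes_imp_bij)
    have "(\<Sum>i<N. \<Sum>j<N. G (\<pi> i) (\<pi> j)) = (\<Sum>i<N. \<Sum>b<N. G (\<pi> i) b)"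
      by (intro sum.cong refl sum.reindex_bij_betw[OF bij])
    also have "\<dots> = (\<Sum>a<N. \<Sum>b<N. G a b)" by (rule sum.reindex_bij_betw[OF bij])
    finally show ?thesis .
  qed
  have "complex_of_real (\<Sum>x\<in>PiE {..<N} (\<lambda>_. X). (\<Sum>i<N. \<Sum>j\<in>{..<N}-{i}. F (x i) (x j)) * (cmod (slater \<phi> N x))\<^sup>2)
    = (\<Sum>i<N. \<Sum>j\<in>{..<N}-{i}. complex_of_real (\<Sum>x\<in>PiE {..<N} (\<lambda>_. X). F (x i) (x j) * (cmod (slater \<phi> N x))\<^sup>2))"
    unfolding sum_distrib_right of_real_sum
    by (subst sum.swap, rule sum.cong[OF refl], rule sum.swap)
  also have "\<dots> = (\<Sum>i<N. \<Sum>j\<in>{..<N}-{i}. \<Sum>\<pi>\<in>?P. G (\<pi> i) (\<pi> j))"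
    unfolding G_def by (intro sum.cong refl sum_slater_sq_pair) auto
  also have "\<dots> = (\<Sum>i<N. \<Sum>j<N. \<Sum>\<pi>\<in>?P. G (\<pi> i) (\<pi> j))"
    by (intro sum.cong refl sum.mono_neutral_left) (auto simp: G0)
  also have "\<dots> = (\<Sum>\<pi>\<in>?P. \<Sum>i<N. \<Sum>j<N. G (\<pi> i) (\<pi> j))"
    by (subst sum.swap, subst (2) sum.swap, rule sum.swap[symmetric, THEN trans], rule sum.swap)
  also have "\<dots> = of_nat (card ?P) * (\<Sum>a<N. \<Sum>b<N. G a b)" using reindex by simp
  also have "card ?P = fact N" by (simp add: card_permutations)
  also have "(\<Sum>a<N. \<Sum>b<N. G a b) = (\<Sum>u\<in>X. \<Sum>v\<in>X. \<Sum>a<N. \<Sum>b<N. of_real (F u v) *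
        (\<phi> a u * \<phi> b v * (cnj (\<phi> a u) * cnj (\<phi> b v) - cnj (\<phi> b u) * cnj (\<phi> a v))))"
    unfolding G_def by (simp only: sum.swap[of _ X "{..<N}"])
  also have "\<dots> = (\<Sum>u\<in>X. \<Sum>v\<in>X. of_real (F u v * ((\<Sum>a<N. (cmod (\<phi> a u))\<^sup>2) * (\<Sum>a<N. (cmod (\<phi> a v))\<^sup>2)
         - (cmod (\<Sum>a<N. \<phi> a u * cnj (\<phi> a v)))\<^sup>2)))"
  proof (intro sum.cong refl)
    fix u v
    have "(\<Sum>a<N. \<Sum>b<N. \<phi> a u * \<phi> b v * (cnj (\<phi> a u) * cnj (\<phi> b v) - cnj (\<phi> b u) * cnj (\<phi> a v)))
      = (\<Sum>a<N. \<phi> a u * cnj (\<phi> a u)) * (\<Sum>b<N. \<phi> b v * cnj (\<phi> b v))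
        - (\<Sum>a<N. \<phi> a u * cnj (\<phi> a v)) * (\<Sum>b<N. cnj (\<phi> b u) * \<phi> b v)"
      unfolding sum_product sum_subtractf[symmetric] by (intro sum.cong refl) (simp add: algebra_simps)
    then show "(\<Sum>a<N. \<Sum>b<N. of_real (F u v) * (\<phi> a u * \<phi> b v * (cnj (\<phi> a u) * cnj (\<phi> b v) - cnj (\<phi> b u) * cnj (\<phi> a v))))
      = of_real (F u v * ((\<Sum>a<N. (cmod (\<phi> a u))\<^sup>2) * (\<Sum>a<N. (cmod (\<phi> a v))\<^sup>2)
         - (cmod (\<Sum>a<N. \<phi> a u * cnj (\<phi> a v)))\<^sup>2))"
      unfolding sum_distrib_left[symmetric] of_real_mult of_real_diff of_real_sum complex_norm_square cnj_sum
      by simp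
  qed
  finally have "complex_of_real (\<Sum>x\<in>PiE {..<N} (\<lambda>_. X). (\<Sum>i<N. \<Sum>j\<in>{..<N}-{i}. F (x i) (x j)) * (cmod (slater \<phi> N x))\<^sup>2)
   = complex_of_real (fact N * (\<Sum>u\<in>X. \<Sum>v\<in>X. F u v * ((\<Sum>a<N. (cmod (\<phi> a u))\<^sup>2) * (\<Sum>a<N. (cmod (\<phi> a v))\<^sup>2)
         - (cmod (\<Sum>a<N. \<phi> a u * cnj (\<phi> a v)))\<^sup>2)))"
    by simp
  then show ?thesis by (simp only: of_real_eq_iff)
qed

text \<open>First moment argument: were every configuration of nonzero weight above the weighted
  mean, the mean would exceed itself. The witness keeps \<open>slater \<phi> N x \<noteq> 0\<close>,
  which later separates its points.\<close>

lemma exists_configuration: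
  fixes F :: "'x \<Rightarrow> 'x \<Rightarrow> real"
  shows "\<exists>x. (\<forall>i<N. x i \<in> X) \<and> slater \<phi> N x \<noteq> 0 \<and>
    (\<Sum>i<N. \<Sum>j\<in>{..<N}-{i}. F (x i) (x j)) \<le>
     (\<Sum>u\<in>X. \<Sum>v\<in>X. F u v * ((\<Sum>a<N. (cmod (\<phi> a u))\<^sup>2) * (\<Sum>a<N. (cmod (\<phi> a v))\<^sup>2)
         - (cmod (\<Sum>a<N. \<phi> a u * cnj (\<phi> a v)))\<^sup>2))"
proof (rule ccontr)
  assume neg: "\<not> ?thesis"
  define B where "B = (\<Sum>u\<in>X. \<Sum>v\<in>X. F u v * ((\<Sum>a<N. (cmod (\<phi> a u))\<^sup>2) * (\<Sum>a<N. (cmod (\<phi> a v))\<^sup>2)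
         - (cmod (\<Sum>a<N. \<phi> a u * cnj (\<phi> a v)))\<^sup>2))"
  define w where "w x = (cmod (slater \<phi> N x))\<^sup>2" for x
  define E where "E x = (\<Sum>i<N. \<Sum>j\<in>{..<N}-{i}. F (x i) (x j))" for x
  let ?S = "PiE {..<N} (\<lambda>_. X)"
  have finS: "finite ?S" using finX by (simp add: finite_PiE)
  have gt: "B < E x" if "x \<in> ?S" "w x \<noteq> 0" for x
    using neg that unfolding B_def E_def w_def by (auto simp: not_le PiE_iff)
  have tot: "(\<Sum>x\<in>?S. w x) = fact N" unfolding w_def by (rule sum_slater_sq)
  have wE: "(\<Sum>x\<in>?S. E x * w x) = fact N * B" unfolding w_def E_def B_def by (rule sum_slater_sq_pairs)
  obtain x0 where x0: "x0 \<in> ?S" "w x0 \<noteq> 0"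
    using tot by (metis fact_nonzero sum.neutral)
  have "(\<Sum>x\<in>?S. B * w x) < (\<Sum>x\<in>?S. E x * w x)"
  proof (rule sum_strict_mono_ex1[OF finS])
    show "\<forall>x\<in>?S. B * w x \<le> E x * w x"
      using gt by (metis less_imp_le mult_right_mono mult_zero_right order_refl w_def zero_le_power2)
    show "\<exists>x\<in>?S. B * w x < E x * w x"
      using gt[OF x0] x0 by (intro bexI[of _ x0] mult_strict_right_mono) (auto simp: w_def)
  qed
  then show False using tot wE by (simp flip: sum_distrib_left add: mult.commute)
qed

end

section \<open>Monomial moments on grids of the complex projective space\<close>

text \<open>Used in two roles: as exponents of the monomials of degree m in d + 1 variables, and as
  lattice points of the simplex. Vanishing beyond \<open>d\<close> makes the representing function
  unique.\<close>

definition multi_idx :: "nat \<Rightarrow> nat \<Rightarrow> (nat \<Rightarrow> nat) set" where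
  "multi_idx d m = {\<alpha>. (\<forall>k>d. \<alpha> k = 0) \<and> (\<Sum>k\<le>d. \<alpha> k) = m}"

lemma multi_idx_le: "\<alpha> \<in> multi_idx d m \<Longrightarrow> \<alpha> k \<le> m"
  by (cases "k \<le> d") (auto simp: multi_idx_def member_le_sum not_le)

lemma multi_idx_0: "multi_idx 0 m = {(\<lambda>_. 0)(0 := m)}"
  by (auto simp: multi_idx_def fun_eq_iff)

lemma multi_idx_Suc:
  "bij_betw (\<lambda>(j, \<alpha>). \<alpha>(Suc d := j)) (SIGMA j:{..m}. multi_idx d (m - j)) (multi_idx (Suc d) m)"
proof (rule bij_betw_byWitness[where f' = "\<lambda>\<alpha>. (\<alpha> (Suc d), \<alpha>(Suc d := 0))"])
  have s: "(\<Sum>k\<le>d. if k = Suc d then (j::nat) else \<alpha> k) = (\<Sum>k\<le>d. \<alpha> k)" for \<alpha> j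
    by (rule sum.cong) auto
  show "\<forall>x\<in>SIGMA j:{..m}. multi_idx d (m - j). (\<lambda>\<alpha>. (\<alpha> (Suc d), \<alpha>(Suc d := 0))) ((\<lambda>(j, \<alpha>). \<alpha>(Suc d := j)) x) = x"
    by (auto simp: multi_idx_def fun_eq_iff)
  show "\<forall>\<alpha>\<in>multi_idx (Suc d) m. (\<lambda>(j, \<alpha>). \<alpha>(Suc d := j)) (\<alpha> (Suc d), \<alpha>(Suc d := 0)) = \<alpha>"
    by auto
  show "(\<lambda>(j, \<alpha>). \<alpha>(Suc d := j)) ` (SIGMA j:{..m}. multi_idx d (m - j)) \<subseteq> multi_idx (Suc d) m"
    by (auto simp: multi_idx_def s)
  show "(\<lambda>\<alpha>. (\<alpha> (Suc d), \<alpha>(Suc d := 0))) ` multi_idx (Suc d) m \<subseteq> (SIGMA j:{..m}. multi_idx d (m - j))"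
    by (auto simp: multi_idx_def s)
qed

lemma finite_multi_idx [simp]: "finite (multi_idx d m)"
proof (induction d arbitrary: m)
  case (Suc d)
  show ?case using bij_betw_finite[OF multi_idx_Suc[of d m]] Suc by auto
qed (simp add: multi_idx_0)

lemma sum_multi_idx_Suc:
  "(\<Sum>\<alpha>\<in>multi_idx (Suc d) m. f \<alpha>) = (\<Sum>j\<le>m. \<Sum>\<alpha>\<in>multi_idx d (m - j). f (\<alpha>(Suc d := j)))"
  by (simp add: sum.reindex_bij_betw[OF multi_idx_Suc, symmetric] sum.Sigma split_def)

lemma prod_atMost_fun_upd_Suc:
  "(\<Prod>k\<le>Suc d. g k ((\<alpha>(Suc d := j)) k)) = g (Suc d) j * (\<Prod>k\<le>d. g k (\<alpha> k))"
proof -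
  have "(\<Prod>k\<le>d. g k ((\<alpha>(Suc d := j)) k)) = (\<Prod>k\<le>d. g k (\<alpha> k))" by (rule prod.cong) auto
  then show ?thesis by (simp add: mult.commute)
qed

lemma multinomial:
  fixes x :: "nat \<Rightarrow> complex"
  shows "(\<Sum>k\<le>d. x k) ^ m = (\<Sum>\<alpha>\<in>multi_idx d m. fact m / (\<Prod>k\<le>d. fact (\<alpha> k)) * (\<Prod>k\<le>d. x k ^ \<alpha> k))"
proof (induction d arbitrary: m)
  case 0
  then show ?case by (simp add: multi_idx_0)
next
  case (Suc d)
  have "(\<Sum>k\<le>Suc d. x k) ^ m = (\<Sum>j\<le>m. of_nat (m choose j) * x (Suc d) ^ j * (\<Sum>k\<le>d. x k) ^ (m - j))"
    by (simp add: binomial_ring add.commute)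
  also have "\<dots> = (\<Sum>j\<le>m. \<Sum>\<alpha>\<in>multi_idx d (m - j). fact m / (\<Prod>k\<le>Suc d. fact ((\<alpha>(Suc d := j)) k))
      * (\<Prod>k\<le>Suc d. x k ^ (\<alpha>(Suc d := j)) k))"
    unfolding Suc sum_distrib_left prod_atMost_fun_upd_Suc[of "\<lambda>_ i. fact i"]
      prod_atMost_fun_upd_Suc[of "\<lambda>k i. x k ^ i"]
    by (intro sum.cong refl) (simp add: binomial_fact field_simps)
  finally show ?case by (simp only: sum_multi_idx_Suc)
qed

text \<open>Both sides count the (p + r + 1)-element subsets of {0..N}; the sum sorts them by their
  (p + 1)-st smallest element j.\<close>

lemma sum_choose_convolution:
  "(\<Sum>j\<le>N. (j choose p) * ((N - j) choose r)) = Suc N choose Suc (p + r)"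
proof (induction N arbitrary: r)
  case 0
  show ?case by (cases r; cases p) auto
next
  case (Suc N)
  show ?case
  proof (cases r)
    case 0
    then show ?thesis by (simp only: binomial_n_0 mult_1_right sum_choose_upper add_0_right)
  next
    case (Suc r')
    have "(\<Sum>j\<le>Suc N. (j choose p) * ((Suc N - j) choose r))
      = (\<Sum>j\<le>N. (j choose p) * ((N - j) choose r') + (j choose p) * ((N - j) choose r))"
      by (auto simp: Suc Suc_diff_le algebra_simps intro!: sum.cong)
    also have "\<dots> = (Suc N choose Suc (p + r')) + (Suc N choose Suc (p + r))"
      by (simp only: sum.distrib Suc.IH)
    finally show ?thesis by (simp add: Suc)
  qed
qed

text \<open>Products of binomial coefficients sum over the lattice simplex in closed form. Products
  of powers do not, so the power moments are later sandwiched between sums of this kind.\<close>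

lemma sum_multi_idx_prod_choose:
  "(\<Sum>a\<in>multi_idx d n. \<Prod>k\<le>d. (a k choose \<alpha> k)) = (n + d) choose ((\<Sum>k\<le>d. \<alpha> k) + d)"
proof (induction d arbitrary: n)
  case 0
  then show ?case by (simp add: multi_idx_0)
next
  case (Suc d)
  define q where "q = (\<Sum>k\<le>d. \<alpha> k)"
  have "(\<Sum>a\<in>multi_idx (Suc d) n. \<Prod>k\<le>Suc d. (a k choose \<alpha> k))
     = (\<Sum>j\<le>n. (j choose \<alpha> (Suc d)) * ((n - j + d) choose (q + d)))"
    unfolding sum_multi_idx_Suc prod_atMost_fun_upd_Suc[of "\<lambda>k i. i choose \<alpha> k"]
    by (simp only: sum_distrib_left[symmetric] Suc q_def)
  also have "\<dots> = (\<Sum>j\<le>n. (j choose \<alpha> (Suc d)) * ((n + d - j) choose (q + d)))"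
    by (intro sum.cong refl) simp
  also have "\<dots> = (\<Sum>j\<le>n + d. (j choose \<alpha> (Suc d)) * ((n + d - j) choose (q + d)))"
    by (rule sum.mono_neutral_left) (auto simp: binomial_eq_0)
  also have "\<dots> = (n + Suc d) choose (q + \<alpha> (Suc d) + Suc d)"
    by (simp add: sum_choose_convolution add_ac)
  finally show ?case by (simp add: q_def)
qed

lemma card_multi_idx: "card (multi_idx d n) = (n + d) choose d"
  using sum_multi_idx_prod_choose[where \<alpha> = "\<lambda>_. 0"] by simp

text \<open>The shift by \<open>\<alpha>\<close> embeds the simplex of size n into the one of size n
  + m, where the closed form is available.\<close>

lemma sum_multi_idx_prod_choose_rising:
  assumes "\<alpha> \<in> multi_idx d m"
  shows "(\<Sum>a\<in>multi_idx d n. \<Prod>k\<le>d. ((a k + \<alpha> k) choose \<alpha> k)) \<le> (n + m + d) choose (m + d)"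
proof -
  let ?h = "\<lambda>a k. a k + \<alpha> k"
  have inj: "inj_on ?h (multi_idx d n)" by (auto simp: inj_on_def fun_eq_iff)
  have "(\<Sum>a\<in>multi_idx d n. \<Prod>k\<le>d. ((a k + \<alpha> k) choose \<alpha> k)) = (\<Sum>a\<in>?h ` multi_idx d n. \<Prod>k\<le>d. (a k choose \<alpha> k))"
    by (simp add: sum.reindex[OF inj])
  also have "\<dots> \<le> (\<Sum>a\<in>multi_idx d (n + m). \<Prod>k\<le>d. (a k choose \<alpha> k))"
    using assms by (intro sum_mono2 finite_multi_idx) (auto simp: multi_idx_def sum.distrib)
  also have "\<dots> = (n + m + d) choose (m + d)"
    using assms by (simp only: sum_multi_idx_prod_choose) (simp add: multi_idx_def)
  finally show ?thesis .
qed

lemma power_le_fact_choose: "a ^ p \<le> fact p * ((a + p) choose p)"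
proof (induction p)
  case (Suc p)
  have "a ^ Suc p \<le> (a + Suc p) * (fact p * ((a + p) choose p))"
    using mult_le_mono[OF _ Suc, of a "a + Suc p"] by simp
  also have "\<dots> = fact p * (Suc (a + p) * ((a + p) choose p))" by (simp only: add_Suc_right mult_ac)
  also have "\<dots> = fact (Suc p) * ((a + Suc p) choose Suc p)"
    by (subst Suc_times_binomial_eq) (simp only: fact_Suc add_Suc_right mult_ac of_nat_id)
  finally show ?case .
qed simp

lemma choose_over_power_tendsto: "(\<lambda>n. real ((n + c) choose r) / real n ^ r) \<longlonglongrightarrow> 1 / fact r"
proof -
  have "(\<lambda>n. (\<Prod>i<r. (real n + (real c - real i)) / real n) / fact r) \<longlonglongrightarrow> (\<Prod>i<r. 1) / fact r"
  proof (intro tendsto_divide tendsto_prod tendsto_const)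
    fix i
    have "(\<lambda>n. 1 + (real c - real i) / real n) \<longlonglongrightarrow> 1 + 0"
      by (intro tendsto_add tendsto_const lim_const_over_n)
    then have "(\<lambda>n. 1 + (real c - real i) / real n) \<longlonglongrightarrow> 1" by simp
    then show "(\<lambda>n. (real n + (real c - real i)) / real n) \<longlonglongrightarrow> 1"
      by (rule Lim_transform_eventually[OF _ eventually_mono[OF eventually_gt_at_top[of 0]]])
        (auto simp: field_simps)
  qed auto
  moreover have "(\<Prod>i<r. (real n + (real c - real i)) / real n) / fact r = real ((n + c) choose r) / real n ^ r" for n
    by (simp add: binomial_gbinomial gbinomial_prod_rev prod_dividef atLeast0LessThan algebra_simps)
  ultimately show ?thesis by simp
qed

section \<open>Moments of the uniform distribution on lattice points of the simplex\<close>

definition simplex_moment :: "nat \<Rightarrow> nat \<Rightarrow> (nat \<Rightarrow> nat) \<Rightarrow> real" where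
  "simplex_moment d n \<alpha> = (\<Sum>a\<in>multi_idx d n. \<Prod>k\<le>d. (real (a k) / real n) ^ \<alpha> k) / real (card (multi_idx d n))"

text \<open>Each power lies between a falling and a rising factorial, both multiples of binomial
  coefficients with the same leading term. The limit is the Dirichlet integral, that is, the squared
  norm of the monomial on the unit sphere with normalised measure.\<close>

lemma simplex_moment_tendsto:
  assumes \<alpha>: "\<alpha> \<in> multi_idx d m"
  shows "(\<lambda>n. simplex_moment d n \<alpha>) \<longlonglongrightarrow> (\<Prod>k\<le>d. fact (\<alpha> k)) * fact d / fact (d + m)"
proof -
  define A where "A = (\<Prod>k\<le>d. fact (\<alpha> k) :: real)"
  have A0: "A > 0" by (auto simp: A_def intro!: prod_pos)
  have sm: "(\<Sum>k\<le>d. \<alpha> k) = m" using \<alpha> by (simp add: multi_idx_def)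
  have eq: "simplex_moment d n \<alpha> = (\<Sum>a\<in>multi_idx d n. \<Prod>k\<le>d. real (a k) ^ \<alpha> k) / (real n ^ m * real ((n + d) choose d))" for n
    by (simp add: simplex_moment_def power_divide prod_dividef power_sum[symmetric] sm card_multi_idx
       sum_divide_distrib[symmetric])
  have lo: "A * (real ((n + d) choose (m + d)) / (real n ^ m * real ((n + d) choose d))) \<le> simplex_moment d n \<alpha>" for n
  proof -
    have "A * real ((n + d) choose (m + d)) = (\<Sum>a\<in>multi_idx d n. \<Prod>k\<le>d. fact (\<alpha> k) * real (a k choose \<alpha> k))"
      unfolding prod.distrib sum_distrib_left[symmetric] A_def
      using arg_cong[OF sum_multi_idx_prod_choose[where \<alpha> = \<alpha>, unfolded sm], of real d n] by (simp add: sm)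
    also have "\<dots> \<le> (\<Sum>a\<in>multi_idx d n. \<Prod>k\<le>d. real (a k) ^ \<alpha> k)"
    proof (intro sum_mono prod_mono conjI)
      fix a k
      have "real ((a k choose \<alpha> k) * fact (\<alpha> k)) \<le> real (a k ^ \<alpha> k)"
        by (intro of_nat_mono binomial_fact_pow)
      then show "fact (\<alpha> k) * real (a k choose \<alpha> k) \<le> real (a k) ^ \<alpha> k" by (simp add: mult.commute)
    qed auto
    finally show ?thesis unfolding eq times_divide_eq_right by (intro divide_right_mono) auto
  qed
  have hi: "simplex_moment d n \<alpha> \<le> A * (real ((n + m + d) choose (m + d)) / (real n ^ m * real ((n + d) choose d)))" for n
  proof -
    have "(\<Sum>a\<in>multi_idx d n. \<Prod>k\<le>d. real (a k) ^ \<alpha> k) \<le> (\<Sum>a\<in>multi_idx d n. \<Prod>k\<le>d. fact (\<alpha> k) * real ((a k + \<alpha> k) choose \<alpha> k))"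
    proof (intro sum_mono prod_mono conjI)
      fix a k
      have "real (a k ^ \<alpha> k) \<le> real (fact (\<alpha> k) * ((a k + \<alpha> k) choose \<alpha> k))"
        by (intro of_nat_mono power_le_fact_choose)
      then show "real (a k) ^ \<alpha> k \<le> fact (\<alpha> k) * real ((a k + \<alpha> k) choose \<alpha> k)" by simp
    qed auto
    also have "\<dots> = A * real (\<Sum>a\<in>multi_idx d n. \<Prod>k\<le>d. ((a k + \<alpha> k) choose \<alpha> k))"
      by (simp add: A_def sum_distrib_left prod.distrib)
    also have "\<dots> \<le> A * real ((n + m + d) choose (m + d))"
      using A0 by (intro mult_left_mono of_nat_mono sum_multi_idx_prod_choose_rising[OF \<alpha>]) auto
    finally show ?thesis unfolding eq times_divide_eq_right by (intro divide_right_mono) auto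
  qed
  \<comment> \<open>The shift \<open>c\<close> does not affect the leading term, so the lower bound
    (c = d) and the upper bound (c = m + d) share one limit.\<close>
  have lim: "(\<lambda>n. A * (real ((n + c) choose (m + d)) / (real n ^ m * real ((n + d) choose d)))) \<longlonglongrightarrow> A * fact d / fact (d + m)" for c
  proof -
    have "(\<lambda>n. A * ((real ((n + c) choose (m + d)) / real n ^ (m + d)) / (real ((n + d) choose d) / real n ^ d))) \<longlonglongrightarrow> A * ((1 / fact (m + d)) / (1 / fact d))"
      by (intro tendsto_mult tendsto_const tendsto_divide choose_over_power_tendsto) auto
    then have "(\<lambda>n. A * ((real ((n + c) choose (m + d)) / real n ^ (m + d)) / (real ((n + d) choose d) / real n ^ d))) \<longlonglongrightarrow> A * fact d / fact (d + m)"
      by (simp add: add.commute)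
    then show ?thesis
      by (rule Lim_transform_eventually[OF _ eventually_mono[OF eventually_gt_at_top[of 0]]])
        (auto simp: field_simps power_add)
  qed
  show ?thesis unfolding A_def[symmetric]
    by (rule tendsto_sandwich[OF _ _ lim[of d] lim[of "m + d"]])
      (use lo hi in \<open>auto intro!: always_eventually simp: add_ac\<close>)
qed

section \<open>Roots of unity and orthogonality of monomials on the grid\<close>

lemma cos_root_of_unity_eq_1_iff:
  assumes "a < K" "b < K"
  shows "cos (2 * pi * (real a - real b) / real K) = 1 \<longleftrightarrow> a = b"
proof
  assume "cos (2 * pi * (real a - real b) / real K) = 1"
  then obtain n :: int where "2 * pi * (real a - real b) / real K = of_int n * 2 * pi"
    unfolding cos_one_2pi_int by blast
  then have "2 * pi * (real a - real b) = 2 * pi * (of_int n * real K)"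
    using assms by (simp add: divide_eq_eq mult_ac)
  then have "real a - real b = of_int n * real K" by (subst (asm) mult_cancel_left) simp
  then have "int a - int b = n * int K" by (metis of_int_diff of_int_eq_iff of_int_mult of_int_of_nat_eq)
  then have "int K dvd int a - int b" by simp
  then show "a = b" using assms dvd_imp_le_int[of "int a - int b" "int K"] by linarith
qed simp

lemma sum_cis_roots:
  assumes "a < K" "b < K"
  shows "(\<Sum>j<K. cis (2 * pi * real j / real K) ^ a * cnj (cis (2 * pi * real j / real K)) ^ b) = (if a = b then of_nat K else 0)"
proof -
  define w where "w = cis (2 * pi * (real a - real b) / real K)"
  have K: "K > 0" using assms by simp
  have pw: "cis (2 * pi * real j / real K) ^ a * cnj (cis (2 * pi * real j / real K)) ^ b = w ^ j" for j
  proof -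
    have "cis (2 * pi * real j / real K) ^ a * cnj (cis (2 * pi * real j / real K)) ^ b
      = cis (real a * (2 * pi * real j / real K) + real b * - (2 * pi * real j / real K))"
      by (simp only: cis_cnj Complex.DeMoivre cis_mult)
    also have "\<dots> = w ^ j"
      unfolding w_def Complex.DeMoivre by (rule arg_cong[of _ _ cis]) (simp add: diff_divide_distrib algebra_simps)
    finally show ?thesis .
  qed
  show ?thesis
  proof (cases "a = b")
    case True
    then show ?thesis unfolding pw by (simp add: w_def)
  next
    case False
    have "w \<noteq> 1"
      using False cos_root_of_unity_eq_1_iff[OF assms] by (metis cis.simps(1) one_complex.simps(1) w_def)
    moreover have "w ^ K = 1"
    proof -
      have "w ^ K = cis (2 * pi * of_int (int a - int b))" using K by (simp add: w_def Complex.DeMoivre)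
      then show ?thesis by (simp add: cis_multiple_2pi)
    qed
    ultimately show ?thesis using False by (simp add: pw sum_gp_strict)
  qed
qed

definition cp_point :: "nat \<Rightarrow> nat \<Rightarrow> (nat \<Rightarrow> nat) \<times> (nat \<Rightarrow> nat) \<Rightarrow> nat \<Rightarrow> complex" where
  "cp_point n Q x k = of_real (sqrt (real (fst x k) / real n)) * cis (2 * pi * real (snd x k) / real Q)"

text \<open>Elements are labels, and several labels may give the same point; all averages count
  labels. All d + 1 phases run freely, although one is redundant projectively, so that phase sums
  factor into one-dimensional ones.\<close>

definition cp_grid :: "nat \<Rightarrow> nat \<Rightarrow> nat \<Rightarrow> ((nat \<Rightarrow> nat) \<times> (nat \<Rightarrow> nat)) set" where
  "cp_grid d n Q = multi_idx d n \<times> PiE {..d} (\<lambda>_. {..<Q})"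

definition monom_at :: "nat \<Rightarrow> (nat \<Rightarrow> nat) \<Rightarrow> (nat \<Rightarrow> complex) \<Rightarrow> complex" where
  "monom_at d \<alpha> z = (\<Prod>k\<le>d. z k ^ \<alpha> k)"

lemma finite_cp_grid [simp]: "finite (cp_grid d n Q)"
  by (simp add: cp_grid_def finite_PiE)

lemma card_cp_grid: "card (cp_grid d n Q) = card (multi_idx d n) * Q ^ Suc d"
  by (simp add: cp_grid_def card_cartesian_product card_PiE)

lemma cp_point_unit:
  assumes "x \<in> cp_grid d n Q" "n > 0"
  shows "(\<Sum>k\<le>d. (cmod (cp_point n Q x k))\<^sup>2) = 1"
proof -
  have "(\<Sum>k\<le>d. (cmod (cp_point n Q x k))\<^sup>2) = (\<Sum>k\<le>d. real (fst x k) / real n)"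
    by (intro sum.cong refl) (simp add: cp_point_def norm_mult)
  also have "\<dots> = real (\<Sum>k\<le>d. fst x k) / real n" by (simp add: sum_divide_distrib)
  also have "\<dots> = 1" using assms by (auto simp: cp_grid_def multi_idx_def)
  finally show ?thesis .
qed

text \<open>The phases alone decide between 0 and the full count; since all exponents stay below
  \<open>Q\<close> there is no aliasing. The moduli then supply the squared norm.\<close>

lemma sum_grid_monom_at:
  assumes \<alpha>: "\<alpha> \<in> multi_idx d m" and \<beta>: "\<beta> \<in> multi_idx d m" and Q: "m < Q"
  shows "(\<Sum>x\<in>cp_grid d n Q. monom_at d \<alpha> (cp_point n Q x) * cnj (monom_at d \<beta> (cp_point n Q x)))
    = (if \<alpha> = \<beta> then of_real (real (card (cp_grid d n Q)) * simplex_moment d n \<alpha>) else 0)"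
proof -
  define r where "r a k = complex_of_real (sqrt (real (a k) / real n))" for a :: "nat \<Rightarrow> nat" and k
  define e where "e j = cis (2 * pi * real j / real Q)" for j :: nat
  have "(\<Sum>x\<in>cp_grid d n Q. monom_at d \<alpha> (cp_point n Q x) * cnj (monom_at d \<beta> (cp_point n Q x)))
     = (\<Sum>a\<in>multi_idx d n. \<Sum>j\<in>PiE {..d} (\<lambda>_. {..<Q}). (\<Prod>k\<le>d. r a k ^ (\<alpha> k + \<beta> k)) * (\<Prod>k\<le>d. e (j k) ^ \<alpha> k * cnj (e (j k)) ^ \<beta> k))"
    unfolding cp_grid_def sum.cartesian_product
    by (intro sum.cong refl) (auto simp: monom_at_def cp_point_def r_def e_def prod.distrib[symmetric] power_mult_distrib power_add mult_ac intro!: prod.cong)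
  also have "\<dots> = (\<Sum>a\<in>multi_idx d n. (\<Prod>k\<le>d. r a k ^ (\<alpha> k + \<beta> k)) * (\<Prod>k\<le>d. \<Sum>j<Q. e j ^ \<alpha> k * cnj (e j) ^ \<beta> k))"
    by (subst prod_sum_PiE) (auto simp: sum_distrib_left)
  also have "\<dots> = (\<Sum>a\<in>multi_idx d n. (\<Prod>k\<le>d. r a k ^ (\<alpha> k + \<beta> k)) * (\<Prod>k\<le>d. if \<alpha> k = \<beta> k then of_nat Q else 0))"
    unfolding e_def using multi_idx_le[OF \<alpha>] multi_idx_le[OF \<beta>] Q
    by (subst sum_cis_roots) (auto intro: le_less_trans)
  also have "\<dots> = (if \<alpha> = \<beta> then of_real (real (card (cp_grid d n Q)) * simplex_moment d n \<alpha>) else 0)"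
  proof (cases "\<alpha> = \<beta>")
    case True
    have "r a k ^ (\<alpha> k + \<alpha> k) = of_real ((real (a k) / real n) ^ \<alpha> k)" for a k
      unfolding r_def of_real_power[symmetric] mult_2[symmetric] power_mult by simp
    moreover have "card (multi_idx d n) \<noteq> 0" by (simp add: card_multi_idx)
    ultimately show ?thesis using True
      unfolding card_cp_grid simplex_moment_def
      by (simp only: sum_distrib_right[symmetric] prod_constant card_atMost if_True) (simp add: mult.commute)
  next
    case False
    then obtain k where k: "\<alpha> k \<noteq> \<beta> k" by auto
    then have "k \<le> d" using \<alpha> \<beta> by (auto simp: multi_idx_def intro: ccontr)
    then have "(\<Prod>k\<le>d. if \<alpha> k = \<beta> k then of_nat Q else 0) = (0::complex)"
      using k by (intro prod_zero) auto
    then show ?thesis using False by (simp only: if_False mult_zero_right sum.neutral_const)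
  qed
  finally show ?thesis .
qed

section \<open>Circles of equally spaced points\<close>

text \<open>The point \<open>z\<close> of the disc solves c = 2z / (1 + |z|^2), so 2 - 2 Re c is (1
  + s) |1 - z|^2 and its inverse is a multiple of the Poisson kernel at z. Multiplying c by a phase
  multiplies z by the same phase, which makes averages over rotations computable.\<close>

lemma inverse_one_minus_Re_poisson:
  assumes "cmod c < 1"
  defines "s \<equiv> sqrt (1 - (cmod c)\<^sup>2)"
  defines "z \<equiv> c / (1 + of_real s)"
  shows "1 / (2 - 2 * Re c) = 1 / (2 * s) * Re ((1 + z) / (1 - z))"
proof -
  have c1: "(cmod c)\<^sup>2 < 1" using assms by (simp add: abs_square_less_1)
  then have s: "s > 0" "s\<^sup>2 = 1 - (cmod c)\<^sup>2" by (auto simp: s_def)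
  have Rc: "2 - 2 * Re c > 0" using complex_Re_le_cmod[of c] assms(1) by simp
  have z: "Re z = Re c / (1 + s)" "Im z = Im c / (1 + s)"
  proof -
    have "z = c / of_real (1 + s)" by (simp add: z_def)
    then show "Re z = Re c / (1 + s)" "Im z = Im c / (1 + s)"
      by (simp_all only: Re_divide_of_real Im_divide_of_real)
  qed
  have c2: "(Im c)\<^sup>2 = (1 - s\<^sup>2) - (Re c)\<^sup>2" using s(2) cmod_power2[of c] by simp
  have nz: "(Re z)\<^sup>2 + (Im z)\<^sup>2 = (1 - s) / (1 + s)"
  proof -
    have "(Re z)\<^sup>2 + (Im z)\<^sup>2 = (1 - s\<^sup>2) / (1 + s)\<^sup>2"
      unfolding z power_divide c2 by (simp add: add_divide_distrib[symmetric])
    also have "\<dots> = (1 - s) / (1 + s)" 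
    proof -
      have "1 - s\<^sup>2 = (1 - s) * (1 + s)" by (simp add: power2_eq_square algebra_simps)
      then show ?thesis using s(1) by (simp add: power2_eq_square)
    qed
    finally show ?thesis .
  qed
  have d: "(1 - Re z)\<^sup>2 + (Im z)\<^sup>2 = (2 - 2 * Re c) / (1 + s)"
  proof -
    have "(1 - Re z)\<^sup>2 + (Im z)\<^sup>2 = 1 - 2 * Re z + ((Re z)\<^sup>2 + (Im z)\<^sup>2)" by (simp add: power2_eq_square algebra_simps)
    also have "\<dots> = 1 - 2 * (Re c / (1 + s)) + (1 - s) / (1 + s)" by (simp only: nz) (simp only: z(1))
    also have "\<dots> = (2 - 2 * Re c) / (1 + s)" using s(1) by (simp add: field_simps)
    finally show ?thesis .
  qed
  have "Re ((1 + z) / (1 - z)) = (1 - ((Re z)\<^sup>2 + (Im z)\<^sup>2)) / ((1 - Re z)\<^sup>2 + (Im z)\<^sup>2)"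
    by (simp add: Re_divide power2_eq_square algebra_simps)
  also have "\<dots> = 2 * s / (2 - 2 * Re c)" unfolding nz d using s(1) Rc by (simp add: divide_simps)
  finally show ?thesis using s(1) by simp
qed

text \<open>Averaging over the K-th roots of unity keeps exactly the powers of z whose exponent is a
  multiple of K.\<close>

lemma sum_inverse_one_minus_roots:
  assumes z: "cmod z < 1" and K: "K > 0"
  shows "(\<Sum>j<K. 1 / (1 - cis (2 * pi * real j / real K) * z)) = of_nat K / (1 - z ^ K)"
proof -
  define e where "e j = cis (2 * pi * real j / real K)" for j
  have ne: "x \<noteq> 1" if "cmod x < 1" for x using that by auto
  have eK: "e j ^ K = 1" for j
  proof -
    have "e j ^ K = cis (2 * pi * real j)" using K by (simp add: e_def Complex.DeMoivre)
    then show ?thesis by (simp add: cis_multiple_2pi)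
  qed
  have *: "1 / (1 - e j * z) = (\<Sum>m<K. e j ^ m * z ^ m) / (1 - z ^ K)" for j
  proof -
    have "e j * z \<noteq> 1" by (rule ne) (simp add: norm_mult e_def z)
    moreover have "z ^ K \<noteq> 1" using z K by (intro ne) (simp add: norm_power power_less_one_iff)
    moreover have "1 - z ^ K = (1 - e j * z) * (\<Sum>m<K. e j ^ m * z ^ m)"
      using one_diff_power_eq[of "e j * z" K] by (simp add: power_mult_distrib eK)
    ultimately show ?thesis by (simp add: field_simps)
  qed
  have "(\<Sum>j<K. 1 / (1 - e j * z)) = (\<Sum>m<K. z ^ m * (\<Sum>j<K. e j ^ m * cnj (e j) ^ 0)) / (1 - z ^ K)"
    unfolding * sum_divide_distrib[symmetric] sum_distrib_left
    by (subst sum.swap) (simp add: mult.commute)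
  also have "(\<Sum>m<K. z ^ m * (\<Sum>j<K. e j ^ m * cnj (e j) ^ 0)) = (\<Sum>m<K. if m = 0 then of_nat K else 0)"
    unfolding e_def using K by (intro sum.cong refl) (subst sum_cis_roots; auto)
  also have "\<dots> = of_nat K" using K by simp
  finally show ?thesis by (simp add: e_def)
qed

text \<open>The average over K rotations in the worst case, when z^K is real and nonnegative. As K
  grows it approaches the mean 1 / (2 sqrt (1 - r^2)) over the full circle.\<close>

definition phase_bound :: "nat \<Rightarrow> real \<Rightarrow> real" where
  "phase_bound K r = 1 / (2 * sqrt (1 - r\<^sup>2)) *
     ((1 + (r / (1 + sqrt (1 - r\<^sup>2))) ^ K) / (1 - (r / (1 + sqrt (1 - r\<^sup>2))) ^ K))"

lemma sum_phases_le:
  assumes c: "cmod c < 1" and K: "K > 0"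
  shows "(\<Sum>j<K. 1 / (2 - 2 * Re (cis (2 * pi * real j / real K) * c))) \<le> real K * phase_bound K (cmod c)"
proof -
  define e where "e j = cis (2 * pi * real j / real K)" for j
  define s where "s = sqrt (1 - (cmod c)\<^sup>2)"
  define z where "z = c / (1 + of_real s)"
  have s: "s > 0" using c by (simp add: s_def abs_square_less_1)
  have "cmod z = cmod c / cmod (of_real (1 + s))" unfolding z_def norm_divide by simp
  then have zc: "cmod z = cmod c / (1 + s)" using s unfolding norm_of_real by simp
  have z: "cmod z < 1" using c s by (simp add: zc divide_simps)
  have zK: "cmod z ^ K < 1" using z K by (simp add: power_less_one_iff)
  have one: "1 / (2 - 2 * Re (e j * c)) = 1 / (2 * s) * Re (2 / (1 - e j * z) - 1)" for j
  proof -
    have n: "cmod (e j * c) = cmod c" by (simp add: norm_mult e_def)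
    have "cmod (e j * z) \<noteq> cmod 1" using z by (simp add: norm_mult e_def)
    then have "1 - e j * z \<noteq> 0" by auto
    then have "(1 + e j * z) / (1 - e j * z) = 2 / (1 - e j * z) - 1" by (simp add: field_simps)
    then show ?thesis using inverse_one_minus_Re_poisson[of "e j * c"] c
      unfolding n s_def[symmetric] by (simp add: z_def)
  qed
  have "(\<Sum>j<K. 1 / (2 - 2 * Re (e j * c))) = 1 / (2 * s) * Re (2 * (\<Sum>j<K. 1 / (1 - e j * z)) - of_nat K)"
    unfolding one sum_distrib_left[symmetric] Re_sum[symmetric] by (simp add: sum_subtractf sum_distrib_left)
  also have "(\<Sum>j<K. 1 / (1 - e j * z)) = of_nat K / (1 - z ^ K)"
    unfolding e_def by (rule sum_inverse_one_minus_roots[OF z K])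
  also have "2 * (of_nat K / (1 - z ^ K)) - of_nat K = of_real (real K) * ((1 + z ^ K) / (1 - z ^ K))"
  proof -
    have "cmod (z ^ K) \<noteq> cmod 1" using zK by (simp add: norm_power)
    then have "1 - z ^ K \<noteq> 0" by auto
    then show ?thesis by (simp add: field_simps)
  qed
  also have "Re (of_real (real K) * ((1 + z ^ K) / (1 - z ^ K))) = real K * Re ((1 + z ^ K) / (1 - z ^ K))"
    by (simp only: times_complex.simps Re_complex_of_real Im_complex_of_real mult_zero_left diff_zero)
  also have "Re ((1 + z ^ K) / (1 - z ^ K)) \<le> (1 + cmod z ^ K) / (1 - cmod z ^ K)"
  proof -
    have "Re ((1 + z ^ K) / (1 - z ^ K)) \<le> cmod (1 + z ^ K) / cmod (1 - z ^ K)"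
      by (metis complex_Re_le_cmod norm_divide)
    also have "\<dots> \<le> (1 + cmod z ^ K) / (1 - cmod z ^ K)"
      using zK norm_triangle_ineq[of 1 "z ^ K"] norm_triangle_ineq2[of 1 "z ^ K"]
      by (intro frac_le) (auto simp: norm_power)
    finally show ?thesis .
  qed
  finally show ?thesis using s K
    by (simp add: e_def phase_bound_def zc s_def mult_ac divide_right_mono mult_left_mono)
qed

lemma phase_bound_tendsto:
  assumes "0 \<le> r" "r < 1"
  shows "(\<lambda>K. phase_bound K r) \<longlonglongrightarrow> 1 / (2 * sqrt (1 - r\<^sup>2))"
proof -
  define u where "u = r / (1 + sqrt (1 - r\<^sup>2))"
  have "sqrt (1 - r\<^sup>2) > 0" using assms by (simp add: abs_square_less_1)
  then have "0 < 1 + sqrt (1 - r\<^sup>2)" "r < 1 + sqrt (1 - r\<^sup>2)" using assms by linarith+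
  then have "0 \<le> u" "u < 1" using assms unfolding u_def by simp_all
  then have "(\<lambda>K. 1 / (2 * sqrt (1 - r\<^sup>2)) * ((1 + u ^ K) / (1 - u ^ K))) \<longlonglongrightarrow> 1 / (2 * sqrt (1 - r\<^sup>2)) * ((1 + 0) / (1 - 0))"
    by (intro tendsto_intros LIMSEQ_power_zero) auto
  then show ?thesis by (simp add: phase_bound_def[abs_def] u_def)
qed

lemma sum_weighted_powers_root_of_unity:
  fixes w :: complex
  assumes "w ^ k = 1" "w \<noteq> 1"
  shows "(w - 1) * (\<Sum>m<k. of_nat m * w ^ m) = of_nat k"
proof -
  have "(w - 1) * (\<Sum>m<n. of_nat m * w ^ m) = of_nat n * w ^ n - w * (\<Sum>m<n. w ^ m)" for n
    by (induction n) (auto simp: algebra_simps)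
  moreover have "(\<Sum>m<k. w ^ m) = 0" using assms by (simp add: sum_gp_strict)
  ultimately show ?thesis using assms by simp
qed

text \<open>Parseval for the finite Fourier transform of the sequence \<open>0, 1, \<dots>, k - 1\<close>, whose nonzero
  frequencies are \<open>k / (w - 1)\<close>.\<close>
lemma sum_inverse_sq_dist_roots:
  assumes l0: "l0 < k"
  shows "(\<Sum>l<k. inverse (2 - 2 * Re (cis (2 * pi * real l / real k) * cnj (cis (2 * pi * real l0 / real k))))) = (real k ^ 2 - 1) / 12"
proof -
  define e where "e l = cis (2 * pi * real l / real k)" for l
  define f where "f l = (\<Sum>m<k. of_nat m * (e l * cnj (e l0)) ^ m)" for l
  have k: "k > 0" using l0 by simp
  have eu: "e l * cnj (e l) = 1" for l by (simp add: e_def cis_cnj cis_mult)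
  have ek: "(e l * cnj (e l0)) ^ k = 1" for l
  proof -
    have "e l ^ k = cis (2 * pi * real l)" for l using k by (simp add: e_def Complex.DeMoivre)
    then have "e l ^ k = 1" for l by (simp add: cis_multiple_2pi)
    then show ?thesis by (simp add: power_mult_distrib flip: complex_cnj_power)
  qed
  \<comment> \<open>At \<open>l = l0\<close> the distance is 0 and \<open>inverse 0 = 0\<close>, so
    the full sum over \<open>l\<close> is the energy felt from the other points only.\<close>
  have tm: "inverse (2 - 2 * Re (e l * cnj (e l0))) = (if l = l0 then 0 else (cmod (f l))\<^sup>2 / (real k)\<^sup>2)" if l: "l < k" for l
  proof (cases "l = l0")
    case True
    then show ?thesis by (simp add: eu)
  next
    case False
    define w where "w = e l * cnj (e l0)"
    have wc: "w = cis (2 * pi * (real l - real l0) / real k)"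
      by (simp add: w_def e_def cis_cnj cis_mult diff_divide_distrib algebra_simps)
    have w1: "w \<noteq> 1" using False cos_root_of_unity_eq_1_iff[OF l l0] unfolding wc by (metis cis.simps(1) one_complex.simps(1))
    have "(w - 1) * f l = of_nat k"
      unfolding f_def w_def[symmetric] by (rule sum_weighted_powers_root_of_unity) (use ek w1 in \<open>auto simp: w_def\<close>)
    then have "(cmod (w - 1))\<^sup>2 * (cmod (f l))\<^sup>2 = (real k)\<^sup>2"
      by (metis norm_mult norm_of_nat power_mult_distrib)
    moreover have "(cmod (w - 1))\<^sup>2 = 2 - 2 * Re w"
    proof -
      have "(Re w)\<^sup>2 + (Im w)\<^sup>2 = 1" unfolding wc by simp
      then show ?thesis unfolding cmod_power2 by (simp add: power2_eq_square algebra_simps)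
    qed
    moreover have "cmod (w - 1) \<noteq> 0" using w1 by simp
    ultimately have "(2 - 2 * Re w) * (cmod (f l))\<^sup>2 = (real k)\<^sup>2" "2 - 2 * Re w \<noteq> 0" by auto
    then have "inverse (2 - 2 * Re w) = (cmod (f l))\<^sup>2 / (real k)\<^sup>2"
      using k by (simp add: divide_simps mult.commute)
    then show ?thesis using False by (simp add: w_def)
  qed
  have "complex_of_real (\<Sum>l<k. (cmod (f l))\<^sup>2) = (\<Sum>l<k. \<Sum>m<k. \<Sum>n<k. of_nat m * of_nat n * cnj (e l0) ^ m * e l0 ^ n * (e l ^ m * cnj (e l) ^ n))"
    unfolding of_real_sum complex_norm_square f_def cnj_sum sum_product
    by (intro sum.cong refl) (simp add: power_mult_distrib mult_ac)
  also have "\<dots> = (\<Sum>m<k. \<Sum>n<k. of_nat m * of_nat n * cnj (e l0) ^ m * e l0 ^ n * (\<Sum>l<k. e l ^ m * cnj (e l) ^ n))"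
    unfolding sum_distrib_left by (subst sum.swap, rule sum.cong[OF refl], rule sum.swap)
  also have "\<dots> = (\<Sum>m<k. \<Sum>n<k. if n = m then of_nat k * of_nat m * of_nat m * (e l0 * cnj (e l0)) ^ m else 0)"
    unfolding e_def by (intro sum.cong refl, subst sum_cis_roots) (auto simp: power_mult_distrib)
  also have "\<dots> = of_real (\<Sum>m<k. real k * real m * real m)" by (simp add: eu)
  finally have par: "(\<Sum>l<k. (cmod (f l))\<^sup>2) = real k * (\<Sum>m<k. (real m)\<^sup>2)"
    by (simp only: of_real_eq_iff sum_distrib_left power2_eq_square mult.assoc)
  have sq: "(\<Sum>m<n. (real m)\<^sup>2) = (real n - 1) * real n * (2 * real n - 1) / 6" for n
    by (induction n) (auto simp: field_simps power2_eq_square)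
  have li: "(\<Sum>m<n. real m) = real n * (real n - 1) / 2" for n
    by (induction n) (auto simp: field_simps)
  have f0: "(cmod (f l0))\<^sup>2 = (real k * (real k - 1) / 2)\<^sup>2"
  proof -
    have "f l0 = of_real (\<Sum>m<k. real m)" by (simp add: f_def eu)
    then show ?thesis unfolding li by (simp only: norm_of_real power2_abs)
  qed
  have "(\<Sum>l<k. inverse (2 - 2 * Re (e l * cnj (e l0)))) = (\<Sum>l\<in>{..<k}-{l0}. (cmod (f l))\<^sup>2 / (real k)\<^sup>2)"
  proof -
    have "(\<Sum>l<k. inverse (2 - 2 * Re (e l * cnj (e l0)))) = (\<Sum>l<k. if l = l0 then 0 else (cmod (f l))\<^sup>2 / (real k)\<^sup>2)"
      by (intro sum.cong refl tm) simp
    also have "\<dots> = (\<Sum>l\<in>{..<k}-{l0}. (cmod (f l))\<^sup>2 / (real k)\<^sup>2)"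
      using l0 by (intro sum.mono_neutral_cong_right) auto
    finally show ?thesis .
  qed
  also have "\<dots> = ((\<Sum>l<k. (cmod (f l))\<^sup>2) - (cmod (f l0))\<^sup>2) / (real k)\<^sup>2"
    using l0 by (simp add: sum_diff1 sum_divide_distrib[symmetric])
  also have "\<dots> = (real k ^ 2 - 1) / 12"
    unfolding par f0 sq using k by (simp add: field_simps power2_eq_square)
  finally show ?thesis by (simp add: e_def)
qed

text \<open>Method of conditional expectations: values are fixed one index at a time, each new value
  doing no worse than its average against all those already fixed. Hence \<open>avg\<close> averages
  over one argument only, for every fixed value of the other.\<close>

lemma exists_assignment_pairwise_average:
  fixes h :: "nat \<Rightarrow> nat \<Rightarrow> 'a \<Rightarrow> 'a \<Rightarrow> real"
  assumes S: "finite S" "S \<noteq> {}"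
    and avg: "\<And>i j a. i < j \<Longrightarrow> j < N \<Longrightarrow> a \<in> S \<Longrightarrow> (\<Sum>b\<in>S. h i j a b) \<le> real (card S) * B i j"
  shows "\<exists>f. (\<forall>i. f i \<in> S) \<and> (\<Sum>j<N. \<Sum>i<j. h i j (f i) (f j)) \<le> (\<Sum>j<N. \<Sum>i<j. B i j)"
  using avg
proof (induction N)
  case 0
  then show ?case using S by auto
next
  case (Suc N)
  have "\<exists>f. (\<forall>i. f i \<in> S) \<and> (\<Sum>j<N. \<Sum>i<j. h i j (f i) (f j)) \<le> (\<Sum>j<N. \<Sum>i<j. B i j)"
    by (rule Suc.IH) (simp add: Suc.prems)
  then obtain f where f: "\<And>i. f i \<in> S" "(\<Sum>j<N. \<Sum>i<j. h i j (f i) (f j)) \<le> (\<Sum>j<N. \<Sum>i<j. B i j)"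
    by blast
  have "\<exists>b\<in>S. (\<Sum>i<N. h i N (f i) b) \<le> (\<Sum>i<N. B i N)"
  proof (rule ccontr)
    assume "\<not> ?thesis"
    then have "(\<Sum>b\<in>S. \<Sum>i<N. B i N) < (\<Sum>b\<in>S. \<Sum>i<N. h i N (f i) b)"
      by (intro sum_strict_mono[OF S]) (simp add: not_le)
    also have "\<dots> = (\<Sum>i<N. \<Sum>b\<in>S. h i N (f i) b)" by (rule sum.swap)
    also have "\<dots> \<le> (\<Sum>i<N. real (card S) * B i N)"
      using f Suc.prems by (intro sum_mono) auto
    finally show False by (simp add: sum_distrib_left)
  qed
  then obtain b where b: "b \<in> S" "(\<Sum>i<N. h i N (f i) b) \<le> (\<Sum>i<N. B i N)" by blast
  define g where "g = f(N := b)"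
  have "(\<Sum>j<N. \<Sum>i<j. h i j (g i) (g j)) = (\<Sum>j<N. \<Sum>i<j. h i j (f i) (f j))"
    by (intro sum.cong refl) (auto simp: g_def)
  moreover have "(\<Sum>i<N. h i N (g i) (g N)) = (\<Sum>i<N. h i N (f i) b)"
    by (intro sum.cong refl) (auto simp: g_def)
  ultimately have "(\<Sum>j<Suc N. \<Sum>i<j. h i j (g i) (g j)) \<le> (\<Sum>j<Suc N. \<Sum>i<j. B i j)" using f b by simp
  moreover have "\<forall>i. g i \<in> S" using f b by (auto simp: g_def)
  ultimately show ?case by blast
qed

lemma sum_off_diagonal_symmetric:
  fixes g :: "nat \<Rightarrow> nat \<Rightarrow> real"
  assumes sym: "\<And>i j. g i j = g j i"
  shows "(\<Sum>i<N. \<Sum>j\<in>{..<N}-{i}. g i j) = 2 * (\<Sum>j<N. \<Sum>i<j. g i j)"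
proof -
  have "(\<Sum>i<N. \<Sum>j\<in>{..<N}-{i}. g i j) = (\<Sum>i<N. \<Sum>j<N. if i = j then 0 else g i j)"
    by (intro sum.cong refl sum.mono_neutral_cong_left) auto
  also have "\<dots> = 2 * (\<Sum>j<N. \<Sum>i<j. g i j)"
  proof (induction N)
    case (Suc N)
    have "(\<Sum>i<N. if i = N then 0 else g i N) = (\<Sum>i<N. g i N)"
      "(\<Sum>j<N. if N = j then 0 else g N j) = (\<Sum>i<N. g i N)"
      by (auto intro!: sum.cong simp: sym)
    then show ?case using Suc by (simp add: sum.distrib)
  qed simp
  finally show ?thesis .
qed

section \<open>Unit vectors of C^(d+1) as points of the real sphere, and energy of a union of
  fibres\<close>

definition hinner :: "nat \<Rightarrow> (nat \<Rightarrow> complex) \<Rightarrow> (nat \<Rightarrow> complex) \<Rightarrow> complex" where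
  "hinner d p q = (\<Sum>k\<le>d. p k * cnj (q k))"

definition realify :: "nat \<Rightarrow> (nat \<Rightarrow> complex) \<Rightarrow> nat \<Rightarrow> real" where
  "realify d p c = (if c < 2 * d + 2 then if even c then Re (p (c div 2)) else Im (p (c div 2)) else 0)"

lemma sum_realify:
  "(\<Sum>c<2 * d + 2. g (realify d p c) (realify d q c)) = (\<Sum>k\<le>d. g (Re (p k)) (Re (q k)) + g (Im (p k)) (Im (q k)))"
proof -
  have "(\<Sum>c<2 * n. f c) = (\<Sum>k<n. f (2 * k) + f (2 * k + 1))" for f :: "nat \<Rightarrow> 'b::comm_monoid_add" and n
    by (induction n) (auto simp: add_ac)
  then have "(\<Sum>c<2 * Suc d. g (realify d p c) (realify d q c)) = (\<Sum>k<Suc d. g (realify d p (2 * k)) (realify d q (2 * k)) + g (realify d p (2 * k + 1)) (realify d q (2 * k + 1)))" .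
  also have "\<dots> = (\<Sum>k\<le>d. g (Re (p k)) (Re (q k)) + g (Im (p k)) (Im (q k)))"
    unfolding lessThan_Suc_atMost by (intro sum.cong refl) (simp add: realify_def)
  also have "2 * Suc d = 2 * d + 2" by simp
  finally show ?thesis .
qed

lemma realify_unit:
  assumes "(\<Sum>k\<le>d. (cmod (p k))\<^sup>2) = 1"
  shows "realify d p \<in> unit_sphere_pts (2 * d + 2)"
proof -
  have "(\<Sum>c<2 * d + 2. (realify d p c)\<^sup>2) = (\<Sum>k\<le>d. (cmod (p k))\<^sup>2)"
    using sum_realify[of "\<lambda>a b. a\<^sup>2" d p p] by (simp add: cmod_power2)
  then show ?thesis using assms by (auto simp: unit_sphere_pts_def realify_def)
qed

lemma edist_realify:
  assumes "(\<Sum>k\<le>d. (cmod (p k))\<^sup>2) = 1" "(\<Sum>k\<le>d. (cmod (q k))\<^sup>2) = 1"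
  shows "(edist (2 * d + 2) (realify d p) (realify d q))\<^sup>2 = 2 - 2 * Re (hinner d p q)"
proof -
  have "(edist (2 * d + 2) (realify d p) (realify d q))\<^sup>2 = (\<Sum>k\<le>d. (Re (p k) - Re (q k))\<^sup>2 + (Im (p k) - Im (q k))\<^sup>2)"
    unfolding edist_def sum_realify[of "\<lambda>a b. (a - b)\<^sup>2"] by (simp add: sum_nonneg)
  also have "\<dots> = (\<Sum>k\<le>d. (cmod (p k))\<^sup>2 + (cmod (q k))\<^sup>2 - 2 * Re (p k * cnj (q k)))"
    by (intro sum.cong refl) (simp add: cmod_power2, simp add: power2_eq_square algebra_simps)
  also have "\<dots> = 2 - 2 * Re (hinner d p q)"
    by (simp add: sum.distrib sum_subtractf assms hinner_def sum_distrib_left)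
  finally show ?thesis .
qed

text \<open>Also correct for coinciding points, where both sides are the junk value 0; this lets the
  energy be summed over all pairs of indices, the diagonal included.\<close>
lemma edist_realify_powr:
  assumes "(\<Sum>k\<le>d. (cmod (p k))\<^sup>2) = 1" "(\<Sum>k\<le>d. (cmod (q k))\<^sup>2) = 1"
  shows "edist (2 * d + 2) (realify d p) (realify d q) powr (- 2) = inverse (2 - 2 * Re (hinner d p q))"
proof -
  define \<rho> where "\<rho> = edist (2 * d + 2) (realify d p) (realify d q)"
  have "\<rho> \<ge> 0" by (simp add: \<rho>_def edist_def sum_nonneg)
  then have "\<rho> powr (- 2) = inverse (\<rho>\<^sup>2)" by (simp only: powr_minus powr_numeral)
  then show ?thesis unfolding \<rho>_def edist_realify[OF assms] .
qed

lemma min_energy_le_riesz_energy: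
  assumes "inj_on x {..<n}" "\<And>i. i < n \<Longrightarrow> x i \<in> unit_sphere_pts m"
  shows "min_energy m s n \<le> riesz_energy m s n x"
  unfolding min_energy_def
proof (rule cInf_lower)
  show "bdd_below {riesz_energy m s n x |x. inj_on x {..<n} \<and> (\<forall>i<n. x i \<in> unit_sphere_pts m)}"
    by (rule bdd_belowI[of _ 0]) (auto simp: riesz_energy_def intro!: sum_nonneg)
qed (use assms in auto)

lemma hinner_scale: "hinner d (\<lambda>k. a * p k) (\<lambda>k. b * q k) = a * cnj b * hinner d p q"
  by (simp add: hinner_def sum_distrib_left mult_ac)

lemma cnj_hinner: "cnj (hinner d p q) = hinner d q p"
  by (simp add: hinner_def mult.commute)

lemma sum_double_div_mod:
  fixes g :: "nat \<Rightarrow> nat \<Rightarrow> real"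
  shows "(\<Sum>m<N * k. g (m div k) (m mod k)) = (\<Sum>i<N. \<Sum>l<k. g i l)"
proof -
  have "(\<Sum>m<N * k. g (m div k) (m mod k)) = (\<Sum>i<N. \<Sum>m = i * k..<i * k + k. g (m div k) (m mod k))"
    by (rule sum.nat_group[symmetric])
  also have "\<dots> = (\<Sum>i<N. \<Sum>l<k. g i l)"
  proof (rule sum.cong[OF refl])
    fix i
    have dm: "m div k = i \<and> m mod k = m - i * k" if "m \<in> {i * k..<i * k + k}" for m
    proof -
      define l where "l = m - i * k"
      have "m = i * k + l" "l < k" using that by (auto simp: l_def)
      then show ?thesis by simp
    qed
    show "(\<Sum>m = i * k..<i * k + k. g (m div k) (m mod k)) = (\<Sum>l<k. g i l)"
      by (rule sum.reindex_bij_witness[where j = "\<lambda>m. m - i * k" and i = "\<lambda>l. i * k + l"])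
        (auto simp: dm)
  qed
  finally show ?thesis .
qed

text \<open>For each K, rotations of the fibres by K-th roots of unity can be chosen so that the
  total cross interaction is at most the sum of the averages, themselves bounded by
  \<open>phase_bound\<close>. The configuration depends on K, but the minimal energy and the self
  energy do not, so K may then tend to infinity.\<close>

lemma min_energy_le_fibres:
  fixes p :: "nat \<Rightarrow> nat \<Rightarrow> complex"
  assumes unit: "\<And>i. i < N \<Longrightarrow> (\<Sum>k\<le>d. (cmod (p i k))\<^sup>2) = 1"
    and lt: "\<And>i j. i < N \<Longrightarrow> j < N \<Longrightarrow> i \<noteq> j \<Longrightarrow> cmod (hinner d (p i) (p j)) < 1"
    and k: "k > 0"
  shows "min_energy (2 * d + 2) 2 (N * k) \<le> real N * (real k * (real k ^ 2 - 1) / 12)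
    + (real k)\<^sup>2 * (\<Sum>i<N. \<Sum>j\<in>{..<N}-{i}. 1 / (2 * sqrt (1 - (cmod (hinner d (p i) (p j)))\<^sup>2)))"
    (is "?m \<le> ?self + _ * ?cross")
proof -
  define \<omega> where "\<omega> l = cis (2 * pi * real l / real k)" for l
  define r where "r i j = cmod (hinner d (p i) (p j))" for i j
  have rsym: "r i j = r j i" for i j unfolding r_def by (subst cnj_hinner[symmetric]) simp
  have bound: "?m \<le> ?self + (real k)\<^sup>2 * (\<Sum>i<N. \<Sum>j\<in>{..<N}-{i}. phase_bound K (r i j))" if K: "K > 0" for K
  proof -
    define \<zeta> where "\<zeta> a = cis (2 * pi * real a / real K)" for a :: nat
    define h where "h i j a b = (\<Sum>l<k. \<Sum>l'<k. inverse (2 - 2 * Re (\<omega> l * \<zeta> a * cnj (\<omega> l' * \<zeta> b) * hinner d (p i) (p j))))" for i j a b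
    have avg: "(\<Sum>b<K. h i j a b) \<le> real (card {..<K}) * ((real k)\<^sup>2 * phase_bound K (r i j))"
      if ij: "i < j" "j < N" for i j a
    proof -
      have inner: "(\<Sum>b<K. inverse (2 - 2 * Re (\<omega> l * \<zeta> a * cnj (\<omega> l' * \<zeta> b) * hinner d (p i) (p j)))) \<le> real K * phase_bound K (r i j)" for l l'
      proof -
        \<comment> \<open>\<open>c\<close> collects every phase except the one being averaged; after
          conjugation the real part has the form \<open>Re (\<zeta> b * c)\<close> treated by
          \<open>sum_phases_le\<close>.\<close>
        define c where "c = cnj (\<omega> l * \<zeta> a) * \<omega> l' * hinner d (p j) (p i)"
        have c: "cmod c = r i j" by (simp add: c_def norm_mult \<omega>_def \<zeta>_def rsym[of i j] r_def[of j i])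
        have "Re (\<omega> l * \<zeta> a * cnj (\<omega> l' * \<zeta> b) * hinner d (p i) (p j)) = Re (\<zeta> b * c)" for b
        proof -
          have "cnj (\<zeta> b * c) = \<omega> l * \<zeta> a * cnj (\<omega> l' * \<zeta> b) * hinner d (p i) (p j)"
            by (simp add: c_def cnj_hinner mult_ac)
          then show ?thesis by (metis complex_cnj(1) cnj.simps(1))
        qed
        then have "(\<Sum>b<K. inverse (2 - 2 * Re (\<omega> l * \<zeta> a * cnj (\<omega> l' * \<zeta> b) * hinner d (p i) (p j)))) = (\<Sum>b<K. 1 / (2 - 2 * Re (\<zeta> b * c)))"
          by (simp add: inverse_eq_divide)
        also have "\<dots> \<le> real K * phase_bound K (cmod c)"
          unfolding \<zeta>_def using lt[of i j] ij K c by (intro sum_phases_le) (auto simp: r_def)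
        finally show ?thesis by (simp add: c)
      qed
      have "(\<Sum>b<K. h i j a b) = (\<Sum>l<k. \<Sum>l'<k. \<Sum>b<K. inverse (2 - 2 * Re (\<omega> l * \<zeta> a * cnj (\<omega> l' * \<zeta> b) * hinner d (p i) (p j))))"
        unfolding h_def by (subst sum.swap, rule sum.cong[OF refl], rule sum.swap)
      also have "\<dots> \<le> (\<Sum>l<k. \<Sum>l'<k. real K * phase_bound K (r i j))" by (intro sum_mono inner)
      finally show ?thesis by (simp add: power2_eq_square mult_ac)
    qed
    obtain f where f: "\<And>i. f i < K" "(\<Sum>j<N. \<Sum>i<j. h i j (f i) (f j)) \<le> (\<Sum>j<N. \<Sum>i<j. (real k)\<^sup>2 * phase_bound K (r i j))"
      using exists_assignment_pairwise_average[of "{..<K}" N h "\<lambda>i j. (real k)\<^sup>2 * phase_bound K (r i j)"] avg K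
      by (auto simp: lessThan_empty_iff)
    \<comment> \<open>Index \<open>m\<close> stands for position \<open>m mod k\<close> on the
      circle over \<open>p (m div k)\<close>.\<close>
    define y where "y m = (\<lambda>c. \<omega> (m mod k) * \<zeta> (f (m div k)) * p (m div k) c)" for m
    define x where "x m = realify d (y m)" for m
    define H where "H i j l l' = inverse (2 - 2 * Re (\<omega> l * \<zeta> (f i) * cnj (\<omega> l' * \<zeta> (f j)) * hinner d (p i) (p j)))" for i j l l'
    have div: "m div k < N" if "m < N * k" for m using that k by (simp add: less_mult_imp_div_less)
    have yunit: "(\<Sum>c\<le>d. (cmod (y m c))\<^sup>2) = 1" if "m < N * k" for m
      using unit[OF div[OF that]] by (simp add: y_def norm_mult \<omega>_def \<zeta>_def)
    have hy: "hinner d (y m) (y m') = \<omega> (m mod k) * \<zeta> (f (m div k)) * cnj (\<omega> (m' mod k) * \<zeta> (f (m' div k))) * hinner d (p (m div k)) (p (m' div k))" for m m'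
      unfolding y_def by (rule hinner_scale)
    have hpp: "hinner d (p i) (p i) = 1" if "i < N" for i
    proof -
      have "hinner d (p i) (p i) = of_real (\<Sum>k\<le>d. (cmod (p i k))\<^sup>2)"
        unfolding hinner_def of_real_sum complex_norm_square ..
      then show ?thesis using unit[OF that] by simp
    qed
    have zz: "\<zeta> a * cnj (\<zeta> a) = 1" for a by (simp add: \<zeta>_def cis_cnj cis_mult)
    have hyd: "hinner d (y m) (y m') = cis (2 * pi * (real (m mod k) - real (m' mod k)) / real k)"
      if "m div k = m' div k" "m < N * k" for m m'
    proof -
      have "hinner d (y m) (y m') = \<omega> (m mod k) * cnj (\<omega> (m' mod k)) * (\<zeta> (f (m div k)) * cnj (\<zeta> (f (m div k))))"
        unfolding hy using that(1) hpp[OF div[OF that(2)]] by (simp add: mult_ac)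
      then show ?thesis by (simp only: zz) (simp add: \<omega>_def cis_cnj cis_mult diff_divide_distrib algebra_simps)
    qed
    have inj: "inj_on x {..<N * k}"
    proof (rule inj_onI, clarsimp)
      fix m m' assume m: "m < N * k" "m' < N * k" "x m = x m'"
      have "(edist (2 * d + 2) (x m) (x m'))\<^sup>2 = 0" using m by (simp add: edist_def)
      then have re: "Re (hinner d (y m) (y m')) = 1"
        using edist_realify[OF yunit[OF m(1)] yunit[OF m(2)]] by (simp add: x_def)
      have dd: "m div k = m' div k"
      proof (rule ccontr)
        assume "m div k \<noteq> m' div k"
        then have "cmod (hinner d (y m) (y m')) < 1"
          using lt[OF div[OF m(1)] div[OF m(2)]] by (simp add: hy norm_mult \<omega>_def \<zeta>_def)
        then show False using re complex_Re_le_cmod[of "hinner d (y m) (y m')"] by simp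
      qed
      have "m mod k = m' mod k"
        using re cos_root_of_unity_eq_1_iff[of "m mod k" k "m' mod k"] k
        unfolding hyd[OF dd m(1)] by simp
      then show "m = m'" using dd by (metis div_mod_decomp)
    qed
    have en: "edist (2 * d + 2) (x m) (x m') powr (- 2) = H (m div k) (m' div k) (m mod k) (m' mod k)"
      if "m < N * k" "m' < N * k" for m m'
      unfolding x_def edist_realify_powr[OF yunit[OF that(1)] yunit[OF that(2)]] H_def hy ..
    \<comment> \<open>Including the diagonal is free, since \<open>0 powr (- 2)\<close> is 0, and
      gives a full square of indices that splits along \<open>div\<close> and
      \<open>mod\<close>.\<close>
    have "riesz_energy (2 * d + 2) 2 (N * k) x = (\<Sum>m<N * k. \<Sum>m'<N * k. H (m div k) (m' div k) (m mod k) (m' mod k))"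
      unfolding riesz_energy_def
    proof (rule sum.cong[OF refl])
      fix m assume "m \<in> {..<N * k}"
      have "(\<Sum>j\<in>{..<N * k}-{m}. edist (2 * d + 2) (x m) (x j) powr (- 2)) = (\<Sum>j<N * k. edist (2 * d + 2) (x m) (x j) powr (- 2))"
        by (rule sum.mono_neutral_left) (auto simp: edist_def)
      also have "\<dots> = (\<Sum>m'<N * k. H (m div k) (m' div k) (m mod k) (m' mod k))"
        using \<open>m \<in> _\<close> by (intro sum.cong refl en) auto
      finally show "(\<Sum>j\<in>{..<N * k}-{m}. edist (2 * d + 2) (x m) (x j) powr (- 2)) = (\<Sum>m'<N * k. H (m div k) (m' div k) (m mod k) (m' mod k))" .
    qed
    also have "\<dots> = (\<Sum>m<N * k. \<Sum>j<N. \<Sum>l'<k. H (m div k) j (m mod k) l')"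
      by (intro sum.cong refl sum_double_div_mod)
    also have "\<dots> = (\<Sum>i<N. \<Sum>l<k. \<Sum>j<N. \<Sum>l'<k. H i j l l')"
      by (rule sum_double_div_mod)
    also have "\<dots> = (\<Sum>i<N. \<Sum>j<N. \<Sum>l<k. \<Sum>l'<k. H i j l l')"
      by (intro sum.cong refl sum.swap)
    also have "\<dots> = (\<Sum>i<N. (\<Sum>l<k. \<Sum>l'<k. H i i l l') + (\<Sum>j\<in>{..<N}-{i}. h i j (f i) (f j)))"
      by (intro sum.cong refl, subst sum.remove) (auto simp: H_def h_def)
    also have "\<dots> = (\<Sum>i<N. real k * ((real k)\<^sup>2 - 1) / 12) + (\<Sum>i<N. \<Sum>j\<in>{..<N}-{i}. h i j (f i) (f j))"
    proof -
      have "(\<Sum>l<k. \<Sum>l'<k. H i i l l') = real k * ((real k)\<^sup>2 - 1) / 12" if "i < N" for i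
      proof -
        \<comment> \<open>The rotation common to a whole fibre cancels in its self energy, leaving
          the equally spaced points on one circle.\<close>
        have H: "H i i l l' = inverse (2 - 2 * Re (\<omega> l * cnj (\<omega> l')))" for l l'
        proof -
          have "\<omega> l * \<zeta> (f i) * cnj (\<omega> l' * \<zeta> (f i)) * hinner d (p i) (p i) = \<omega> l * cnj (\<omega> l') * (\<zeta> (f i) * cnj (\<zeta> (f i)))"
            by (simp add: hpp[OF that] mult_ac)
          then show ?thesis by (simp only: H_def zz mult_1_right)
        qed
        have "(\<Sum>l<k. \<Sum>l'<k. H i i l l') = (\<Sum>l'<k. \<Sum>l<k. inverse (2 - 2 * Re (\<omega> l * cnj (\<omega> l'))))"
          unfolding H by (rule sum.swap)
        also have "\<dots> = (\<Sum>l'<k. ((real k)\<^sup>2 - 1) / 12)"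
          unfolding \<omega>_def by (intro sum.cong refl sum_inverse_sq_dist_roots) simp
        finally show ?thesis by simp
      qed
      then have "(\<Sum>i<N. \<Sum>l<k. \<Sum>l'<k. H i i l l') = (\<Sum>i<N. real k * ((real k)\<^sup>2 - 1) / 12)"
        by (intro sum.cong[OF refl]) simp
      then show ?thesis by (simp only: sum.distrib)
    qed
    also have "(\<Sum>i<N. \<Sum>j\<in>{..<N}-{i}. h i j (f i) (f j)) = 2 * (\<Sum>j<N. \<Sum>i<j. h i j (f i) (f j))"
    proof (rule sum_off_diagonal_symmetric)
      fix i j
      have "Re (\<omega> l * \<zeta> (f i) * cnj (\<omega> l' * \<zeta> (f j)) * hinner d (p i) (p j)) = Re (\<omega> l' * \<zeta> (f j) * cnj (\<omega> l * \<zeta> (f i)) * hinner d (p j) (p i))" for l l'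
      proof -
        have "cnj (\<omega> l * \<zeta> (f i) * cnj (\<omega> l' * \<zeta> (f j)) * hinner d (p i) (p j)) = \<omega> l' * \<zeta> (f j) * cnj (\<omega> l * \<zeta> (f i)) * hinner d (p j) (p i)"
          by (simp add: cnj_hinner mult_ac)
        then show ?thesis by (metis cnj.simps(1))
      qed
      then show "h i j (f i) (f j) = h j i (f j) (f i)"
        unfolding h_def by (simp only: ) (rule sum.swap)
    qed
    also have "2 * (\<Sum>j<N. \<Sum>i<j. h i j (f i) (f j)) \<le> 2 * (\<Sum>j<N. \<Sum>i<j. (real k)\<^sup>2 * phase_bound K (r i j))"
      using f(2) by simp
    also have "\<dots> = (\<Sum>i<N. \<Sum>j\<in>{..<N}-{i}. (real k)\<^sup>2 * phase_bound K (r i j))"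
      by (rule sum_off_diagonal_symmetric[symmetric]) (simp add: rsym)
    finally have "riesz_energy (2 * d + 2) 2 (N * k) x \<le> ?self + (real k)\<^sup>2 * (\<Sum>i<N. \<Sum>j\<in>{..<N}-{i}. phase_bound K (r i j))"
      by (simp add: sum_distrib_left)
    moreover have "?m \<le> riesz_energy (2 * d + 2) 2 (N * k) x"
      by (rule min_energy_le_riesz_energy[OF inj]) (simp only: x_def realify_unit[OF yunit])
    ultimately show ?thesis by simp
  qed
  have "(\<lambda>K. ?self + (real k)\<^sup>2 * (\<Sum>i<N. \<Sum>j\<in>{..<N}-{i}. phase_bound K (r i j))) \<longlonglongrightarrow>
     ?self + (real k)\<^sup>2 * (\<Sum>i<N. \<Sum>j\<in>{..<N}-{i}. 1 / (2 * sqrt (1 - (r i j)\<^sup>2)))"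
    by (intro tendsto_intros phase_bound_tendsto) (auto simp: r_def lt)
  then show ?thesis unfolding r_def[symmetric]
  proof (rule tendsto_lowerbound)
    show "\<forall>\<^sub>F K in sequentially. ?m \<le> ?self + (real k)\<^sup>2 * (\<Sum>i<N. \<Sum>j\<in>{..<N}-{i}. phase_bound K (r i j))"
      using eventually_gt_at_top[of 0] by eventually_elim (rule bound)
  qed simp
qed

section \<open>The interaction kernel and its averages\<close>

text \<open>Taylor coefficients of (1 - t)^(-1/2), equal to the central binomial coefficient of 2m
  over 4^m.\<close>

definition bincoeff :: "nat \<Rightarrow> real" where
  "bincoeff m = pochhammer (1/2) m / fact m"

lemma bincoeff_nonneg: "0 \<le> bincoeff m"
  by (simp add: bincoeff_def pochhammer_nonneg)

lemma bincoeff_Suc: "bincoeff (Suc m) = bincoeff m * ((2 * real m + 1) / (2 * real m + 2))"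
  by (simp add: bincoeff_def pochhammer_Suc field_simps)

lemma bincoeff_antimono: "m \<le> n \<Longrightarrow> bincoeff n \<le> bincoeff m"
proof (rule lift_Suc_antimono_le[of bincoeff])
  fix n
  have "bincoeff n * ((2 * real n + 1) / (2 * real n + 2)) \<le> bincoeff n * 1"
    by (intro mult_left_mono bincoeff_nonneg) (simp add: divide_simps)
  then show "bincoeff (Suc n) \<le> bincoeff n" by (simp add: bincoeff_Suc)
qed

lemma bincoeff_tendsto_0: "bincoeff \<longlonglongrightarrow> 0"
proof -
  \<comment> \<open>A Wallis type bound, proved by induction from (2m + 1)(2m + 3) \<le> (2m +
    2)^2.\<close>
  have sq: "(bincoeff m)\<^sup>2 \<le> 1 / (2 * real m + 1)" for m
  proof (induction m)
    case (Suc m)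
    have "(bincoeff (Suc m))\<^sup>2 = (bincoeff m)\<^sup>2 * ((2 * real m + 1) / (2 * real m + 2))\<^sup>2"
      by (simp only: bincoeff_Suc power_mult_distrib)
    also have "\<dots> \<le> 1 / (2 * real m + 1) * ((2 * real m + 1) / (2 * real m + 2))\<^sup>2"
      by (intro mult_right_mono Suc) auto
    also have "\<dots> = (2 * real m + 1) / (2 * real m + 2)\<^sup>2"
      by (simp add: power2_eq_square)
    also have "\<dots> \<le> 1 / (2 * real (Suc m) + 1)"
      by (simp add: divide_simps, simp add: power2_eq_square algebra_simps)
    finally show ?case .
  qed (simp add: bincoeff_def)
  have lim: "(\<lambda>m. 1 / (2 * real m + 1)) \<longlonglongrightarrow> 0" by real_asymp
  have "(\<lambda>m. (bincoeff m)\<^sup>2) \<longlonglongrightarrow> 0"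
    by (rule tendsto_sandwich[OF _ _ tendsto_const lim]) (use sq in \<open>auto intro: always_eventually\<close>)
  then have "(\<lambda>m. sqrt ((bincoeff m)\<^sup>2)) \<longlonglongrightarrow> sqrt 0" by (rule tendsto_real_sqrt)
  then show ?thesis by (simp add: bincoeff_nonneg)
qed

lemma bincoeff_sums:
  assumes "\<bar>t\<bar> < 1"
  shows "(\<lambda>m. bincoeff m * t ^ m) sums (1 / sqrt (1 - t))"
proof -
  have "(\<lambda>m. ((-1/2) gchoose m) * (- t) ^ m) sums (1 + (- t)) powr (-1/2)"
    using assms by (intro gen_binomial_real) auto
  moreover have "((-1/2) gchoose m) * (- t) ^ m = bincoeff m * t ^ m" for m
  proof -
    have "(-1 :: real) ^ m * (-1) ^ m = 1" by (simp flip: power_mult_distrib)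
    then have "(-1) ^ m * pochhammer (1/2) m / fact m * ((-1) ^ m * t ^ m) = pochhammer (1/2) m / fact m * t ^ m"
      by simp
    then show ?thesis by (simp add: bincoeff_def gbinomial_pochhammer power_minus[of t])
  qed
  moreover have "(1 + (- t)) powr (-1/2) = 1 / sqrt (1 - t)"
    using assms by (simp add: powr_minus_divide[of _ "1/2", simplified] powr_half_sqrt)
  ultimately show ?thesis by simp
qed

lemma bincoeff_diff_sums:
  assumes "\<bar>t\<bar> < 1"
  shows "(\<lambda>m. bincoeff m * (t ^ m - t ^ (m + L))) sums ((1 - t ^ L) / sqrt (1 - t))"
proof -
  have "(\<lambda>m. bincoeff m * t ^ m - t ^ L * (bincoeff m * t ^ m)) sums (1 / sqrt (1 - t) - t ^ L * (1 / sqrt (1 - t)))"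
    using assms by (intro sums_diff sums_mult bincoeff_sums)
  moreover have "bincoeff m * t ^ m - t ^ L * (bincoeff m * t ^ m) = bincoeff m * (t ^ m - t ^ (m + L))" for m
    by (simp add: power_add algebra_simps)
  ultimately show ?thesis by (simp add: diff_divide_distrib)
qed

text \<open>Each difference t^m - t^(m+L) is \<open>f m - f (Suc m)\<close>, where \<open>f\<close>
  is a window of L consecutive powers and takes values in [0, L]. Since the coefficients decrease,
  the tail is at most \<open>bincoeff (Suc M)\<close> times a telescoping sum, hence bounded
  uniformly up to t = 1.\<close>

lemma truncated_kernel_bound:
  assumes t: "0 \<le> t" "t \<le> 1"
  shows "(1 - t ^ L) / sqrt (1 - t) \<le> (\<Sum>m\<le>M. bincoeff m * (t ^ m - t ^ (m + L))) + real L * bincoeff (Suc M)"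
proof (cases "t = 1")
  \<comment> \<open>At t = 1 the left-hand side is 0 / 0 = 0.\<close>
  case True
  then show ?thesis using bincoeff_nonneg by simp
next
  case False
  define f where "f n = (\<Sum>i<L. t ^ (n + i))" for n
  define g where "g m = t ^ m - t ^ (m + L)" for m
  define S where "S = (\<Sum>m<Suc M. bincoeff m * g m)"
  have gf: "g m = f m - f (Suc m)" for m
  proof -
    have "f (Suc m) + t ^ m = f m + t ^ (m + L)"
      unfolding f_def using sum.lessThan_Suc_shift[of "\<lambda>i. t ^ (m + i)" L] by (simp add: add_ac)
    then show ?thesis by (simp add: g_def)
  qed
  have g0: "0 \<le> g m" for m using t by (simp add: g_def power_decreasing)
  have f0: "0 \<le> f n" for n using t by (simp add: f_def sum_nonneg)
  have fL: "f n \<le> real L" for n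
  proof -
    have "f n \<le> (\<Sum>i<L. 1)" unfolding f_def using t by (intro sum_mono power_le_one)
    then show ?thesis by simp
  qed
  have part: "(\<Sum>m<Suc M + j. bincoeff m * g m) \<le> S + bincoeff (Suc M) * (f (Suc M) - f (Suc M + j))" for j
  proof (induction j)
    case (Suc j)
    have "bincoeff (Suc M + j) * g (Suc M + j) \<le> bincoeff (Suc M) * g (Suc M + j)"
      by (intro mult_right_mono bincoeff_antimono g0) auto
    then show ?case using Suc by (simp add: gf algebra_simps)
  qed (simp add: S_def)
  have "(\<lambda>m. bincoeff m * g m) sums ((1 - t ^ L) / sqrt (1 - t))"
    unfolding g_def using t False by (intro bincoeff_diff_sums) auto
  then have "(\<lambda>n. \<Sum>m<n. bincoeff m * g m) \<longlonglongrightarrow> (1 - t ^ L) / sqrt (1 - t)" by (simp add: sums_def)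
  then have "(1 - t ^ L) / sqrt (1 - t) \<le> S + bincoeff (Suc M) * real L"
  proof (rule tendsto_upperbound)
    show "\<forall>\<^sub>F n in sequentially. (\<Sum>m<n. bincoeff m * g m) \<le> S + bincoeff (Suc M) * real L"
    proof (rule eventually_sequentiallyI[of "Suc M"])
      fix n assume "n \<ge> Suc M"
      then obtain j where j: "n = Suc M + j" using le_Suc_ex by blast
      have "bincoeff (Suc M) * (f (Suc M) - f (Suc M + j)) \<le> bincoeff (Suc M) * real L"
        using f0[of "Suc M + j"] fL[of "Suc M"] by (intro mult_left_mono bincoeff_nonneg) simp
      then show "(\<Sum>m<n. bincoeff m * g m) \<le> S + bincoeff (Suc M) * real L"
        using part[of j] unfolding j by linarith
    qed
  qed simp
  then show ?thesis by (simp add: S_def g_def lessThan_Suc_atMost mult.commute)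
qed

section \<open>Lagrange's identity, monotonicity in the weights, and equality in
  Cauchy-Schwarz\<close>

lemma lagrange_identity:
  fixes x y :: "'i \<Rightarrow> complex" and v :: "'i \<Rightarrow> real"
  shows "(\<Sum>a\<in>I. v a * (cmod (x a))\<^sup>2) * (\<Sum>a\<in>I. v a * (cmod (y a))\<^sup>2) - (cmod (\<Sum>a\<in>I. of_real (v a) * (x a * cnj (y a))))\<^sup>2
    = (\<Sum>a\<in>I. \<Sum>b\<in>I. v a * v b * (cmod (x a * y b - x b * y a))\<^sup>2) / 2"
proof -
  have "complex_of_real (\<Sum>a\<in>I. \<Sum>b\<in>I. v a * v b * (cmod (x a * y b - x b * y a))\<^sup>2)
    = (\<Sum>a\<in>I. \<Sum>b\<in>I. of_real (v a) * of_real (v b) *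
        (x a * cnj (x a) * (y b * cnj (y b)) + x b * cnj (x b) * (y a * cnj (y a))
         - x a * cnj (y a) * (y b * cnj (x b)) - y a * cnj (x a) * (x b * cnj (y b))))"
    unfolding of_real_sum of_real_mult complex_norm_square
    by (intro sum.cong refl) (simp add: algebra_simps)
  also have "\<dots> = 2 * ((\<Sum>a\<in>I. of_real (v a) * (x a * cnj (x a))) * (\<Sum>b\<in>I. of_real (v b) * (y b * cnj (y b)))
     - (\<Sum>a\<in>I. of_real (v a) * (x a * cnj (y a))) * (\<Sum>b\<in>I. of_real (v b) * (y b * cnj (x b))))"
  proof -
    have 1: "(\<Sum>a\<in>I. \<Sum>b\<in>I. of_real (v a) * of_real (v b) * (x b * cnj (x b) * (y a * cnj (y a))))
      = (\<Sum>a\<in>I. of_real (v a) * (x a * cnj (x a))) * (\<Sum>b\<in>I. of_real (v b) * (y b * cnj (y b)))"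
      unfolding sum_product by (subst sum.swap) (intro sum.cong refl, simp add: mult_ac)
    have 2: "(\<Sum>a\<in>I. \<Sum>b\<in>I. of_real (v a) * of_real (v b) * (y a * cnj (x a) * (x b * cnj (y b))))
      = (\<Sum>a\<in>I. of_real (v a) * (x a * cnj (y a))) * (\<Sum>b\<in>I. of_real (v b) * (y b * cnj (x b)))"
      unfolding sum_product by (subst sum.swap) (intro sum.cong refl, simp add: mult_ac)
    have 3: "(\<Sum>a\<in>I. \<Sum>b\<in>I. of_real (v a) * of_real (v b) * (x a * cnj (x a) * (y b * cnj (y b))))
      = (\<Sum>a\<in>I. of_real (v a) * (x a * cnj (x a))) * (\<Sum>b\<in>I. of_real (v b) * (y b * cnj (y b)))"
      unfolding sum_product by (intro sum.cong refl, simp add: mult_ac)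
    have 4: "(\<Sum>a\<in>I. \<Sum>b\<in>I. of_real (v a) * of_real (v b) * (x a * cnj (y a) * (y b * cnj (x b))))
      = (\<Sum>a\<in>I. of_real (v a) * (x a * cnj (y a))) * (\<Sum>b\<in>I. of_real (v b) * (y b * cnj (x b)))"
      unfolding sum_product by (intro sum.cong refl, simp add: mult_ac)
    show ?thesis by (simp only: distrib_left right_diff_distrib sum.distrib sum_subtractf 1 2 3 4 mult_2 diff_diff_eq)
  qed
  also have "\<dots> = complex_of_real (2 * ((\<Sum>a\<in>I. v a * (cmod (x a))\<^sup>2) * (\<Sum>a\<in>I. v a * (cmod (y a))\<^sup>2) - (cmod (\<Sum>a\<in>I. of_real (v a) * (x a * cnj (y a))))\<^sup>2))"
    unfolding of_real_mult of_real_diff of_real_sum complex_norm_square cnj_sum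
    by (simp add: mult_ac)
  finally show ?thesis unfolding of_real_eq_iff by simp
qed

text \<open>Monotonicity in the weights is invisible in a difference of two terms, but evident once
  \<open>lagrange_identity\<close> writes it as a sum of squares with coefficients
  \<open>v a * v b\<close>.\<close>

lemma lagrange_mono:
  fixes x y :: "'i \<Rightarrow> complex" and v w :: "'i \<Rightarrow> real"
  assumes "\<And>a. a \<in> I \<Longrightarrow> 0 \<le> v a" "\<And>a. a \<in> I \<Longrightarrow> v a \<le> w a"
  shows "(\<Sum>a\<in>I. v a * (cmod (x a))\<^sup>2) * (\<Sum>a\<in>I. v a * (cmod (y a))\<^sup>2) - (cmod (\<Sum>a\<in>I. of_real (v a) * (x a * cnj (y a))))\<^sup>2
    \<le> (\<Sum>a\<in>I. w a * (cmod (x a))\<^sup>2) * (\<Sum>a\<in>I. w a * (cmod (y a))\<^sup>2) - (cmod (\<Sum>a\<in>I. of_real (w a) * (x a * cnj (y a))))\<^sup>2"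
  unfolding lagrange_identity
  by (intro divide_right_mono sum_mono mult_right_mono mult_mono) (use assms in \<open>auto intro: order_trans\<close>)

lemma hinner_lagrange:
  assumes "(\<Sum>k\<le>d. (cmod (p k))\<^sup>2) = 1" "(\<Sum>k\<le>d. (cmod (q k))\<^sup>2) = 1"
  shows "1 - (cmod (hinner d p q))\<^sup>2 = (\<Sum>a\<le>d. \<Sum>b\<le>d. (cmod (p a * q b - p b * q a))\<^sup>2) / 2"
  using lagrange_identity[of "\<lambda>_. 1" p "{..d}" q] assms by (simp add: hinner_def)

lemma cmod_hinner_le_1:
  assumes "(\<Sum>k\<le>d. (cmod (p k))\<^sup>2) = 1" "(\<Sum>k\<le>d. (cmod (q k))\<^sup>2) = 1"
  shows "(cmod (hinner d p q))\<^sup>2 \<le> 1"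
proof -
  have "0 \<le> (\<Sum>a\<le>d. \<Sum>b\<le>d. (cmod (p a * q b - p b * q a))\<^sup>2) / 2" by (intro divide_nonneg_pos sum_nonneg) auto
  then show ?thesis using hinner_lagrange[OF assms] by linarith
qed

text \<open>Equality in Cauchy-Schwarz makes all 2 by 2 minors vanish; summing them against
  \<open>cnj (q b)\<close> recovers the factor of proportionality.\<close>

lemma hinner_eq_1_imp_parallel:
  assumes u: "(\<Sum>k\<le>d. (cmod (p k))\<^sup>2) = 1" "(\<Sum>k\<le>d. (cmod (q k))\<^sup>2) = 1"
    and "cmod (hinner d p q) = 1" and "k \<le> d"
  shows "p k = hinner d p q * q k"
proof -
  have "(\<Sum>a\<le>d. \<Sum>b\<le>d. (cmod (p a * q b - p b * q a))\<^sup>2) = 0"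
    using hinner_lagrange[OF u] assms(3) by simp
  then have eq: "p a * q b = p b * q a" if "a \<le> d" "b \<le> d" for a b
    using that by (simp add: sum_nonneg_eq_0_iff sum_nonneg)
  have "p k = (\<Sum>b\<le>d. p k * (q b * cnj (q b)))"
    using arg_cong[OF u(2), of complex_of_real]
    unfolding sum_distrib_left[symmetric] of_real_sum complex_norm_square by simp
  also have "\<dots> = (\<Sum>b\<le>d. p b * cnj (q b) * q k)"
  proof (intro sum.cong refl)
    fix b assume "b \<in> {..d}"
    then show "p k * (q b * cnj (q b)) = p b * cnj (q b) * q k" using eq[of k b] assms(4)
      by (simp add: mult_ac)
  qed
  also have "\<dots> = hinner d p q * q k" by (simp add: hinner_def sum_distrib_right)
  finally show ?thesis .
qed

section \<open>The kernel of the monomials of fixed degree and its grid averages\<close>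

definition multinom :: "nat \<Rightarrow> nat \<Rightarrow> (nat \<Rightarrow> nat) \<Rightarrow> real" where
  "multinom d m \<alpha> = fact m / (\<Prod>k\<le>d. fact (\<alpha> k))"

lemma multinom_pos: "multinom d m \<alpha> > 0"
  by (auto simp: multinom_def intro!: divide_pos_pos prod_pos)

text \<open>With multinomial weights the kernel of the degree m monomials collapses to a power of
  the inner product. This is the source of the term t^L in the pair correlation.\<close>

lemma hinner_power:
  "hinner d p q ^ m = (\<Sum>\<alpha>\<in>multi_idx d m. of_real (multinom d m \<alpha>) * (monom_at d \<alpha> p * cnj (monom_at d \<alpha> q)))"
  unfolding hinner_def multinomial
  by (intro sum.cong refl) (simp add: multinom_def monom_at_def power_mult_distrib prod.distrib)

lemma sum_multinom_monom_sq:
  assumes "(\<Sum>k\<le>d. (cmod (p k))\<^sup>2) = 1"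
  shows "(\<Sum>\<alpha>\<in>multi_idx d m. multinom d m \<alpha> * (cmod (monom_at d \<alpha> p))\<^sup>2) = 1"
proof -
  have "hinner d p p = of_real (\<Sum>k\<le>d. (cmod (p k))\<^sup>2)"
    unfolding hinner_def of_real_sum complex_norm_square ..
  then have "hinner d p p = 1" using assms by simp
  then have "1 = complex_of_real (\<Sum>\<alpha>\<in>multi_idx d m. multinom d m \<alpha> * (cmod (monom_at d \<alpha> p))\<^sup>2)"
    using hinner_power[of d p p m] unfolding of_real_sum of_real_mult complex_norm_square by simp
  then show ?thesis by (rule of_real_eq_1_iff[THEN iffD1, OF sym])
qed

lemma monom_at_scale:
  assumes "\<alpha> \<in> multi_idx d m" "\<And>k. k \<le> d \<Longrightarrow> p k = c * q k"
  shows "monom_at d \<alpha> p = c ^ m * monom_at d \<alpha> q"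
proof -
  have "monom_at d \<alpha> p = (\<Prod>k\<le>d. c ^ \<alpha> k * q k ^ \<alpha> k)"
    unfolding monom_at_def by (intro prod.cong refl) (simp add: assms(2) power_mult_distrib)
  also have "\<dots> = c ^ (\<Sum>k\<le>d. \<alpha> k) * monom_at d \<alpha> q"
    by (simp only: prod.distrib monom_at_def power_sum)
  also have "(\<Sum>k\<le>d. \<alpha> k) = m" using assms(1) by (simp add: multi_idx_def)
  finally show ?thesis .
qed

text \<open>The mean of t^m over pairs of grid points, as \<open>sum_grid_hinner_power\<close>
  shows.\<close>

definition grid_moment :: "nat \<Rightarrow> nat \<Rightarrow> nat \<Rightarrow> real" where
  "grid_moment d n m = (\<Sum>\<alpha>\<in>multi_idx d m. (multinom d m \<alpha> * simplex_moment d n \<alpha>)\<^sup>2)"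

text \<open>t^m is the squared modulus of \<open>hinner_power\<close>, a double sum over
  \<open>\<alpha>\<close> and \<open>\<beta>\<close>; orthogonality in each of the two points leaves
  only \<open>\<alpha> = \<beta>\<close>.\<close>

lemma sum_grid_hinner_power:
  assumes "m < Q"
  shows "(\<Sum>x\<in>cp_grid d n Q. \<Sum>y\<in>cp_grid d n Q. ((cmod (hinner d (cp_point n Q x) (cp_point n Q y)))\<^sup>2) ^ m)
    = (real (card (cp_grid d n Q)))\<^sup>2 * grid_moment d n m"
proof -
  let ?X = "cp_grid d n Q" and ?I = "multi_idx d m"
  define P where "P \<alpha> x = monom_at d \<alpha> (cp_point n Q x)" for \<alpha> x
  define W where "W \<alpha> = complex_of_real (multinom d m \<alpha>)" for \<alpha>
  have e: "complex_of_real (((cmod (hinner d (cp_point n Q x) (cp_point n Q y)))\<^sup>2) ^ m)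
     = (\<Sum>\<alpha>\<in>?I. \<Sum>\<beta>\<in>?I. W \<alpha> * W \<beta> * ((P \<alpha> x * cnj (P \<beta> x)) * cnj (P \<alpha> y * cnj (P \<beta> y))))" for x y
  proof -
    have "complex_of_real (((cmod (hinner d (cp_point n Q x) (cp_point n Q y)))\<^sup>2) ^ m)
      = hinner d (cp_point n Q x) (cp_point n Q y) ^ m * cnj (hinner d (cp_point n Q x) (cp_point n Q y) ^ m)"
      by (simp only: of_real_power[of "(cmod (hinner d (cp_point n Q x) (cp_point n Q y)))\<^sup>2" m]
          complex_norm_square power_mult_distrib complex_cnj_power)
    also have "\<dots> = (\<Sum>\<alpha>\<in>?I. \<Sum>\<beta>\<in>?I. W \<alpha> * W \<beta> * ((P \<alpha> x * cnj (P \<beta> x)) * cnj (P \<alpha> y * cnj (P \<beta> y))))"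
      unfolding hinner_power cnj_sum sum_product
      by (intro sum.cong refl) (simp add: P_def W_def mult_ac)
    finally show ?thesis .
  qed
  have "complex_of_real (\<Sum>x\<in>?X. \<Sum>y\<in>?X. ((cmod (hinner d (cp_point n Q x) (cp_point n Q y)))\<^sup>2) ^ m)
    = (\<Sum>x\<in>?X. \<Sum>y\<in>?X. \<Sum>\<alpha>\<in>?I. \<Sum>\<beta>\<in>?I. W \<alpha> * W \<beta> * ((P \<alpha> x * cnj (P \<beta> x)) * cnj (P \<alpha> y * cnj (P \<beta> y))))"
    unfolding of_real_sum e ..
  also have "\<dots> = (\<Sum>\<alpha>\<in>?I. \<Sum>\<beta>\<in>?I. \<Sum>x\<in>?X. \<Sum>y\<in>?X. W \<alpha> * W \<beta> * ((P \<alpha> x * cnj (P \<beta> x)) * cnj (P \<alpha> y * cnj (P \<beta> y))))"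
    by (simp only: sum.swap[of _ ?I ?X])
  also have "\<dots> = (\<Sum>\<alpha>\<in>?I. \<Sum>\<beta>\<in>?I. W \<alpha> * W \<beta> * ((\<Sum>x\<in>?X. P \<alpha> x * cnj (P \<beta> x)) * cnj (\<Sum>y\<in>?X. P \<alpha> y * cnj (P \<beta> y))))"
    unfolding cnj_sum sum_product by (simp only: sum_distrib_left)
  also have "\<dots> = (\<Sum>\<alpha>\<in>?I. \<Sum>\<beta>\<in>?I. if \<beta> = \<alpha> then of_real ((multinom d m \<alpha> * (real (card ?X) * simplex_moment d n \<alpha>))\<^sup>2) else 0)"
    unfolding P_def using assms
    by (intro sum.cong refl) (auto simp: sum_grid_monom_at W_def power2_eq_square mult_ac)
  also have "\<dots> = complex_of_real ((real (card ?X))\<^sup>2 * grid_moment d n m)"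
    by (simp add: grid_moment_def sum_distrib_left power_mult_distrib mult_ac)
  finally show ?thesis by (simp only: of_real_eq_iff)
qed

text \<open>In the limit all \<open>(m + d) choose d\<close> summands are equal, each being the
  square of the reciprocal of their number. The limit is the m-th moment of the density d (1 -
  t)^(d-1) on [0,1].\<close>

lemma grid_moment_tendsto: "(\<lambda>n. grid_moment d n m) \<longlonglongrightarrow> 1 / real ((m + d) choose d)"
proof -
  have "(\<lambda>n. grid_moment d n m) \<longlonglongrightarrow> (\<Sum>\<alpha>\<in>multi_idx d m. (multinom d m \<alpha> * ((\<Prod>k\<le>d. fact (\<alpha> k)) * fact d / fact (d + m)))\<^sup>2)"
    unfolding grid_moment_def by (intro tendsto_intros simplex_moment_tendsto)
  also have "(\<Sum>\<alpha>\<in>multi_idx d m. (multinom d m \<alpha> * ((\<Prod>k\<le>d. fact (\<alpha> k)) * fact d / fact (d + m)))\<^sup>2)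
     = real ((m + d) choose d) * (fact m * fact d / fact (d + m))\<^sup>2"
    by (simp add: multinom_def card_multi_idx)
  also have "\<dots> = 1 / real ((m + d) choose d)"
    by (simp add: binomial_fact power2_eq_square add.commute)
  finally show ?thesis .
qed

section \<open>Existence of configurations\<close>

text \<open>The weights \<open>v\<close> make the monomials orthonormal on the grid, while the
  kernel is explicit only for weights \<open>w\<close> proportional to \<open>multinom\<close>. The
  condition on \<open>A\<close> gives v \<le> w, and \<open>lagrange_mono\<close> transfers the
  bound: the pair correlation is at most (A / C)^2 (1 - t^L).\<close>

lemma exists_grid_configuration:
  assumes n: "n > 0"
    and pos: "\<And>\<alpha>. \<alpha> \<in> multi_idx d L \<Longrightarrow> simplex_moment d n \<alpha> > 0"
    and A: "\<And>\<alpha>. \<alpha> \<in> multi_idx d L \<Longrightarrow> 1 / simplex_moment d n \<alpha> \<le> A * multinom d L \<alpha>"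
  shows "\<exists>p. (\<forall>i < (L + d) choose d. (\<Sum>k\<le>d. (cmod (p i k))\<^sup>2) = 1)
    \<and> (\<forall>i < (L + d) choose d. \<forall>j < (L + d) choose d. i \<noteq> j \<longrightarrow> cmod (hinner d (p i) (p j)) < 1)
    \<and> (\<Sum>i < (L + d) choose d. \<Sum>j\<in>{..<(L + d) choose d}-{i}. 1 / sqrt (1 - (cmod (hinner d (p i) (p j)))\<^sup>2))
       \<le> A\<^sup>2 * ((\<Sum>m\<le>M. bincoeff m * (grid_moment d n m - grid_moment d n (m + L))) + real L * bincoeff (Suc M))"
proof -
  \<comment> \<open>The highest moment needed below is that of order M + L; this many phases make
    all of them free of aliasing.\<close>
  define Q where "Q = Suc (M + L)"
  define X where "X = cp_grid d n Q"
  define P where "P = cp_point n Q"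
  define I where "I = multi_idx d L"
  define C where "C = real (card X)"
  let ?N = "(L + d) choose d"
  have "Q > 0" by (simp add: Q_def)
  then have C0: "C > 0" by (simp add: C_def X_def card_cp_grid card_multi_idx del: power_Suc)
  have unit: "(\<Sum>k\<le>d. (cmod (P x k))\<^sup>2) = 1" if "x \<in> X" for x
    using that cp_point_unit n by (auto simp: X_def P_def)
  obtain e where e: "bij_betw e {..<?N} I"
    using ex_bij_betw_nat_finite[of I] by (auto simp: I_def card_multi_idx atLeast0LessThan)
  have eI: "e a \<in> I" if "a < ?N" for a using e that by (auto simp: bij_betw_def)
  define v where "v \<alpha> = 1 / (C * simplex_moment d n \<alpha>)" for \<alpha>
  define w where "w \<alpha> = A / C * multinom d L \<alpha>" for \<alpha>
  define \<phi> where "\<phi> a x = of_real (sqrt (v (e a))) * monom_at d (e a) (P x)" for a x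
  have v0: "0 \<le> v \<alpha>" if "\<alpha> \<in> I" for \<alpha> using pos[of \<alpha>] that C0 by (simp add: v_def I_def)
  have vw: "v \<alpha> \<le> w \<alpha>" if "\<alpha> \<in> I" for \<alpha>
  proof -
    have "1 / C * (1 / simplex_moment d n \<alpha>) \<le> 1 / C * (A * multinom d L \<alpha>)"
      using A[of \<alpha>] that C0 by (intro mult_left_mono) (auto simp: I_def)
    then show ?thesis by (simp add: v_def w_def)
  qed
  interpret finite_orthonormal X \<phi> ?N
  proof
    show "finite X" by (simp add: X_def)
    fix a b assume ab: "a < ?N" "b < ?N"
    have "(\<Sum>x\<in>X. \<phi> a x * cnj (\<phi> b x)) = of_real (sqrt (v (e a))) * of_real (sqrt (v (e b))) *
        (\<Sum>x\<in>X. monom_at d (e a) (P x) * cnj (monom_at d (e b) (P x)))"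
      unfolding \<phi>_def sum_distrib_left by (intro sum.cong refl) (simp add: mult_ac)
    also have "(\<Sum>x\<in>X. monom_at d (e a) (P x) * cnj (monom_at d (e b) (P x)))
       = (if e a = e b then of_real (C * simplex_moment d n (e a)) else 0)"
      unfolding X_def P_def C_def by (rule sum_grid_monom_at) (use eI ab in \<open>auto simp: I_def Q_def\<close>)
    also have "e a = e b \<longleftrightarrow> a = b" using e ab by (auto simp: bij_betw_def inj_on_eq_iff)
    also have "of_real (sqrt (v (e a))) * of_real (sqrt (v (e b))) * (if a = b then of_real (C * simplex_moment d n (e a)) else 0)
       = (if a = b then 1 else (0::complex))"
    proof (cases "a = b")
      case True
      have "sqrt (v (e a)) * sqrt (v (e a)) = v (e a)" using v0[OF eI[OF ab(1)]] by simp
      moreover have "v (e a) * (C * simplex_moment d n (e a)) = 1"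
        using pos[of "e a"] eI[OF ab(1)] C0 by (simp add: v_def I_def)
      ultimately have "complex_of_real (sqrt (v (e a)) * sqrt (v (e a)) * (C * simplex_moment d n (e a))) = 1"
        by (simp only: of_real_1)
      then show ?thesis using True by (simp only: of_real_mult if_True simp_thms)
    qed simp
    finally show "(\<Sum>x\<in>X. \<phi> a x * cnj (\<phi> b x)) = (if a = b then 1 else 0)" .
  qed
  define t where "t u z = (cmod (hinner d (P u) (P z)))\<^sup>2" for u z
  \<comment> \<open>At \<open>t u z = 1\<close> the value is 1 / 0 = 0. No interaction is lost by
    this, since a configuration of nonzero weight contains no such pair, as \<open>lt1\<close>
    shows.\<close>
  define F where "F u z = 1 / sqrt (1 - t u z)" for u z
  have t01: "0 \<le> t u z" "t u z \<le> 1" if "u \<in> X" "z \<in> X" for u z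
    using cmod_hinner_le_1[OF unit[OF that(1)] unit[OF that(2)]] by (auto simp: t_def)
  have kern: "(\<Sum>a<?N. (cmod (\<phi> a u))\<^sup>2) * (\<Sum>a<?N. (cmod (\<phi> a z))\<^sup>2) - (cmod (\<Sum>a<?N. \<phi> a u * cnj (\<phi> a z)))\<^sup>2
     \<le> (A / C)\<^sup>2 * (1 - t u z ^ L)" if uz: "u \<in> X" "z \<in> X" for u z
  proof -
    have d1: "(\<Sum>a<?N. (cmod (\<phi> a x))\<^sup>2) = (\<Sum>\<alpha>\<in>I. v \<alpha> * (cmod (monom_at d \<alpha> (P x)))\<^sup>2)" for x
      unfolding sum.reindex_bij_betw[OF e, symmetric]
      by (intro sum.cong refl) (use v0 eI in \<open>auto simp: \<phi>_def norm_mult power_mult_distrib\<close>)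
    have d2: "(\<Sum>a<?N. \<phi> a u * cnj (\<phi> a z)) = (\<Sum>\<alpha>\<in>I. of_real (v \<alpha>) * (monom_at d \<alpha> (P u) * cnj (monom_at d \<alpha> (P z))))"
      unfolding sum.reindex_bij_betw[OF e, symmetric]
    proof (intro sum.cong refl)
      fix a assume "a \<in> {..<?N}"
      then have "complex_of_real (sqrt (v (e a))) * of_real (sqrt (v (e a))) = of_real (v (e a))"
        using v0 eI by (simp flip: of_real_mult)
      moreover have "\<phi> a u * cnj (\<phi> a z) = (complex_of_real (sqrt (v (e a))) * of_real (sqrt (v (e a)))) * (monom_at d (e a) (P u) * cnj (monom_at d (e a) (P z)))"
        by (simp add: \<phi>_def mult_ac)
      ultimately show "\<phi> a u * cnj (\<phi> a z) = of_real (v (e a)) * (monom_at d (e a) (P u) * cnj (monom_at d (e a) (P z)))"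
        by simp
    qed
    have w1: "(\<Sum>\<alpha>\<in>I. w \<alpha> * (cmod (monom_at d \<alpha> (P x)))\<^sup>2) = A / C" if "x \<in> X" for x
      using sum_multinom_monom_sq[OF unit[OF that], of L]
      unfolding w_def I_def mult.assoc sum_distrib_left[symmetric] by simp
    have w2: "(\<Sum>\<alpha>\<in>I. of_real (w \<alpha>) * (monom_at d \<alpha> (P u) * cnj (monom_at d \<alpha> (P z)))) = of_real (A / C) * hinner d (P u) (P z) ^ L"
      unfolding hinner_power w_def I_def of_real_mult mult.assoc sum_distrib_left ..
    have "(\<Sum>a<?N. (cmod (\<phi> a u))\<^sup>2) * (\<Sum>a<?N. (cmod (\<phi> a z))\<^sup>2) - (cmod (\<Sum>a<?N. \<phi> a u * cnj (\<phi> a z)))\<^sup>2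
      \<le> (A / C) * (A / C) - (cmod (of_real (A / C) * hinner d (P u) (P z) ^ L))\<^sup>2"
      unfolding d1 d2 using lagrange_mono[of I v w "\<lambda>\<alpha>. monom_at d \<alpha> (P u)" "\<lambda>\<alpha>. monom_at d \<alpha> (P z)"] v0 vw
      unfolding w1[OF uz(1)] w1[OF uz(2)] w2 by simp
    also have "\<dots> = (A / C)\<^sup>2 * (1 - t u z ^ L)"
    proof -
      have "(cmod (of_real (A / C) * hinner d (P u) (P z) ^ L))\<^sup>2 = (A / C)\<^sup>2 * t u z ^ L"
        unfolding norm_mult norm_power norm_of_real power_mult_distrib power2_abs t_def
        by (simp add: power_mult[symmetric] mult.commute)
      then show ?thesis by (simp only: right_diff_distrib power2_eq_square mult_1_right)
    qed
    finally show ?thesis .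
  qed
  obtain x where x: "\<And>i. i < ?N \<Longrightarrow> x i \<in> X" "slater \<phi> ?N x \<noteq> 0"
    and le: "(\<Sum>i<?N. \<Sum>j\<in>{..<?N}-{i}. F (x i) (x j)) \<le>
     (\<Sum>u\<in>X. \<Sum>z\<in>X. F u z * ((\<Sum>a<?N. (cmod (\<phi> a u))\<^sup>2) * (\<Sum>a<?N. (cmod (\<phi> a z))\<^sup>2)
         - (cmod (\<Sum>a<?N. \<phi> a u * cnj (\<phi> a z)))\<^sup>2))"
    using exists_configuration[of F] by blast
  note le
  also have "(\<Sum>u\<in>X. \<Sum>z\<in>X. F u z * ((\<Sum>a<?N. (cmod (\<phi> a u))\<^sup>2) * (\<Sum>a<?N. (cmod (\<phi> a z))\<^sup>2)
         - (cmod (\<Sum>a<?N. \<phi> a u * cnj (\<phi> a z)))\<^sup>2))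
    \<le> (\<Sum>u\<in>X. \<Sum>z\<in>X. (A / C)\<^sup>2 * ((\<Sum>m\<le>M. bincoeff m * (t u z ^ m - t u z ^ (m + L))) + real L * bincoeff (Suc M)))"
  proof (intro sum_mono)
    fix u z assume uz: "u \<in> X" "z \<in> X"
    have "F u z * ((\<Sum>a<?N. (cmod (\<phi> a u))\<^sup>2) * (\<Sum>a<?N. (cmod (\<phi> a z))\<^sup>2)
         - (cmod (\<Sum>a<?N. \<phi> a u * cnj (\<phi> a z)))\<^sup>2) \<le> F u z * ((A / C)\<^sup>2 * (1 - t u z ^ L))"
      using t01[OF uz] by (intro mult_left_mono kern uz) (simp add: F_def)
    also have "\<dots> = (A / C)\<^sup>2 * ((1 - t u z ^ L) / sqrt (1 - t u z))" by (simp add: F_def)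
    also have "\<dots> \<le> (A / C)\<^sup>2 * ((\<Sum>m\<le>M. bincoeff m * (t u z ^ m - t u z ^ (m + L))) + real L * bincoeff (Suc M))"
      using t01[OF uz] by (intro mult_left_mono truncated_kernel_bound) auto
    finally show "F u z * ((\<Sum>a<?N. (cmod (\<phi> a u))\<^sup>2) * (\<Sum>a<?N. (cmod (\<phi> a z))\<^sup>2)
         - (cmod (\<Sum>a<?N. \<phi> a u * cnj (\<phi> a z)))\<^sup>2)
      \<le> (A / C)\<^sup>2 * ((\<Sum>m\<le>M. bincoeff m * (t u z ^ m - t u z ^ (m + L))) + real L * bincoeff (Suc M))" .
  qed
  also have "\<dots> = (A / C)\<^sup>2 * ((\<Sum>m\<le>M. bincoeff m * ((\<Sum>u\<in>X. \<Sum>z\<in>X. t u z ^ m) - (\<Sum>u\<in>X. \<Sum>z\<in>X. t u z ^ (m + L)))) + C\<^sup>2 * (real L * bincoeff (Suc M)))"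
  proof -
    have "(\<Sum>u\<in>X. \<Sum>z\<in>X. \<Sum>m\<le>M. bincoeff m * (t u z ^ m - t u z ^ (m + L))) = (\<Sum>m\<le>M. \<Sum>u\<in>X. \<Sum>z\<in>X. bincoeff m * (t u z ^ m - t u z ^ (m + L)))"
      by (simp only: sum.swap[of _ "{..M}" X])
    also have "\<dots> = (\<Sum>m\<le>M. bincoeff m * ((\<Sum>u\<in>X. \<Sum>z\<in>X. t u z ^ m) - (\<Sum>u\<in>X. \<Sum>z\<in>X. t u z ^ (m + L))))"
      by (simp only: sum_distrib_left[symmetric] sum_subtractf[symmetric])
    finally show ?thesis
      unfolding sum_distrib_left[symmetric] sum.distrib by (simp add: C_def power2_eq_square)
  qed
  also have "\<dots> = (A / C)\<^sup>2 * (C\<^sup>2 * ((\<Sum>m\<le>M. bincoeff m * (grid_moment d n m - grid_moment d n (m + L))) + real L * bincoeff (Suc M)))"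
  proof -
    have "(\<Sum>u\<in>X. \<Sum>z\<in>X. t u z ^ m) = C\<^sup>2 * grid_moment d n m" if "m < Q" for m
      unfolding X_def t_def C_def P_def by (rule sum_grid_hinner_power[OF that])
    then have "(\<Sum>m\<le>M. bincoeff m * ((\<Sum>u\<in>X. \<Sum>z\<in>X. t u z ^ m) - (\<Sum>u\<in>X. \<Sum>z\<in>X. t u z ^ (m + L))))
      = (\<Sum>m\<le>M. C\<^sup>2 * (bincoeff m * (grid_moment d n m - grid_moment d n (m + L))))"
      by (intro sum.cong refl) (simp add: Q_def algebra_simps)
    then show ?thesis by (simp only: sum_distrib_left[symmetric] distrib_left)
  qed
  also have "\<dots> = A\<^sup>2 * ((\<Sum>m\<le>M. bincoeff m * (grid_moment d n m - grid_moment d n (m + L))) + real L * bincoeff (Suc M))"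
    using C0 by (simp add: power_divide)
  finally have fin: "(\<Sum>i<?N. \<Sum>j\<in>{..<?N}-{i}. F (x i) (x j)) \<le> A\<^sup>2 * ((\<Sum>m\<le>M. bincoeff m * (grid_moment d n m - grid_moment d n (m + L))) + real L * bincoeff (Suc M))" .
  \<comment> \<open>Two parallel points would give proportional columns, with the L-th power of
    their inner product as the factor, and the determinant would vanish.\<close>
  have lt1: "cmod (hinner d (P (x i)) (P (x j))) < 1" if ij: "i < ?N" "j < ?N" "i \<noteq> j" for i j
  proof (rule ccontr)
    assume "\<not> ?thesis"
    moreover have "cmod (hinner d (P (x i)) (P (x j))) \<le> 1"
      using t01(2)[OF x(1)[OF ij(1)] x(1)[OF ij(2)]] by (simp add: t_def abs_square_le_1)
    ultimately have h1: "cmod (hinner d (P (x i)) (P (x j))) = 1" by simp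
    have "slater \<phi> ?N x = 0"
    proof (rule slater_eq_0[OF ij])
      fix a assume "a < ?N"
      then have "monom_at d (e a) (P (x i)) = hinner d (P (x i)) (P (x j)) ^ L * monom_at d (e a) (P (x j))"
        using eI hinner_eq_1_imp_parallel[OF unit[OF x(1)[OF ij(1)]] unit[OF x(1)[OF ij(2)]] h1]
        by (intro monom_at_scale) (auto simp: I_def)
      then show "\<phi> a (x i) = hinner d (P (x i)) (P (x j)) ^ L * \<phi> a (x j)"
        by (simp add: \<phi>_def)
    qed
    then show False using x(2) by simp
  qed
  show ?thesis
    by (rule exI[of _ "\<lambda>i. P (x i)"]) (use fin lt1 unit x(1) in \<open>auto simp: F_def t_def\<close>)
qed

text \<open>The reciprocal of \<open>simplex_moment\<close> tends to \<open>N d L\<close> times the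
  multinomial coefficient, so any A > N is eventually admissible, for all of the finitely many
  \<open>\<alpha>\<close> at once. The strict bound \<open>B\<close> leaves room for such an
  \<open>A\<close> and then for a finite grid size.\<close>

lemma exists_configuration_limit:
  fixes B :: real
  defines "N \<equiv> (\<lambda>d L. (L + d) choose d)"
  assumes B: "(real (N d L))\<^sup>2 * ((\<Sum>m\<le>M. bincoeff m * (1 / real ((m + d) choose d) - 1 / real ((m + L + d) choose d)))
      + real L * bincoeff (Suc M)) < B"
  shows "\<exists>p. (\<forall>i < N d L. (\<Sum>k\<le>d. (cmod (p i k))\<^sup>2) = 1)
    \<and> (\<forall>i < N d L. \<forall>j < N d L. i \<noteq> j \<longrightarrow> cmod (hinner d (p i) (p j)) < 1)
    \<and> (\<Sum>i < N d L. \<Sum>j\<in>{..<N d L}-{i}. 1 / sqrt (1 - (cmod (hinner d (p i) (p j)))\<^sup>2)) \<le> B"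
proof -
  define J where "J = (\<Sum>m\<le>M. bincoeff m * (1 / real ((m + d) choose d) - 1 / real ((m + L + d) choose d))) + real L * bincoeff (Suc M)"
  have N0: "real (N d L) > 0" by (simp add: N_def)
  \<comment> \<open>A sequence decreasing to \<open>N d L\<close> provides an \<open>A\<close> above
    \<open>N d L\<close> that still satisfies A^2 J < B.\<close>
  have "(\<lambda>i. (real (N d L) + 1 / real (Suc i))\<^sup>2 * J) \<longlonglongrightarrow> (real (N d L) + 0)\<^sup>2 * J"
    by (intro tendsto_intros LIMSEQ_inverse_real_of_nat[unfolded inverse_eq_divide])
  moreover have "(real (N d L) + 0)\<^sup>2 * J < B" using B by (simp add: J_def)
  ultimately have "eventually (\<lambda>i. (real (N d L) + 1 / real (Suc i))\<^sup>2 * J < B) sequentially"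
    by (rule order_tendstoD)
  then obtain i where i: "(real (N d L) + 1 / real (Suc i))\<^sup>2 * J < B"
    by (auto simp: eventually_sequentially)
  define A where "A = real (N d L) + 1 / real (Suc i)"
  have A: "A > real (N d L)" by (simp add: A_def)
  have ev1: "eventually (\<lambda>n. \<forall>\<alpha>\<in>multi_idx d L. simplex_moment d n \<alpha> > 0 \<and> 1 / simplex_moment d n \<alpha> \<le> A * multinom d L \<alpha>) sequentially"
  proof (intro eventually_ball_finite ballI finite_multi_idx)
    fix \<alpha> assume \<alpha>: "\<alpha> \<in> multi_idx d L"
    define l where "l = (\<Prod>k\<le>d. fact (\<alpha> k)) * fact d / (fact (d + L) :: real)"
    have l: "l > 0" by (auto simp: l_def intro!: mult_pos_pos divide_pos_pos prod_pos)
    have lim: "(\<lambda>n. simplex_moment d n \<alpha>) \<longlonglongrightarrow> l" unfolding l_def by (rule simplex_moment_tendsto[OF \<alpha>])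
    have "1 / l = real (N d L) * multinom d L \<alpha>"
      by (simp add: l_def multinom_def N_def binomial_fact add.commute)
    also have "\<dots> < A * multinom d L \<alpha>" using A by (intro mult_strict_right_mono multinom_pos)
    finally have "1 / l < A * multinom d L \<alpha>" .
    moreover have "(\<lambda>n. 1 / simplex_moment d n \<alpha>) \<longlonglongrightarrow> 1 / l" using l by (intro tendsto_intros lim) auto
    ultimately have "eventually (\<lambda>n. 1 / simplex_moment d n \<alpha> < A * multinom d L \<alpha>) sequentially"
      by (intro order_tendstoD)
    moreover have "eventually (\<lambda>n. simplex_moment d n \<alpha> > 0) sequentially"
      using lim l by (intro order_tendstoD)
    ultimately show "eventually (\<lambda>n. simplex_moment d n \<alpha> > 0 \<and> 1 / simplex_moment d n \<alpha> \<le> A * multinom d L \<alpha>) sequentially"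
      by eventually_elim simp
  qed
  have "(\<lambda>n. A\<^sup>2 * ((\<Sum>m\<le>M. bincoeff m * (grid_moment d n m - grid_moment d n (m + L))) + real L * bincoeff (Suc M))) \<longlonglongrightarrow> A\<^sup>2 * J"
    unfolding J_def by (intro tendsto_intros grid_moment_tendsto)
  then have ev2: "eventually (\<lambda>n. A\<^sup>2 * ((\<Sum>m\<le>M. bincoeff m * (grid_moment d n m - grid_moment d n (m + L))) + real L * bincoeff (Suc M)) < B) sequentially"
    by (rule order_tendstoD) (use i in \<open>simp add: A_def\<close>)
  obtain n where n: "n > 0" "\<forall>\<alpha>\<in>multi_idx d L. simplex_moment d n \<alpha> > 0 \<and> 1 / simplex_moment d n \<alpha> \<le> A * multinom d L \<alpha>"
     "A\<^sup>2 * ((\<Sum>m\<le>M. bincoeff m * (grid_moment d n m - grid_moment d n (m + L))) + real L * bincoeff (Suc M)) < B"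
    using eventually_happens[OF eventually_conj[OF eventually_gt_at_top[of 0] eventually_conj[OF ev1 ev2]]] by auto
  obtain p where p: "\<forall>i < N d L. (\<Sum>k\<le>d. (cmod (p i k))\<^sup>2) = 1"
    "\<forall>i < N d L. \<forall>j < N d L. i \<noteq> j \<longrightarrow> cmod (hinner d (p i) (p j)) < 1"
    "(\<Sum>i < N d L. \<Sum>j\<in>{..<N d L}-{i}. 1 / sqrt (1 - (cmod (hinner d (p i) (p j)))\<^sup>2))
       \<le> A\<^sup>2 * ((\<Sum>m\<le>M. bincoeff m * (grid_moment d n m - grid_moment d n (m + L))) + real L * bincoeff (Suc M))"
    using exists_grid_configuration[OF n(1), of d L A M] n(2) unfolding N_def by blast
  show ?thesis by (intro exI[of _ p] conjI p(1,2) order_trans[OF p(3)] less_imp_le[OF n(3)])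
qed

text \<open>The sum is an integral of partial sums against the density \<open>d (1 - t) ^ (d - 1)\<close> of
  \<open>t\<close> on the complex projective space.\<close>
lemma truncated_moment_bound:
  assumes d: "d \<ge> 1"
  shows "(\<Sum>m\<le>M. bincoeff m * (1 / real ((m + d) choose d) - 1 / real ((m + L + d) choose d)))
    \<le> 2 * real d / (2 * real d - 1) - real d * Beta (real L + 1) (real d - 1/2)"
proof -
  have bint: "((\<lambda>t. t powr (a - 1) * (1 - t) powr (b - 1)) has_integral Beta a b) {0<..<1}" if "a > 0" "b > 0" for a b :: real
    using has_integral_Beta_real[OF that] by (simp add: has_integral_Icc_iff_Ioo)
  have b: "1 / real ((m + d) choose d) = real d * Beta (real m + 1) (real d)" for m
  proof -
    have "Beta (real m + 1) (real d) = fact m * fact (d - 1) / fact (m + d)"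
      using Gamma_fact[of m, where 'a=real] Gamma_fact[of "d - 1", where 'a=real] Gamma_fact[of "m + d", where 'a=real] d
      by (simp add: Beta_def of_nat_diff add_ac)
    moreover have "(fact d :: real) = real d * fact (d - 1)" using d by (simp add: fact_reduce)
    ultimately show ?thesis by (simp add: binomial_fact)
  qed
  have i1: "((\<lambda>t. \<Sum>m\<le>M. bincoeff m * (real d * (t powr (real m + 1 - 1) * (1 - t) powr (real d - 1))
        - real d * (t powr (real (m + L) + 1 - 1) * (1 - t) powr (real d - 1))))
      has_integral (\<Sum>m\<le>M. bincoeff m * (real d * Beta (real m + 1) (real d) - real d * Beta (real (m + L) + 1) (real d)))) {0<..<1}"
    using d by (intro has_integral_sum has_integral_mult_right has_integral_diff bint) auto
  have i2: "((\<lambda>t. real d * (t powr (1 - 1) * (1 - t) powr (real d - 1/2 - 1)) - real d * (t powr (real L + 1 - 1) * (1 - t) powr (real d - 1/2 - 1)))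
      has_integral (real d * Beta 1 (real d - 1/2) - real d * Beta (real L + 1) (real d - 1/2))) {0<..<1}"
    using d by (intro has_integral_mult_right has_integral_diff bint) auto
  have "(\<Sum>m\<le>M. bincoeff m * (real d * Beta (real m + 1) (real d) - real d * Beta (real (m + L) + 1) (real d)))
     \<le> real d * Beta 1 (real d - 1/2) - real d * Beta (real L + 1) (real d - 1/2)"
  proof (rule has_integral_le[OF i1 i2])
    fix t :: real assume t: "t \<in> {0<..<1}"
    then have t01: "0 < t" "t < 1" by auto
    \<comment> \<open>All terms of the series are nonnegative, so its partial sums lie below the
      kernel. Truncation thus costs only the error term of
      \<open>truncated_kernel_bound\<close>.\<close>
    have s: "(\<Sum>m\<le>M. bincoeff m * (t ^ m - t ^ (m + L))) \<le> (1 - t ^ L) / sqrt (1 - t)"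
    proof -
      have g0: "0 \<le> bincoeff m * (t ^ m - t ^ (m + L))" for m
        using t01 by (intro mult_nonneg_nonneg bincoeff_nonneg) (simp add: power_decreasing)
      have sm: "(\<lambda>m. bincoeff m * (t ^ m - t ^ (m + L))) sums ((1 - t ^ L) / sqrt (1 - t))"
        using t01 by (intro bincoeff_diff_sums) auto
      then have "(\<Sum>m\<le>M. bincoeff m * (t ^ m - t ^ (m + L))) \<le> (\<Sum>m. bincoeff m * (t ^ m - t ^ (m + L)))"
        by (intro sum_le_suminf) (auto simp: sums_iff g0)
      then show ?thesis using sm by (simp add: sums_iff)
    qed
    have p: "t powr (real m + 1 - 1) = t ^ m" for m using t01 by (simp add: powr_realpow)
    have q: "(1 - t) powr (real d - 1/2 - 1) = (1 - t) powr (real d - 1) / sqrt (1 - t)"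
      using t01 by (simp add: powr_half_sqrt[symmetric] powr_diff[symmetric])
    have "(\<Sum>m\<le>M. bincoeff m * (real d * (t powr (real m + 1 - 1) * (1 - t) powr (real d - 1))
        - real d * (t powr (real (m + L) + 1 - 1) * (1 - t) powr (real d - 1))))
      = real d * (1 - t) powr (real d - 1) * (\<Sum>m\<le>M. bincoeff m * (t ^ m - t ^ (m + L)))"
      unfolding p sum_distrib_left by (intro sum.cong refl) (simp add: algebra_simps)
    also have "\<dots> \<le> real d * (1 - t) powr (real d - 1) * ((1 - t ^ L) / sqrt (1 - t))"
      by (intro mult_left_mono s) auto
    also have "\<dots> = real d * (t powr (1 - 1) * (1 - t) powr (real d - 1/2 - 1)) - real d * (t powr (real L + 1 - 1) * (1 - t) powr (real d - 1/2 - 1))"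
      unfolding p q using t01 by (simp add: algebra_simps diff_divide_distrib)
    finally show "(\<Sum>m\<le>M. bincoeff m * (real d * (t powr (real m + 1 - 1) * (1 - t) powr (real d - 1))
        - real d * (t powr (real (m + L) + 1 - 1) * (1 - t) powr (real d - 1))))
      \<le> real d * (t powr (1 - 1) * (1 - t) powr (real d - 1/2 - 1)) - real d * (t powr (real L + 1 - 1) * (1 - t) powr (real d - 1/2 - 1))" .
  qed
  moreover have "real d * Beta 1 (real d - 1/2) = 2 * real d / (2 * real d - 1)"
  proof -
    have z: "real d - 1/2 > 0" using d by simp
    have "Gamma (real d - 1/2 + 1) = (real d - 1/2) * Gamma (real d - 1/2)"
      using z by (intro Gamma_plus1) (auto elim!: nonpos_Ints_cases)
    then have "Beta 1 (real d - 1/2) = 1 / (real d - 1/2)"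
      using less_imp_neq[OF Gamma_real_pos[OF z]] z by (simp add: Beta_def add_ac)
    then show ?thesis using z by (simp add: field_simps)
  qed
  ultimately show ?thesis unfolding b by simp
qed

lemma min_energy_upper_bound:
  fixes d L k :: nat
  defines "N \<equiv> (L + d) choose d"
  assumes d: "d \<ge> 1" and k: "k > 0"
  shows "min_energy (2 * d + 2) 2 (N * k) \<le> real N * real k ^ 3 / 12
    + (real k)\<^sup>2 * (real N)\<^sup>2 * (real d / (2 * real d - 1) - real d / 2 * Beta (real L + 1) (real d - 1/2))"
proof -
  define G where "G = 2 * real d / (2 * real d - 1) - real d * Beta (real L + 1) (real d - 1/2)"
  have step: "min_energy (2 * d + 2) 2 (N * k) \<le> real N * real k ^ 3 / 12
      + (real k)\<^sup>2 * (((real N)\<^sup>2 * (G + real L * bincoeff (Suc M)) + 1 / real (Suc M)) / 2)" for M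
  proof -
    \<comment> \<open>The summand \<open>1 / real (Suc M)\<close> supplies the strict inequality
      required by \<open>exists_configuration_limit\<close> and disappears as M grows.\<close>
    define B where "B = (real N)\<^sup>2 * (G + real L * bincoeff (Suc M)) + 1 / real (Suc M)"
    have "(real N)\<^sup>2 * ((\<Sum>m\<le>M. bincoeff m * (1 / real ((m + d) choose d) - 1 / real ((m + L + d) choose d))) + real L * bincoeff (Suc M))
        \<le> (real N)\<^sup>2 * (G + real L * bincoeff (Suc M))"
      unfolding G_def by (intro mult_left_mono add_right_mono truncated_moment_bound d) auto
    also have "\<dots> < B" by (simp add: B_def)
    finally obtain p where p: "\<And>i. i < N \<Longrightarrow> (\<Sum>k\<le>d. (cmod (p i k))\<^sup>2) = 1"
      "\<And>i j. i < N \<Longrightarrow> j < N \<Longrightarrow> i \<noteq> j \<Longrightarrow> cmod (hinner d (p i) (p j)) < 1"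
      "(\<Sum>i < N. \<Sum>j\<in>{..<N}-{i}. 1 / sqrt (1 - (cmod (hinner d (p i) (p j)))\<^sup>2)) \<le> B"
      using exists_configuration_limit[of L d M B] unfolding N_def by blast
    have "min_energy (2 * d + 2) 2 (N * k) \<le> real N * (real k * (real k ^ 2 - 1) / 12)
      + (real k)\<^sup>2 * (\<Sum>i<N. \<Sum>j\<in>{..<N}-{i}. 1 / (2 * sqrt (1 - (cmod (hinner d (p i) (p j)))\<^sup>2)))"
      by (rule min_energy_le_fibres[OF p(1,2) k])
    also have "(\<Sum>i<N. \<Sum>j\<in>{..<N}-{i}. 1 / (2 * sqrt (1 - (cmod (hinner d (p i) (p j)))\<^sup>2)))
       = (\<Sum>i<N. \<Sum>j\<in>{..<N}-{i}. 1 / sqrt (1 - (cmod (hinner d (p i) (p j)))\<^sup>2)) / 2"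
      by (simp add: sum_divide_distrib mult.commute)
    also have "real N * (real k * (real k ^ 2 - 1) / 12) + (real k)\<^sup>2 * ((\<Sum>i<N. \<Sum>j\<in>{..<N}-{i}. 1 / sqrt (1 - (cmod (hinner d (p i) (p j)))\<^sup>2)) / 2)
       \<le> real N * real k ^ 3 / 12 + (real k)\<^sup>2 * (B / 2)"
    proof (rule add_mono)
      have "real N * (real k * (real k ^ 2 - 1)) \<le> real N * real k ^ 3"
        by (intro mult_left_mono) (auto simp: power2_eq_square power3_eq_cube algebra_simps)
      then show "real N * (real k * (real k ^ 2 - 1) / 12) \<le> real N * real k ^ 3 / 12" by simp
      show "(real k)\<^sup>2 * ((\<Sum>i<N. \<Sum>j\<in>{..<N}-{i}. 1 / sqrt (1 - (cmod (hinner d (p i) (p j)))\<^sup>2)) / 2) \<le> (real k)\<^sup>2 * (B / 2)"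
        by (intro mult_left_mono divide_right_mono p(3)) auto
    qed
    finally show ?thesis by (simp add: B_def)
  qed
  have "(\<lambda>M. real N * real k ^ 3 / 12 + (real k)\<^sup>2 * (((real N)\<^sup>2 * (G + real L * bincoeff (Suc M)) + 1 / real (Suc M)) / 2))
    \<longlonglongrightarrow> real N * real k ^ 3 / 12 + (real k)\<^sup>2 * (((real N)\<^sup>2 * (G + real L * 0) + 0) / 2)"
    by (intro tendsto_intros LIMSEQ_Suc[OF bincoeff_tendsto_0] LIMSEQ_inverse_real_of_nat[unfolded inverse_eq_divide]) auto
  then have "min_energy (2 * d + 2) 2 (N * k) \<le> real N * real k ^ 3 / 12 + (real k)\<^sup>2 * (((real N)\<^sup>2 * (G + real L * 0) + 0) / 2)"
    by (rule tendsto_lowerbound) (use step in auto)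
  moreover have "G / 2 = real d / (2 * real d - 1) - real d / 2 * Beta (real L + 1) (real d - 1/2)"
    using d by (simp add: G_def field_simps)
  ultimately show ?thesis by (simp add: mult.assoc flip: times_divide_eq_right)
qed

section \<open>Asymptotics\<close>

text \<open>Legendre's duplication formula splits Gamma (2d), and the Gamma factors cancel. The
  result is exactly the leading constant of \<open>min_energy_upper_bound\<close>, so the terms of
  order n^2 in \<open>C_const\<close> cancel without remainder.\<close>

lemma V_sphere_2:
  assumes d: "d \<ge> 1"
  shows "V_sphere (2 * d + 1) 2 = real d / (2 * real d - 1)"
proof -
  have z: "real d - 1/2 > 0" "real d > 0" using d by auto
  have half: "Gamma (real d + 1/2) = (real d - 1/2) * Gamma (real d - 1/2)"
  proof -
    have "real d - 1/2 \<notin> \<int>\<^sub>\<le>\<^sub>0" using z by (auto elim!: nonpos_Ints_cases)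
    then show ?thesis using Gamma_plus1[of "real d - 1/2"] by (simp add: add.commute)
  qed
  have dup: "Gamma (real d) * Gamma (real d + 1/2) = 2 powr (1 - 2 * real d) * sqrt pi * Gamma (2 * real d)"
  proof -
    have "complex_of_real (Gamma (real d) * Gamma (real d + 1/2))
      = Gamma (of_real (real d)) * Gamma (of_real (real d) + 1/2)"
      by (simp flip: Gamma_complex_of_real)
    also have "\<dots> = exp ((1 - 2 * of_real (real d)) * of_real (ln 2)) * of_real (sqrt pi) * Gamma (2 * of_real (real d))"
    proof (rule Gamma_legendre_duplication)
      show "complex_of_real (real d) \<notin> \<int>\<^sub>\<le>\<^sub>0" using z by (auto elim!: nonpos_Ints_cases simp: complex_eq_iff)
      show "complex_of_real (real d) + 1/2 \<notin> \<int>\<^sub>\<le>\<^sub>0" using z by (auto elim!: nonpos_Ints_cases simp: complex_eq_iff)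
    qed
    also have "\<dots> = complex_of_real (exp ((1 - 2 * real d) * ln 2) * sqrt pi * Gamma (2 * real d))"
      by (simp flip: Gamma_complex_of_real exp_of_real)
    finally show ?thesis unfolding of_real_eq_iff by (simp add: powr_def)
  qed
  have G0: "Gamma (real d - 1/2) > 0" "Gamma (real d) > 0" "Gamma (2 * real d) > 0" using z by auto
  have d1: "Gamma (real d + 1) = real d * Gamma (real d)"
    by (rule Gamma_plus1) (use z in \<open>auto elim!: nonpos_Ints_cases\<close>)
  have pw: "2 powr (2 * real d - 2) * 2 powr (1 - 2 * real d) = (1/2 :: real)"
    by (simp add: powr_add[symmetric] powr_minus_divide)
  have "V_sphere (2 * d + 1) 2 = 2 powr (2 * real d - 2) * Gamma (real d + 1) * Gamma (real d - 1/2) / (sqrt pi * Gamma (2 * real d))"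
    by (simp add: V_sphere_def add_divide_distrib diff_divide_distrib add.commute)
  also have "\<dots> = 2 powr (2 * real d - 2) * (real d * (Gamma (real d) * Gamma (real d + 1/2))) / ((real d - 1/2) * (sqrt pi * Gamma (2 * real d)))"
  proof -
    define h where "h = real d - 1/2"
    have "h \<noteq> 0" using z by (simp add: h_def)
    then show ?thesis unfolding half d1 h_def[symmetric] by simp
  qed
  also have "\<dots> = (2 powr (2 * real d - 2) * 2 powr (1 - 2 * real d)) * real d / (real d - 1/2)"
  proof -
    define h where "h = real d - 1/2"
    show ?thesis unfolding dup h_def[symmetric] using G0(3) by (simp add: mult_ac)
  qed
  also have "\<dots> = real d / (2 * real d - 1)" unfolding pw using z by (simp add: field_simps)
  finally show ?thesis .
qed

text \<open>For L > 0 the left-hand side is Euler's product L! L^z / (z (z+1) ... (z+L)), that is,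
  \<open>Gamma_series z L\<close>.\<close>

lemma Beta_power_tendsto:
  assumes z: "z > 0"
  shows "(\<lambda>L. Beta (real L + 1) z * real L powr z) \<longlonglongrightarrow> Gamma z"
proof -
  have "eventually (\<lambda>L. Gamma_series z L = Beta (real L + 1) z * real L powr z) sequentially"
    using eventually_gt_at_top[of 0]
  proof eventually_elim
    case (elim L)
    have "pochhammer z (L + 1) = Gamma (z + real (L + 1)) / Gamma z"
      using z by (intro pochhammer_Gamma) (auto elim!: nonpos_Ints_cases)
    moreover have "Gamma (1 + real L) = fact L" by (rule Gamma_fact)
    ultimately show ?case using elim by (simp add: Gamma_series_def Beta_def powr_def add_ac)
  qed
  then show ?thesis using Gamma_series_LIMSEQ[of z] by (rule Lim_transform_eventually[rotated])
qed

text \<open>Gathers the factors with exponent 1 - e under one base. That base is \<kappa> / d!, the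
  limit of n / L^(d + 1/2) along the chosen sizes n, as in \<open>optimal_value\<close>.\<close>

lemma bound_1p2_alt:
  fixes d :: nat
  defines "e \<equiv> 2 / (2 * real d + 1)" and "G \<equiv> Gamma (real d - 1/2)"
  assumes d: "d \<ge> 1"
  shows "bound_1p2 d = (3 * (2 * real d - 1) * G / (2 * (fact d)\<^sup>2)) powr (1 - e) * (2 * real d + 1) * G / 8"
proof -
  have G: "G > 0" unfolding G_def using d by (intro Gamma_real_pos) simp
  have d': "2 * real d - 1 > 0" using d by simp
  have f: "(fact d :: real) powr (2 - 2 * e) = ((fact d)\<^sup>2) powr (1 - e)"
  proof -
    have "((fact d)\<^sup>2 :: real) = fact d powr 2" by (simp add: powr_numeral)
    then show ?thesis by (simp only: powr_powr) (simp add: algebra_simps)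
  qed
  have "G powr (2 - e) = G powr (1 - e) * G" using G powr_add[of G "1 - e" 1] by simp
  moreover have "(2::real) powr (4 - e) = 2 powr (1 - e) * 8" using powr_add[of "2::real" "1 - e" 3] by simp
  moreover have "(3 * (2 * real d - 1) * G / (2 * (fact d)\<^sup>2)) powr (1 - e)
    = 3 powr (1 - e) * (2 * real d - 1) powr (1 - e) * G powr (1 - e) / (2 powr (1 - e) * ((fact d)\<^sup>2) powr (1 - e))"
  proof -
    have pw: "(3 * b * G / (2 * c)) powr s = 3 powr s * b powr s * G powr s / (2 powr s * c powr s)"
      if "b > 0" "c > 0" for b c s :: real
      using that G by (simp add: powr_divide powr_mult)
    show ?thesis by (rule pw) (use d' in auto)
  qed
  ultimately show ?thesis
    unfolding bound_1p2_def Let_def e_def[symmetric] G_def[symmetric] f by (simp add: mult_ac)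
qed

text \<open>With l = L, the substitutions are N = y l^d, k = x l^(1/2) and (d/2) Beta = Z / l^(d -
  1/2). Both numerator terms and the denominator then scale like l^(d + 3/2), which cancels.\<close>

lemma powr_scaling_identity:
  fixes y x Z l :: real and d :: nat
  defines "e \<equiv> 2 / (2 * real d + 1)"
  assumes "l > 0" "x > 0" "y > 0"
  shows "((x * l powr (1/2))\<^sup>2 * (y * l ^ d)\<^sup>2 * (Z / l powr (real d - 1/2)) - (y * l ^ d) * (x * l powr (1/2)) ^ 3 / 12)
      / ((y * l ^ d) * (x * l powr (1/2))) powr (1 + e)
    = (x\<^sup>2 * y\<^sup>2 * Z - y * x ^ 3 / 12) / (x * y) powr (1 + e)"
proof -
  have ld: "l ^ d = l powr real d" using assms by (simp add: powr_realpow)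
  have p2: "(l powr a)\<^sup>2 = l powr (2 * a)" and p3: "(l powr a) ^ 3 = l powr (3 * a)" for a
    by (simp_all add: powr_powr[symmetric] powr_numeral mult.commute[of _ a])
  have n1: "(x * l powr (1/2))\<^sup>2 * (y * l ^ d)\<^sup>2 * (Z / l powr (real d - 1/2)) = x\<^sup>2 * y\<^sup>2 * Z * l powr (real d + 3/2)"
  proof -
    have "l powr (2 * (1/2)) * l powr (2 * real d) / l powr (real d - 1/2) = l powr (real d + 3/2)"
      by (simp only: powr_add[symmetric] powr_diff[symmetric]) (simp add: algebra_simps)
    moreover have "x\<^sup>2 * A * (y\<^sup>2 * B) * (Z / C) = x\<^sup>2 * y\<^sup>2 * Z * (A * B / C)" for A B C by simp
    ultimately show ?thesis unfolding ld power_mult_distrib p2 by (simp only:)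
  qed
  have n2: "(y * l ^ d) * (x * l powr (1/2)) ^ 3 / 12 = y * x ^ 3 / 12 * l powr (real d + 3/2)"
  proof -
    have "l powr real d * l powr (3/2) = l powr (real d + 3/2)" by (simp only: powr_add[symmetric])
    then show ?thesis unfolding ld power_mult_distrib p3 by (simp add: mult_ac)
  qed
  have dn: "((y * l ^ d) * (x * l powr (1/2))) powr (1 + e) = (x * y) powr (1 + e) * l powr (real d + 3/2)"
  proof -
    have eq: "(y * l ^ d) * (x * l powr (1/2)) = (x * y) * l powr (real d + 1/2)"
      unfolding ld powr_add by (simp add: mult_ac)
    have "((y * l ^ d) * (x * l powr (1/2))) powr (1 + e) = (x * y) powr (1 + e) * (l powr (real d + 1/2)) powr (1 + e)"
      unfolding eq using assms(2-4) by (simp add: powr_mult)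
    moreover have "(real d + 1/2) * (1 + e) = real d + 3/2" unfolding e_def by (simp add: field_simps)
    ultimately show ?thesis by (simp only: powr_powr)
  qed
  have l: "l powr (real d + 3/2) \<noteq> 0" using assms by simp
  show ?thesis unfolding n1 n2 dn left_diff_distrib[symmetric] using l by simp
qed

text \<open>With y = 1 / d! and Z = d G / 2, the quotient as a function of \<kappa> is proportional
  to y Z \<kappa>^(1-e) - \<kappa>^(2-e) / 12. Its critical point is 12 y Z (1 - e) / (2 - e), and
  (1 - e) / (2 - e) = (2d - 1) / (4d) gives the stated \<open>\<kappa>\<close>.\<close>

lemma optimal_value:
  fixes d :: nat
  defines "e \<equiv> 2 / (2 * real d + 1)" and "G \<equiv> Gamma (real d - 1/2)"
  defines "\<kappa> \<equiv> 3/2 * (2 * real d - 1) * G / fact d"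
  assumes d: "d \<ge> 1"
  shows "(\<kappa>\<^sup>2 * (1 / fact d)\<^sup>2 * (real d / 2 * G) - (1 / fact d) * \<kappa> ^ 3 / 12) / (\<kappa> * (1 / fact d)) powr (1 + e) = bound_1p2 d"
proof -
  have G: "G > 0" unfolding G_def using d by (intro Gamma_real_pos) simp
  define q where "q = \<kappa> / fact d"
  have q: "q = 3 * (2 * real d - 1) * G / (2 * (fact d)\<^sup>2)" by (simp add: q_def \<kappa>_def power2_eq_square)
  have q0: "q > 0" unfolding q using G d by (intro divide_pos_pos mult_pos_pos) auto
  have "\<kappa>\<^sup>2 * (1 / fact d)\<^sup>2 * (real d / 2 * G) - (1 / fact d) * \<kappa> ^ 3 / 12 = q\<^sup>2 * (real d / 2 * G - \<kappa> * fact d / 12)"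
    by (simp add: q_def power2_eq_square power3_eq_cube field_simps)
  also have "real d / 2 * G - \<kappa> * fact d / 12 = (2 * real d + 1) * G / 8"
    by (simp add: \<kappa>_def field_simps)
  also have "q\<^sup>2 = q powr (1 - e) * q powr (1 + e)"
    using q0 by (simp add: powr_add[symmetric])
  finally have val: "(\<kappa>\<^sup>2 * (1 / fact d)\<^sup>2 * (real d / 2 * G) - (1 / fact d) * \<kappa> ^ 3 / 12) / q powr (1 + e) = q powr (1 - e) * ((2 * real d + 1) * G / 8)"
    using q0 by simp
  have kq: "\<kappa> * (1 / fact d) = q" by (simp add: q_def)
  show ?thesis unfolding kq val
    using bound_1p2_alt[OF d] unfolding e_def[symmetric] G_def[symmetric] q[symmetric] by simp
qed

section \<open>The limit of the bound as d tends to infinity\<close>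

lemma ln_fact_bounds:
  assumes "d \<ge> 1"
  shows "real d * ln (real d) - real d \<le> ln (fact d)"
    and "ln (fact d) \<le> real d * ln (real d) - real d + 1 + ln (real d)"
proof -
  have "real d * ln (real d) - real d \<le> ln (fact d) \<and> ln (fact d) \<le> real d * ln (real d) - real d + 1 + ln (real d)"
    using assms
  proof (induction d rule: nat_induct_at_least)
    case (Suc n)
    have n: "real n > 0" using Suc by simp
    \<comment> \<open>The induction rests on n s \<le> 1 \<le> (n + 1) s for this increment of the
      logarithm.\<close>
    define s where "s = ln (real (Suc n)) - ln (real n)"
    have lf: "ln (fact (Suc n)) = ln (real (Suc n)) + ln (fact n)"
      by (simp add: ln_mult)
    have "s = ln (1 + 1 / real n)"
      using ln_div[of "real (Suc n)" "real n"] n by (simp add: s_def add_divide_distrib add.commute)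
    then have "s \<le> 1 / real n" using n ln_add_one_self_le_self[of "1 / real n"] by simp
    then have up: "real n * s \<le> 1" using n by (simp add: field_simps)
    have r: "1 + (- 1 / real (Suc n)) = real n / real (Suc n)" by (simp add: field_simps)
    have "- s = ln (1 + (- 1 / real (Suc n)))"
      unfolding r s_def using n ln_div[of "real n" "real (Suc n)"] by simp
    also have "\<dots> \<le> - 1 / real (Suc n)" using n by (intro ln_add_one_self_le_self2) (simp add: field_simps)
    finally have lo: "real (Suc n) * s \<ge> 1" by (simp add: field_simps)
    have e: "ln (real (Suc n)) = ln (real n) + s" by (simp add: s_def)
    have E: "real (Suc n) * ln (real (Suc n)) = real n * ln (real n) + real n * s + ln (real (Suc n))"
    proof -
      have "real n * ln (real (Suc n)) = real n * ln (real n) + real n * s"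
        unfolding e by (simp only: distrib_left)
      then show ?thesis by (simp only: of_nat_Suc distrib_right mult_1_left)
    qed
    show ?case unfolding lf E using Suc.IH up lo e by (auto simp: algebra_simps)
  qed simp
  then show "real d * ln (real d) - real d \<le> ln (fact d)"
    and "ln (fact d) \<le> real d * ln (real d) - real d + 1 + ln (real d)" by auto
qed

text \<open>Euler's product for Gamma at -1/2; the factor d / (d - 1/2) accounts for the shift from
  Gamma (d + 1/2) to Gamma (d - 1/2).\<close>

lemma Gamma_half_ratio_tendsto:
  "(\<lambda>d. Gamma (real d - 1/2) * real d powr (3/2) / fact d) \<longlonglongrightarrow> 1"
proof -
  define z where "z = - (1/2 :: real)"
  have z: "z \<notin> \<int>\<^sub>\<le>\<^sub>0"
  proof
    assume "z \<in> \<int>\<^sub>\<le>\<^sub>0"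
    then obtain m :: int where "- (1/2 :: real) = of_int m" unfolding z_def by (auto elim!: nonpos_Ints_cases)
    then have "of_int (2 * m) = (-1 :: real)" by simp
    then have "2 * m = -1" by linarith
    then show False by presburger
  qed
  have Gz: "Gamma z \<noteq> 0" using z by (simp add: Gamma_eq_zero_iff)
  have lim: "(\<lambda>d. Gamma z / Gamma_series z d * (real d / (real d - 1/2))) \<longlonglongrightarrow> Gamma z / Gamma z * 1"
  proof (intro tendsto_mult tendsto_divide tendsto_const Gamma_series_LIMSEQ Gz)
    show "(\<lambda>d. real d / (real d - 1/2)) \<longlonglongrightarrow> 1" by real_asymp
  qed
  have ev: "eventually (\<lambda>d. Gamma z / Gamma_series z d * (real d / (real d - 1/2)) = Gamma (real d - 1/2) * real d powr (3/2) / fact d) sequentially"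
    using eventually_gt_at_top[of 0]
  proof eventually_elim
    case (elim d)
    have h: "real d - 1/2 > 0" using elim by simp
    have "Gamma (real d - 1/2 + 1) = (real d - 1/2) * Gamma (real d - 1/2)"
      by (rule Gamma_plus1) (use h in \<open>auto elim!: nonpos_Ints_cases\<close>)
    then have g: "Gamma (z + real (d + 1)) = (real d - 1/2) * Gamma (real d - 1/2)" by (simp add: z_def add_ac)
    have p: "pochhammer z (d + 1) = (real d - 1/2) * Gamma (real d - 1/2) / Gamma z"
      using pochhammer_Gamma[OF z, of "d + 1"] unfolding g .
    have ex: "exp (z * ln (real d)) = real d powr z" using elim by (simp add: powr_def)
    have pw: "real d powr (3/2) * real d powr z = real d"
      using elim by (simp add: powr_add[symmetric] z_def)
    have "Gamma (real d - 1/2) > 0" using h by (rule Gamma_real_pos)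
    then have "Gamma z / Gamma_series z d * (real d / (real d - 1/2)) = Gamma (real d - 1/2) * (real d / real d powr z) / fact d"
      unfolding Gamma_series_def p using h Gz elim by (simp add: ex field_simps)
    also have "real d / real d powr z = real d powr (3/2)" using pw elim by (simp add: field_simps)
    finally show ?case .
  qed
  show ?thesis using Lim_transform_eventually[OF lim ev] Gz by simp
qed

text \<open>Apart from a prefactor tending to 3/4, what remains is q^(-e) / d with e = 2 / (2d + 1).
  Its limit exp (-1) comes from the factor e^(-d) in Stirling's formula for d!, raised to a power
  close to 1/d.\<close>

lemma bound_1p2_tendsto: "bound_1p2 \<longlonglongrightarrow> 3 / (4 * exp 1)"
proof -
  define a where "a d = Gamma (real d - 1/2) * real d powr (3/2) / fact d" for d
  have a1: "a \<longlonglongrightarrow> 1" unfolding a_def[abs_def] by (rule Gamma_half_ratio_tendsto)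
  \<comment> \<open>The error of the crude Stirling approximation. It is of order ln d while
    \<open>e d\<close> is of order 1/d, so the product vanishes.\<close>
  define u where "u d = ln (fact d) - (real d * ln (real d) - real d)" for d
  define e where "e d = 2 / (2 * real d + 1)" for d :: nat
  have eu: "(\<lambda>d. e d * u d) \<longlonglongrightarrow> 0"
  proof (rule tendsto_sandwich[OF _ _ tendsto_const])
    show "(\<lambda>d. e d * (1 + ln (real d))) \<longlonglongrightarrow> 0" unfolding e_def by real_asymp
    show "\<forall>\<^sub>F d in sequentially. 0 \<le> e d * u d"
      using eventually_ge_at_top[of 1]
    proof eventually_elim
      case (elim d)
      then show ?case using ln_fact_bounds(1)[OF elim] by (simp add: e_def u_def)
    qed
    show "\<forall>\<^sub>F d in sequentially. e d * u d \<le> e d * (1 + ln (real d))"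
      using eventually_ge_at_top[of 1]
    proof eventually_elim
      case (elim d)
      then show ?case using ln_fact_bounds(2)[OF elim] by (intro mult_left_mono) (auto simp: e_def u_def)
    qed
  qed
  \<comment> \<open>The exponent is grouped so that the Stirling error and \<open>ln (a d)\<close>
    stand apart; the bracket simplifies to (2 ln d - 2d) / (2d + 1), which tends to -1.\<close>
  have main: "(\<lambda>d. e d * u d + (e d * (real d * ln (real d) - real d) + 3/2 * e d * ln (real d) - ln (real d))
     - e d * ln (3/2 * (2 * real d - 1)) - e d * ln (a d)) \<longlonglongrightarrow> 0 + (-1) - 0 - 0 * ln 1"
  proof (intro tendsto_add tendsto_diff eu tendsto_mult)
    show "(\<lambda>d. e d * (real d * ln (real d) - real d) + 3/2 * e d * ln (real d) - ln (real d)) \<longlonglongrightarrow> -1"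
      unfolding e_def by real_asymp
    show "(\<lambda>d. e d * ln (3/2 * (2 * real d - 1))) \<longlonglongrightarrow> 0" unfolding e_def by real_asymp
    show "e \<longlonglongrightarrow> 0" unfolding e_def by real_asymp
    show "(\<lambda>d. ln (a d)) \<longlonglongrightarrow> ln 1" by (intro tendsto_ln a1) simp
  qed
  have "(\<lambda>d. (3 * (2 * real d - 1) * (2 * real d + 1) / (16 * (real d)\<^sup>2)) * (a d)\<^sup>2 *
      exp (e d * u d + (e d * (real d * ln (real d) - real d) + 3/2 * e d * ln (real d) - ln (real d))
     - e d * ln (3/2 * (2 * real d - 1)) - e d * ln (a d))) \<longlonglongrightarrow> (3/4) * 1\<^sup>2 * exp (0 + (-1) - 0 - 0 * ln 1)"
  proof (intro tendsto_mult tendsto_power tendsto_exp a1 main)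
    show "(\<lambda>d. 3 * (2 * real d - 1) * (2 * real d + 1) / (16 * (real d)\<^sup>2)) \<longlonglongrightarrow> 3/4" by real_asymp
  qed
  also have "(3/4) * 1\<^sup>2 * exp (0 + (-1) - 0 - 0 * ln 1) = 3 / (4 * exp (1::real))"
    by (simp add: exp_minus field_simps)
  finally show ?thesis
  proof (rule Lim_transform_eventually)
    show "\<forall>\<^sub>F d in sequentially. (3 * (2 * real d - 1) * (2 * real d + 1) / (16 * (real d)\<^sup>2)) * (a d)\<^sup>2 *
      exp (e d * u d + (e d * (real d * ln (real d) - real d) + 3/2 * e d * ln (real d) - ln (real d))
     - e d * ln (3/2 * (2 * real d - 1)) - e d * ln (a d)) = bound_1p2 d"
      using eventually_ge_at_top[of 1]
    proof eventually_elim
      case (elim d)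
      define G where "G = Gamma (real d - 1/2)"
      define f where "f = (fact d :: real)"
      define D where "D = real d"
      define q where "q = 3 * (2 * D - 1) * G / (2 * f\<^sup>2)"
      have D: "D \<ge> 1" using elim by (simp add: D_def)
      have G0: "G > 0" unfolding G_def using elim by (intro Gamma_real_pos) simp
      have f0: "f > 0" by (simp add: f_def)
      have Ga: "G = a d * f / D powr (3/2)" using D by (simp add: a_def G_def f_def D_def)
      have a0: "a d > 0" using G0 f0 D by (simp add: a_def G_def[symmetric] f_def[symmetric] D_def[symmetric])
      have q0: "q > 0" unfolding q_def using G0 f0 D by (intro divide_pos_pos mult_pos_pos) auto
      have lnq: "ln q = ln (3/2 * (2 * D - 1)) + ln (a d) - 3/2 * ln D - ln f"
      proof -
        have "q = (3/2 * (2 * D - 1)) * a d / (D powr (3/2) * f)"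
          unfolding q_def Ga using f0 D by (simp add: power2_eq_square)
        also have "ln \<dots> = ln (3/2 * (2 * D - 1)) + ln (a d) - (3/2 * ln D + ln f)"
          using D a0 f0 by (simp only: ln_div ln_mult ln_powr mult_pos_pos powr_gt_zero) (simp add: ln_div ln_mult ln_powr)
        finally show ?thesis by simp
      qed
      have D32: "(D powr (3/2))\<^sup>2 = D ^ 3"
        using D by (simp add: powr_powr powr_realpow flip: powr_numeral)
      have "bound_1p2 d = q powr (1 - e d) * (2 * D + 1) * G / 8"
        using bound_1p2_alt[OF elim] by (simp add: q_def G_def f_def D_def e_def)
      also have "q powr (1 - e d) = q * exp (- e d * ln q)"
      proof -
        have "q powr (1 - e d) = exp (ln q + - e d * ln q)" using q0 by (simp add: powr_def algebra_simps)
        then show ?thesis using q0 by (simp only: exp_add exp_ln)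
      qed
      \<comment> \<open>The prefactor decays like 1/D and the exponential grows like D; moving a
        factor D between them gives each a finite limit.\<close>
      also have "q * exp (- e d * ln q) * (2 * D + 1) * G / 8 = (q * (2 * D + 1) * G / 8 * D) * (exp (- e d * ln q) / D)"
        using D by simp
      also have "q * (2 * D + 1) * G / 8 * D = 3 * (2 * D - 1) * (2 * D + 1) / (16 * D\<^sup>2) * (a d)\<^sup>2"
      proof -
        have "q * (2 * D + 1) * G / 8 * D = 3 * (2 * D - 1) * (2 * D + 1) / 16 * D * (G\<^sup>2 / f\<^sup>2)"
          by (simp add: q_def power2_eq_square)
        also have "G\<^sup>2 / f\<^sup>2 = (a d)\<^sup>2 / D ^ 3"
          unfolding Ga using f0 by (simp add: power_mult_distrib power_divide D32)
        finally show ?thesis using D by (simp add: power2_eq_square power3_eq_cube)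
      qed
      also have "exp (- e d * ln q) / D = exp (- e d * ln q - ln D)" using D by (simp add: exp_diff)
      also have "- e d * ln q - ln D = e d * u d + (e d * (D * ln D - D) + 3/2 * e d * ln D - ln D)
          - e d * ln (3/2 * (2 * D - 1)) - e d * ln (a d)"
        unfolding lnq u_def f_def[symmetric] D_def[symmetric] by (simp add: algebra_simps)
      finally show ?case by (simp add: D_def)
    qed
  qed
qed

text \<open>Along n = N L * k L the quotient \<open>C_const\<close> is bounded below by a continuous
  expression in the rescaled quantities \<open>x\<close>, \<open>y\<close>, \<open>Z\<close>, whose
  limits are \<kappa>, 1 / d! and (d/2) G.\<close>

lemma limsup_C_const_ge:
  assumes d: "d \<ge> 1"
  shows "limsup (\<lambda>n. ereal (C_const 2 (2 * d + 1) n)) \<ge> ereal (bound_1p2 d)"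
proof -
  define G where "G = Gamma (real d - 1/2)"
  define \<kappa> where "\<kappa> = 3/2 * (2 * real d - 1) * G / fact d"
  define e where "e = 2 / (2 * real d + 1)"
  define N where "N L = (L + d) choose d" for L
  \<comment> \<open>Adding 1 keeps \<open>k L\<close> positive also for small L; after division by
    sqrt L it is negligible.\<close>
  define k where "k L = nat \<lfloor>\<kappa> * sqrt (real L)\<rfloor> + 1" for L
  define \<beta> where "\<beta> L = Beta (real L + 1) (real d - 1/2)" for L
  define x where "x L = real (k L) / real L powr (1/2)" for L
  define y where "y L = real (N L) / real L ^ d" for L
  define Z where "Z L = real d / 2 * (\<beta> L * real L powr (real d - 1/2))" for L
  have G: "G > 0" unfolding G_def using d by (intro Gamma_real_pos) simp
  have \<kappa>: "\<kappa> > 0" unfolding \<kappa>_def using G d by (intro divide_pos_pos mult_pos_pos) auto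
  have kpos: "k L > 0" and Npos: "N L > 0" for L by (simp_all add: k_def N_def)
  have xlim: "x \<longlonglongrightarrow> \<kappa>"
  proof (rule tendsto_sandwich)
    show "(\<lambda>L. \<kappa> + 0 * real L) \<longlonglongrightarrow> \<kappa>" by simp
    show "(\<lambda>L. \<kappa> + 1 / real L powr (1/2)) \<longlonglongrightarrow> \<kappa>" by real_asymp
    have b: "\<kappa> * sqrt (real L) \<le> real (k L)" "real (k L) \<le> \<kappa> * sqrt (real L) + 1" for L
    proof -
      have "\<kappa> * sqrt (real L) \<ge> 0" using \<kappa> by simp
      then have "real (nat \<lfloor>\<kappa> * sqrt (real L)\<rfloor>) = of_int \<lfloor>\<kappa> * sqrt (real L)\<rfloor>" by simp
      then show "\<kappa> * sqrt (real L) \<le> real (k L)" "real (k L) \<le> \<kappa> * sqrt (real L) + 1"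
        unfolding k_def by linarith+
    qed
    have x: "x L = real (k L) / sqrt (real L)" for L by (simp add: x_def powr_half_sqrt)
    show "\<forall>\<^sub>F L in sequentially. \<kappa> + 0 * real L \<le> x L"
      using eventually_gt_at_top[of 0] by eventually_elim (use b(1) in \<open>simp add: x pos_le_divide_eq\<close>)
    show "\<forall>\<^sub>F L in sequentially. x L \<le> \<kappa> + 1 / real L powr (1/2)"
      using eventually_gt_at_top[of 0]
      by eventually_elim (use b(2) in \<open>simp add: x powr_half_sqrt pos_divide_le_eq distrib_right\<close>)
  qed
  have ylim: "y \<longlonglongrightarrow> 1 / fact d"
    unfolding y_def N_def by (rule choose_over_power_tendsto)
  have Zlim: "Z \<longlonglongrightarrow> real d / 2 * G"
    unfolding Z_def \<beta>_def G_def using d by (intro tendsto_intros Beta_power_tendsto) simp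
  have lim: "(\<lambda>L. ((x L)\<^sup>2 * (y L)\<^sup>2 * Z L - y L * x L ^ 3 / 12) / (x L * y L) powr (1 + e)) \<longlonglongrightarrow> bound_1p2 d"
  proof -
    have "(\<lambda>L. ((x L)\<^sup>2 * (y L)\<^sup>2 * Z L - y L * x L ^ 3 / 12) / (x L * y L) powr (1 + e)) \<longlonglongrightarrow>
      (\<kappa>\<^sup>2 * (1 / fact d)\<^sup>2 * (real d / 2 * G) - (1 / fact d) * \<kappa> ^ 3 / 12) / (\<kappa> * (1 / fact d)) powr (1 + e)"
      using \<kappa> by (intro tendsto_intros xlim ylim Zlim) auto
    then show ?thesis unfolding \<kappa>_def G_def e_def optimal_value[OF d] .
  qed
  have ge: "eventually (\<lambda>L. ereal (((x L)\<^sup>2 * (y L)\<^sup>2 * Z L - y L * x L ^ 3 / 12) / (x L * y L) powr (1 + e))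
      \<le> ereal (C_const 2 (2 * d + 1) (N L * k L))) sequentially"
    using eventually_gt_at_top[of 0]
  proof eventually_elim
    case (elim L)
    have l: "real L > 0" using elim by simp
    have kx: "real (k L) = x L * real L powr (1/2)" using l by (simp add: x_def)
    have Ny: "real (N L) = y L * real L ^ d" using l by (simp add: y_def)
    have Zb: "Z L / real L powr (real d - 1/2) = real d / 2 * \<beta> L" using l by (simp add: Z_def)
    have xy: "x L > 0" "y L > 0" using l kpos[of L] Npos[of L] by (auto simp: x_def y_def)
    have "((x L)\<^sup>2 * (y L)\<^sup>2 * Z L - y L * x L ^ 3 / 12) / (x L * y L) powr (1 + e)
      = ((real (k L))\<^sup>2 * (real (N L))\<^sup>2 * (real d / 2 * \<beta> L) - real (N L) * real (k L) ^ 3 / 12) / (real (N L) * real (k L)) powr (1 + e)"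
      using powr_scaling_identity[OF l xy, of d "Z L"] unfolding kx[symmetric] Ny[symmetric] Zb e_def by simp
    also have "\<dots> \<le> (V_sphere (2 * d + 1) 2 * (real (N L * k L))\<^sup>2 - min_energy (2 * d + 1 + 1) 2 (N L * k L)) / (real (N L) * real (k L)) powr (1 + e)"
    proof (rule divide_right_mono)
      have "min_energy (2 * d + 1 + 1) 2 (N L * k L) \<le> real (N L) * real (k L) ^ 3 / 12
        + (real (k L))\<^sup>2 * (real (N L))\<^sup>2 * (real d / (2 * real d - 1) - real d / 2 * \<beta> L)"
        using min_energy_upper_bound[OF d kpos[of L], of L] unfolding N_def \<beta>_def by simp
      then show "(real (k L))\<^sup>2 * (real (N L))\<^sup>2 * (real d / 2 * \<beta> L) - real (N L) * real (k L) ^ 3 / 12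
        \<le> V_sphere (2 * d + 1) 2 * (real (N L * k L))\<^sup>2 - min_energy (2 * d + 1 + 1) 2 (N L * k L)"
        unfolding V_sphere_2[OF d] by (simp add: power_mult_distrib right_diff_distrib mult_ac)
    qed simp
    also have "\<dots> = C_const 2 (2 * d + 1) (N L * k L)" by (simp add: C_const_def e_def add_ac)
    finally show ?case by simp
  qed
  \<comment> \<open>The sizes must form a genuine subsequence: \<open>k\<close> is nondecreasing and
    positive, and \<open>N\<close> increases strictly because d \<ge> 1.\<close>
  have mono: "strict_mono (\<lambda>L. N L * k L)"
  proof (rule strict_monoI_Suc)
    fix L
    have "sqrt (real L) \<le> sqrt (real (Suc L))" by simp
    then have "\<kappa> * sqrt (real L) \<le> \<kappa> * sqrt (real (Suc L))" using \<kappa> by simp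
    then have "k L \<le> k (Suc L)" unfolding k_def by (intro add_right_mono nat_mono floor_mono)
    moreover have "N L < N (Suc L)"
    proof -
      obtain d' where "d = Suc d'" using d by (cases d) auto
      then show ?thesis by (simp add: N_def)
    qed
    ultimately show "N L * k L < N (Suc L) * k (Suc L)" using kpos[of L]
      by (meson le_less_trans less_le_trans mult_le_mono2 mult_less_mono1 order_refl)
  qed
  have "ereal (bound_1p2 d) = limsup (\<lambda>L. ereal (((x L)\<^sup>2 * (y L)\<^sup>2 * Z L - y L * x L ^ 3 / 12) / (x L * y L) powr (1 + e)))"
    using lim by (intro lim_imp_Limsup[symmetric]) auto
  also have "\<dots> \<le> limsup (\<lambda>L. ereal (C_const 2 (2 * d + 1) (N L * k L)))"
    by (rule Limsup_mono[OF ge])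
  also have "\<dots> \<le> limsup (\<lambda>n. ereal (C_const 2 (2 * d + 1) n))"
    using limsup_subseq_mono[OF mono, of "\<lambda>n. ereal (C_const 2 (2 * d + 1) n)"] by (simp add: o_def)
  finally show ?thesis .
qed

theorem theorem1p2:
  shows "(\<forall>d::nat. d \<ge> 1 \<longrightarrow>
            limsup (\<lambda>n. ereal (C_const 2 (2 * d + 1) n)) \<ge> ereal (bound_1p2 d))
         \<and> (bound_1p2 \<longlonglongrightarrow> 3 / (4 * exp 1))"
  using limsup_C_const_ge bound_1p2_tendsto by blast

end
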